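(* Let $(W,S)$ be an arbitrary Coxeter system and $I\subseteq S$ an arbitrary subset, and define (with the notation of the context) the subgroup $B_I=\{w\in\widetilde{B}_I\mid \mathsf{A}(w)\in\mathcal{A}\}$ of $\widetilde{B}_I$. Then $g_A\in B_I$ for all $A\in\mathcal{A}$, the sequence $$1\to Y_I\hookrightarrow B_I\overset{\mathsf{A}}{\to}\mathcal{A}\to 1$$ is exact, and $\widetilde{B}_I=Z(W_I)\times B_I$ (internal direct product). Moreover, $$Z_W(W_I)=W^{\perp I}\rtimes(Z(W_I)\times B_I)=(Z(W_I)\times W^{\perp I})\rtimes B_I,$$ where $B_I$ acts on $W^{\perp I}$ by conjugation as automorphisms of the Coxeter system $(W^{\perp I},R^I)$ (i.e. preserving $R^I$).
   Context: **Coxeter groups.** $(W,S)$ is a Coxeter system, $S$ possibly infinite; $m_{s,t}$ is the order of $st$; $\Gamma$ is the Coxeter graph ($s\ne t$ adjacent iff $m_{s,t}\ge 3$, including $\infty$). $V$ is the real space with basis $\{\alpha_s\mid s\in S\}$ and form $\langle\alpha_s,\alpha_t\rangle=-\cos(\pi/m_{s,t})$ ($=-1$ if $m_{s,t}=\infty$); $W$ acts by $s\cdot v=v-2\langle\alpha_s,v\rangle\alpha_s$. $\Phi=\{w\cdot\alpha_s\}$ is the root system, $\Phi^+$ the positive roots, $\Phi^-=-\Phi^+$, $\Psi^{\pm}=\Psi\cap\Phi^{\pm}$ for $\Psi\subseteq\Phi$; $s_\gamma=wsw^{-1}$ for $\gamma=w\cdot\alpha_s$. For $J\subseteq S$, $W_J=\langle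 J\rangle$; $J$ is of finite type if $W_J$ is finite, and then $w_0(J)$ is the longest element of $W_J$. $J$ is irreducible if the full subgraph of $\Gamma$ on $J$ is connected; irreducible components of $J$ are the vertex sets of its connected components. An irreducible $J$ of finite type is of $(-1)$-type if $w_0(J)\in Z(W_J)$. For $J,K\subseteq S$, $J_{\sim K}$ is the union of those connected components of the full subgraph of $\Gamma$ on $J\cup K$ which meet $K$; $J_{\sim s}=J_{\sim\{s\}}$. $Z(\cdot)$ is the center, $Z_W(\cdot)$ the centralizer in $W$. **Orthogonal part.** For $J\subseteq S$, $\Phi^{\perp J}=\{\gamma\in\Phi\mid\langle\gamma,\alpha_s\rangle=0\ \forall s\in J\}$, $W^{\perp J}=\langle s_\gamma\mid\gamma\in\Phi^{\perp J}\rangle$. It is known that $(W^{\perp J},R^J)$ is a Coxeter system, where $R^J$ consists of the $s_\gamma$ with $\gamma\in(\Phi^{\perp J})^+$ such that in any expression $\gamma=\sum_i c_i\beta_i$ with $c_i>0$, $\beta_i\in(\Phi^{\perp J})^+$, all $\beta_i=\gamma$. **Groupoids.** Fix a set $\Lambda$ with $|\Lambda|=|I|$. $S^{(\Lambda)}$ is the set of injections $x:\Lambda\to S$, $x_\lambda=x(\lambda)$, $x_A=\{x_\lambda\mid\lambda\in A\}$, $[x]=x_\Lambda$. Fix $x_I\in S^{(\Lambda)}$ with $[x_I]=I$. For $x,y\in S^{(\Lambda)}$ put $C_{x,y}=\{w\in W\mid\alpha_{x_\lambda}=w\cdot\alpha_{y_\lambda}\ \forall\lambda\}$, and $\mathcal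 V(C)=\{x\mid C_{x,x_I}\ne\emptyset\}$; if $w\in C_{x,y}$ write $x=w\cdot y$. $Y_{x,y}=\{w\in C_{x,y}\mid w\cdot(\Phi^{\perp[y]})^+\subseteq\Phi^+\}$, $C_I=C_{x_I,x_I}$, $Y_I=Y_{x_I,x_I}$. **Graph and tree.** For $x\in\mathcal V(C)$ and $s\in S\smallsetminus[x]$ with $[x]_{\sim s}$ of finite type, let $w_x^s=w_0([x]_{\sim s})w_0([x]_{\sim s}\smallsetminus\{s\})$; there is a unique $y\in\mathcal V(C)$ with $w_x^s\in C_{y,x}$. $\mathcal C$ is the graph with vertex set $\mathcal V(C)$ and edges $w_x^s$ from $x$ to $w_x^s\cdot x$, where $w_x^s$ and its inverse $w_y^t$ ($y=w_x^s\cdot x$, $\{t\}=([x]\cup\{s\})\smallsetminus[y]$) are identified as the two orientations of one edge. $\mathcal Y^1$ is $\mathcal C$ with all loops deleted; it is connected. Fix a maximal tree $\mathcal T$ of $\mathcal Y^1$; $p_{z,y}$ is the non-backtracking path in $\mathcal T$ from $y$ to $z$. A path from $y$ to $z$ represents an element of $C_{z,y}\subseteq W$ (paths are written from right to left). **The groups $\widetilde{\mathcal A},\mathcal A$.** Say $A\subseteq\Lambda$ is of finite type, an irreducible component of $\Lambda$, of $(-1)$-type, if $(x_I)_A$ is so (an irreducible component of $I$, etc.). If $A$ is of finite type and a union of irreducible components of $\Lambda$, define $x_I{}^A\in S^{(\Lambda)}$ by $(x_I{}^A)_\lambda=w_0((x_I)_A)(x_I)_\lambda w_0((x_I)_A)$.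 $\widetilde{\mathcal A}$ is the set of such $A$ with $x_I{}^A\in\mathcal V(C)$; it is an elementary abelian $2$-group under symmetric difference. $\mathcal A$ is the subgroup of those $A\in\widetilde{\mathcal A}$ disjoint from every irreducible component of $\Lambda$ of $(-1)$-type. $\mathsf A:Z_W(W_I)\to\widetilde{\mathcal A}$ is the homomorphism $\mathsf A(w)=\{\lambda\in\Lambda\mid w\cdot\alpha_{(x_I)_\lambda}=-\alpha_{(x_I)_\lambda}\}$, and for $A\in\widetilde{\mathcal A}$, $g_A=p_{x_I,x_I{}^A}\,w_0((x_I)_A)\in Z_W(W_I)$. $\widetilde B_I=\{w\in Z_W(W_I)\mid w\cdot(\Phi^{\perp I})^+=(\Phi^{\perp I})^+\}$. *)

theory Defs
  imports
    Complex_Main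
    "HOL-Library.Poly_Mapping"
    "Graph_Theory.Graph_Theory"
    "HOL-Algebra.Algebra"
begin

section \<open>Group-theoretic notions\<close>

text \<open>A subgroup \<open>H\<close> of \<open>G\<close> is regarded as a group in its own right by writing
  \<open>G\<lparr>carrier := H\<rparr>\<close>.\<close>

definition centralizer :: "('a, 'm) monoid_scheme \<Rightarrow> 'a set \<Rightarrow> 'a set" where
  "centralizer G H = {g \<in> carrier G. \<forall>h\<in>H. g \<otimes>\<^bsub>G\<^esub> h = h \<otimes>\<^bsub>G\<^esub> g}"

definition center :: "('a, 'm) monoid_scheme \<Rightarrow> 'a set" where
  "center G = centralizer G (carrier G)"

definition internal_direct_product ::
    "('a, 'm) monoid_scheme \<Rightarrow> 'a set \<Rightarrow> 'a set \<Rightarrow> bool" where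
  "internal_direct_product G H K \<longleftrightarrow>
     H \<lhd> G \<and> K \<lhd> G \<and> H \<inter> K = {\<one>\<^bsub>G\<^esub>} \<and> H <#>\<^bsub>G\<^esub> K = carrier G"

definition internal_semidirect_product ::
    "('a, 'm) monoid_scheme \<Rightarrow> 'a set \<Rightarrow> 'a set \<Rightarrow> bool" where
  "internal_semidirect_product G N H \<longleftrightarrow>
     N \<lhd> G \<and> subgroup H G \<and> N \<inter> H = {\<one>\<^bsub>G\<^esub>} \<and> N <#>\<^bsub>G\<^esub> H = carrier G"

text \<open>Exactness of \<open>1 \<rightarrow> G \<rightarrow> H \<rightarrow> K \<rightarrow> 1\<close>. The library's exact
  sequences require all groups of the sequence to have elements of the same type.\<close>

definition short_exact_groups ::
    "('a, 'm) monoid_scheme \<Rightarrow> ('a \<Rightarrow> 'b) \<Rightarrow> ('b, 'n) monoid_scheme \<Rightarrow> ('b \<Rightarrow> 'c)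
      \<Rightarrow> ('c, 'p) monoid_scheme \<Rightarrow> bool" where
  "short_exact_groups G f H g K \<longleftrightarrow>
     group_hom G H f \<and> inj_on f (carrier G) \<and>
     group_hom H K g \<and> g ` carrier H = carrier K \<and>
     kernel H K g = f ` carrier G"

definition sym_diff_group :: "'l set set \<Rightarrow> 'l set monoid" where
  "sym_diff_group \<A> = \<lparr>carrier = \<A>, mult = (\<lambda>A B. sym_diff A B), one = {}\<rparr>"


section \<open>Coxeter systems\<close>

text \<open>The order of \<open>st\<close>; as for \<^const>\<open>group.ord\<close>, the value \<open>0\<close> stands for \<open>\<infinity>\<close>.\<close>

definition cox_m :: "('a, 'm) monoid_scheme \<Rightarrow> 'a \<Rightarrow> 'a \<Rightarrow> nat" where
  "cox_m W s t = group.ord W (s \<otimes>\<^bsub>W\<^esub> t)"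

definition word_prod :: "('a, 'm) monoid_scheme \<Rightarrow> 'a list \<Rightarrow> 'a" where
  "word_prod W ss = foldr (mult W) ss \<one>\<^bsub>W\<^esub>"

text \<open>Deletion of a factor \<open>(st)\<^sup>m\<close>, with \<open>m = m\<^bsub>s,t\<^esub>\<close>, from a word over \<open>S\<close>. For \<open>s = t\<close> this deletes
  \<open>ss\<close>, and for \<open>m = \<infinity>\<close> it does nothing.\<close>

definition coxeter_step :: "('a, 'm) monoid_scheme \<Rightarrow> 'a set \<Rightarrow> 'a list \<Rightarrow> 'a list \<Rightarrow> bool" where
  "coxeter_step W S u v \<longleftrightarrow>
     (\<exists>a b s t. set a \<subseteq> S \<and> set b \<subseteq> S \<and> s \<in> S \<and> t \<in> S \<and>
        u = a @ concat (replicate (cox_m W s t) [s, t]) @ b \<and> v = a @ b)"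

text \<open>\<open>W\<close> has the presentation with generators \<open>S\<close> and relations \<open>(st)\<^sup>m = 1\<close>, \<open>m = m\<^bsub>s,t\<^esub>\<close>: words over \<open>S\<close>
  represent the same element only if the relations transform one into the other. (Since the
  relations contain \<open>ss = 1\<close>, no inverse letters are needed.)\<close>

definition coxeter_system :: "('a, 'm) monoid_scheme \<Rightarrow> 'a set \<Rightarrow> bool" where
  "coxeter_system W S \<longleftrightarrow>
     group W \<and> S \<subseteq> carrier W \<and> generate W S = carrier W \<and>
     (\<forall>s\<in>S. group.ord W s = 2) \<and>
     (\<forall>u v. set u \<subseteq> S \<and> set v \<subseteq> S \<and> word_prod W u = word_prod W v
        \<longrightarrow> equivclp (coxeter_step W S) u v)"

definition word_length :: "('a, 'm) monoid_scheme \<Rightarrow> 'a set \<Rightarrow> 'a \<Rightarrow> nat" where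
  "word_length W S w = (LEAST n. \<exists>ss. set ss \<subseteq> S \<and> word_prod W ss = w \<and> length ss = n)"

definition finite_type :: "('a, 'm) monoid_scheme \<Rightarrow> 'a set \<Rightarrow> bool" where
  "finite_type W J \<longleftrightarrow> finite (generate W J)"

definition longest_elt :: "('a, 'm) monoid_scheme \<Rightarrow> 'a set \<Rightarrow> 'a set \<Rightarrow> 'a" where
  "longest_elt W S J =
     (THE w. w \<in> generate W J \<and> (\<forall>v \<in> generate W J. word_length W S v \<le> word_length W S w))"


subsection \<open>The Coxeter graph\<close>

definition cox_adj :: "('a, 'm) monoid_scheme \<Rightarrow> 'a set \<Rightarrow> 'a rel" where
  "cox_adj W J =
     {(s, t). s \<in> J \<and> t \<in> J \<and> s \<noteq> t \<and> (cox_m W s t = 0 \<or> 3 \<le> cox_m W s t)}"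

definition irreducible_subset :: "('a, 'm) monoid_scheme \<Rightarrow> 'a set \<Rightarrow> bool" where
  "irreducible_subset W J \<longleftrightarrow> J \<noteq> {} \<and> (\<forall>s\<in>J. \<forall>t\<in>J. (s, t) \<in> (cox_adj W J)\<^sup>*)"

definition irreducible_components :: "('a, 'm) monoid_scheme \<Rightarrow> 'a set \<Rightarrow> 'a set set" where
  "irreducible_components W J = J // (cox_adj W J)\<^sup>*"

definition minus_one_type :: "('a, 'm) monoid_scheme \<Rightarrow> 'a set \<Rightarrow> 'a set \<Rightarrow> bool" where
  "minus_one_type W S J \<longleftrightarrow>
     irreducible_subset W J \<and> finite_type W J \<and>
     longest_elt W S J \<in> center (W\<lparr>carrier := generate W J\<rparr>)"

text \<open>The set \<open>J\<^sub>\<sim>\<^sub>K\<close>.\<close>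

definition link_component :: "('a, 'm) monoid_scheme \<Rightarrow> 'a set \<Rightarrow> 'a set \<Rightarrow> 'a set" where
  "link_component W J K = \<Union> {C \<in> irreducible_components W (J \<union> K). C \<inter> K \<noteq> {}}"


subsection \<open>The geometric representation\<close>

text \<open>\<open>V\<close> consists of the finitely supported functions with support in \<open>S\<close>. They live in the type of
  all finitely supported functions, which is harmless since roots lie in \<open>V\<close>.\<close>

type_synonym 'a vec_space = "'a \<Rightarrow>\<^sub>0 real"

definition vscale :: "real \<Rightarrow> 'a vec_space \<Rightarrow> 'a vec_space" where
  "vscale c v = Poly_Mapping.map ((*) c) v"

definition simple_root :: "'a \<Rightarrow> 'a vec_space" where
  "simple_root s = Poly_Mapping.single s 1"

definition gram :: "('a, 'm) monoid_scheme \<Rightarrow> 'a \<Rightarrow> 'a \<Rightarrow> real" where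
  "gram W s t = (if cox_m W s t = 0 then -1 else - cos (pi / real (cox_m W s t)))"

definition vform :: "('a, 'm) monoid_scheme \<Rightarrow> 'a vec_space \<Rightarrow> 'a vec_space \<Rightarrow> real" where
  "vform W u v =
     (\<Sum>s \<in> Poly_Mapping.keys u. \<Sum>t \<in> Poly_Mapping.keys v.
        Poly_Mapping.lookup u s * Poly_Mapping.lookup v t * gram W s t)"

definition simple_act :: "('a, 'm) monoid_scheme \<Rightarrow> 'a \<Rightarrow> 'a vec_space \<Rightarrow> 'a vec_space" where
  "simple_act W s v = v - vscale (2 * vform W (simple_root s) v) (simple_root s)"

text \<open>The action of \<open>w\<close> is computed along an arbitrary word for \<open>w\<close>; the result is independent of
  this word because the maps \<open>simple_act W s\<close> satisfy the Coxeter relations on \<open>V\<close>.\<close>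

definition act :: "('a, 'm) monoid_scheme \<Rightarrow> 'a set \<Rightarrow> 'a \<Rightarrow> 'a vec_space \<Rightarrow> 'a vec_space" where
  "act W S w v = foldr (simple_act W) (SOME ss. set ss \<subseteq> S \<and> word_prod W ss = w) v"

definition roots :: "('a, 'm) monoid_scheme \<Rightarrow> 'a set \<Rightarrow> 'a vec_space set" where
  "roots W S = {act W S w (simple_root s) | w s. w \<in> carrier W \<and> s \<in> S}"

definition pos_roots :: "('a, 'm) monoid_scheme \<Rightarrow> 'a set \<Rightarrow> 'a vec_space set" where
  "pos_roots W S = {\<gamma> \<in> roots W S. \<forall>s. 0 \<le> Poly_Mapping.lookup \<gamma> s}"

text \<open>\<open>s\<^sub>\<gamma> = w s w\<^sup>-\<^sup>1\<close> for \<open>\<gamma> = w \<cdot> \<alpha>\<^sub>s\<close>.\<close>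

definition root_reflection :: "('a, 'm) monoid_scheme \<Rightarrow> 'a set \<Rightarrow> 'a vec_space \<Rightarrow> 'a" where
  "root_reflection W S \<gamma> =
     (THE r. \<exists>w \<in> carrier W. \<exists>s\<in>S.
        \<gamma> = act W S w (simple_root s) \<and> r = w \<otimes>\<^bsub>W\<^esub> s \<otimes>\<^bsub>W\<^esub> inv\<^bsub>W\<^esub> w)"


section \<open>The reflection subgroup orthogonal to \<open>J\<close>\<close>

definition perp_roots :: "('a, 'm) monoid_scheme \<Rightarrow> 'a set \<Rightarrow> 'a set \<Rightarrow> 'a vec_space set" where
  "perp_roots W S J = {\<gamma> \<in> roots W S. \<forall>s\<in>J. vform W \<gamma> (simple_root s) = 0}"

definition pos_perp_roots :: "('a, 'm) monoid_scheme \<Rightarrow> 'a set \<Rightarrow> 'a set \<Rightarrow> 'a vec_space set" where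
  "pos_perp_roots W S J = perp_roots W S J \<inter> pos_roots W S"

definition W_perp :: "('a, 'm) monoid_scheme \<Rightarrow> 'a set \<Rightarrow> 'a set \<Rightarrow> 'a set" where
  "W_perp W S J = generate W (root_reflection W S ` perp_roots W S J)"

definition R_perp :: "('a, 'm) monoid_scheme \<Rightarrow> 'a set \<Rightarrow> 'a set \<Rightarrow> 'a set" where
  "R_perp W S J = root_reflection W S `
     {\<gamma> \<in> pos_perp_roots W S J.
        \<forall>(n::nat) c \<beta>. (\<forall>i<n. 0 < c i \<and> \<beta> i \<in> pos_perp_roots W S J) \<and>
            \<gamma> = (\<Sum>i<n. vscale (c i) (\<beta> i))
          \<longrightarrow> (\<forall>i<n. \<beta> i = \<gamma>)}"


section \<open>The groupoids \<open>C\<close> and \<open>Y\<close>\<close>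

definition injections :: "'l set \<Rightarrow> 'a set \<Rightarrow> ('l \<Rightarrow> 'a) set" where
  "injections \<Lambda> S = {x \<in> \<Lambda> \<rightarrow>\<^sub>E S. inj_on x \<Lambda>}"

definition C_grpd ::
    "('a, 'm) monoid_scheme \<Rightarrow> 'a set \<Rightarrow> 'l set \<Rightarrow> ('l \<Rightarrow> 'a) \<Rightarrow> ('l \<Rightarrow> 'a) \<Rightarrow> 'a set" where
  "C_grpd W S \<Lambda> x y =
     {w \<in> carrier W. \<forall>l\<in>\<Lambda>. simple_root (x l) = act W S w (simple_root (y l))}"

definition C_verts ::
    "('a, 'm) monoid_scheme \<Rightarrow> 'a set \<Rightarrow> 'l set \<Rightarrow> ('l \<Rightarrow> 'a) \<Rightarrow> ('l \<Rightarrow> 'a) set" where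
  "C_verts W S \<Lambda> xI = {x \<in> injections \<Lambda> S. C_grpd W S \<Lambda> x xI \<noteq> {}}"

definition Y_grpd ::
    "('a, 'm) monoid_scheme \<Rightarrow> 'a set \<Rightarrow> 'l set \<Rightarrow> ('l \<Rightarrow> 'a) \<Rightarrow> ('l \<Rightarrow> 'a) \<Rightarrow> 'a set" where
  "Y_grpd W S \<Lambda> x y =
     {w \<in> C_grpd W S \<Lambda> x y. act W S w ` pos_perp_roots W S (y ` \<Lambda>) \<subseteq> pos_roots W S}"


section \<open>The graph and its maximal trees\<close>

text \<open>The oriented edge \<open>w\<^sub>x\<^sup>s\<close> starting at \<open>x\<close> is the arc \<open>(x, s)\<close>. Parallel edges and loops can occur,
  so a path has to be given by its arcs.\<close>

type_synonym ('l, 'a) arc = "('l \<Rightarrow> 'a) \<times> 'a"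

definition arc_elt :: "('a, 'm) monoid_scheme \<Rightarrow> 'a set \<Rightarrow> 'l set \<Rightarrow> ('l, 'a) arc \<Rightarrow> 'a" where
  "arc_elt W S \<Lambda> e =
     (let x = fst e; s = snd e; K = link_component W (x ` \<Lambda>) {s}
      in longest_elt W S K \<otimes>\<^bsub>W\<^esub> longest_elt W S (K - {s}))"

definition arc_target ::
    "('a, 'm) monoid_scheme \<Rightarrow> 'a set \<Rightarrow> 'l set \<Rightarrow> ('l \<Rightarrow> 'a) \<Rightarrow> ('l, 'a) arc \<Rightarrow> ('l \<Rightarrow> 'a)" where
  "arc_target W S \<Lambda> xI e =
     (THE y. y \<in> C_verts W S \<Lambda> xI \<and> arc_elt W S \<Lambda> e \<in> C_grpd W S \<Lambda> y (fst e))"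

definition arc_reverse ::
    "('a, 'm) monoid_scheme \<Rightarrow> 'a set \<Rightarrow> 'l set \<Rightarrow> ('l \<Rightarrow> 'a) \<Rightarrow> ('l, 'a) arc \<Rightarrow> ('l, 'a) arc" where
  "arc_reverse W S \<Lambda> xI e =
     (let y = arc_target W S \<Lambda> xI e
      in (y, the_elem ((fst e ` \<Lambda> \<union> {snd e}) - y ` \<Lambda>)))"

definition C_graph ::
    "('a, 'm) monoid_scheme \<Rightarrow> 'a set \<Rightarrow> 'l set \<Rightarrow> ('l \<Rightarrow> 'a)
      \<Rightarrow> ('l \<Rightarrow> 'a, ('l, 'a) arc) pre_digraph" where
  "C_graph W S \<Lambda> xI =
     \<lparr>verts = C_verts W S \<Lambda> xI,
      arcs = {(x, s). x \<in> C_verts W S \<Lambda> xI \<and> s \<in> S - x ` \<Lambda> \<and>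
                finite_type W (link_component W (x ` \<Lambda>) {s})},
      tail = fst,
      head = arc_target W S \<Lambda> xI\<rparr>"

definition Y1_graph ::
    "('a, 'm) monoid_scheme \<Rightarrow> 'a set \<Rightarrow> 'l set \<Rightarrow> ('l \<Rightarrow> 'a)
      \<Rightarrow> ('l \<Rightarrow> 'a, ('l, 'a) arc) pre_digraph" where
  "Y1_graph W S \<Lambda> xI =
     (let G = C_graph W S \<Lambda> xI
      in G\<lparr>arcs := {e \<in> arcs G. tail G e \<noteq> head G e}\<rparr>)"

definition non_backtracking :: "('e \<Rightarrow> 'e) \<Rightarrow> 'e list \<Rightarrow> bool" where
  "non_backtracking rev_arc p \<longleftrightarrow> successively (\<lambda>e f. f \<noteq> rev_arc e) p"

text \<open>Here an undirected multigraph is a digraph in which every arc \<open>e\<close> comes with a reverse arc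
  \<open>rev_arc e\<close>. The library's \<open>tree\<close> does not apply: it forbids arcs in both directions.\<close>

definition undirected_tree :: "('e \<Rightarrow> 'e) \<Rightarrow> ('v, 'e) pre_digraph \<Rightarrow> bool" where
  "undirected_tree rev_arc H \<longleftrightarrow>
     rev_arc ` arcs H \<subseteq> arcs H \<and> strongly_connected H \<and>
     (\<forall>u p. pre_digraph.awalk H u p u \<and> non_backtracking rev_arc p \<longrightarrow> p = [])"

definition maximal_tree ::
    "('a, 'm) monoid_scheme \<Rightarrow> 'a set \<Rightarrow> 'l set \<Rightarrow> ('l \<Rightarrow> 'a)
      \<Rightarrow> ('l \<Rightarrow> 'a, ('l, 'a) arc) pre_digraph \<Rightarrow> bool" where
  "maximal_tree W S \<Lambda> xI T \<longleftrightarrow>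
     pre_digraph.max_subgraph (Y1_graph W S \<Lambda> xI)
       (undirected_tree (arc_reverse W S \<Lambda> xI)) T"

text \<open>The element of \<open>W\<close> represented by the non-backtracking path \<open>p\<^bsub>z,y\<^esub>\<close> in \<open>T\<close> from \<open>y\<close> to \<open>z\<close>. A walk
  lists its arcs in the order of traversal, whereas products are taken from right to left.\<close>

definition tree_path_elt ::
    "('a, 'm) monoid_scheme \<Rightarrow> 'a set \<Rightarrow> 'l set \<Rightarrow> ('l \<Rightarrow> 'a)
      \<Rightarrow> ('l \<Rightarrow> 'a, ('l, 'a) arc) pre_digraph \<Rightarrow> ('l \<Rightarrow> 'a) \<Rightarrow> ('l \<Rightarrow> 'a) \<Rightarrow> 'a" where
  "tree_path_elt W S \<Lambda> xI T z y =
     (let p = (THE p. pre_digraph.awalk T y p z \<and> non_backtracking (arc_reverse W S \<Lambda> xI) p)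
      in word_prod W (rev (map (arc_elt W S \<Lambda>) p)))"


section \<open>The groups \<open>\<A>\<close> and \<open>B\<^sub>I\<close>\<close>

text \<open>In this section \<open>I = x\<^sub>I ` \<Lambda>\<close>.\<close>

definition x_conj ::
    "('a, 'm) monoid_scheme \<Rightarrow> 'a set \<Rightarrow> 'l set \<Rightarrow> ('l \<Rightarrow> 'a) \<Rightarrow> 'l set \<Rightarrow> ('l \<Rightarrow> 'a)" where
  "x_conj W S \<Lambda> xI A =
     (\<lambda>l\<in>\<Lambda>. longest_elt W S (xI ` A) \<otimes>\<^bsub>W\<^esub> xI l \<otimes>\<^bsub>W\<^esub> longest_elt W S (xI ` A))"

definition A_tilde ::
    "('a, 'm) monoid_scheme \<Rightarrow> 'a set \<Rightarrow> 'l set \<Rightarrow> ('l \<Rightarrow> 'a) \<Rightarrow> 'l set set" where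
  "A_tilde W S \<Lambda> xI =
     {A. A \<subseteq> \<Lambda> \<and> finite_type W (xI ` A) \<and>
         (\<exists>\<K> \<subseteq> irreducible_components W (xI ` \<Lambda>). xI ` A = \<Union>\<K>) \<and>
         x_conj W S \<Lambda> xI A \<in> C_verts W S \<Lambda> xI}"

definition A_group ::
    "('a, 'm) monoid_scheme \<Rightarrow> 'a set \<Rightarrow> 'l set \<Rightarrow> ('l \<Rightarrow> 'a) \<Rightarrow> 'l set set" where
  "A_group W S \<Lambda> xI =
     {A \<in> A_tilde W S \<Lambda> xI.
        \<forall>K \<in> irreducible_components W (xI ` \<Lambda>). minus_one_type W S K \<longrightarrow> xI ` A \<inter> K = {}}"

definition A_map ::
    "('a, 'm) monoid_scheme \<Rightarrow> 'a set \<Rightarrow> 'l set \<Rightarrow> ('l \<Rightarrow> 'a) \<Rightarrow> 'a \<Rightarrow> 'l set" where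
  "A_map W S \<Lambda> xI w = {l\<in>\<Lambda>. act W S w (simple_root (xI l)) = - simple_root (xI l)}"

definition g_elt ::
    "('a, 'm) monoid_scheme \<Rightarrow> 'a set \<Rightarrow> 'l set \<Rightarrow> ('l \<Rightarrow> 'a)
      \<Rightarrow> ('l \<Rightarrow> 'a, ('l, 'a) arc) pre_digraph \<Rightarrow> 'l set \<Rightarrow> 'a" where
  "g_elt W S \<Lambda> xI T A =
     tree_path_elt W S \<Lambda> xI T xI (x_conj W S \<Lambda> xI A) \<otimes>\<^bsub>W\<^esub> longest_elt W S (xI ` A)"

definition B_tilde :: "('a, 'm) monoid_scheme \<Rightarrow> 'a set \<Rightarrow> 'a set \<Rightarrow> 'a set" where
  "B_tilde W S I =
     {w \<in> centralizer W (generate W I). act W S w ` pos_perp_roots W S I = pos_perp_roots W S I}"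

definition B_group ::
    "('a, 'm) monoid_scheme \<Rightarrow> 'a set \<Rightarrow> 'l set \<Rightarrow> ('l \<Rightarrow> 'a) \<Rightarrow> 'a set" where
  "B_group W S \<Lambda> xI = {w \<in> B_tilde W S (xI ` \<Lambda>). A_map W S \<Lambda> xI w \<in> A_group W S \<Lambda> xI}"

end

(*
  By Deodhar's argument, every w in C_{z,x} is a product of edges w_x^s: if w makes the simple root of s
  negative, then [x]_{~s} is of finite type and the element w (w_x^s)^-1 has fewer inversions than w.
  An edge w_x^s that makes some root of Phi^{perp [x]} negative is the reflection in this root, hence a
  loop. So the non-loops lie in Y and connect all vertices, a maximal tree is spanning, and its paths
  represent elements of Y. This gives g_A in B_I with A(g_A) = A.
  An element of Z_W(W_I) acts on the simple root of each i in I by a sign, constant on irreducible components.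
  Those in Z(W_I) are the w_0(J) for J a union of components of (-1)-type, whence the splitting of
  Btilde_I. The factor W^{perp I} splits off since every coset of a reflection subgroup contains exactly
  one element that keeps its positive roots positive. Uniqueness is reduced by Newman's lemma to dihedral
  subgroups.
*)
theory Submission
  imports Defs
begin


section \<open>The form and the simple reflections\<close>

text \<open>Group, root system and index set may be infinite and the form may be degenerate, so
  neither a longest element of W nor dual bases are available. Finiteness is drawn from the finitely
  many inversions of a single element, and signs are often read off from one coefficient that the
  element at hand cannot change. The finiteness of K = [x]_{~s} is the delicate point. The roots
  supported on K with positive coefficient at s are all inversions of w; the parabolic subgroup of
  \<open>K - {s}\<close> acts faithfully on this finite set and so has a longest element; w times
  this element makes all simple roots of K negative. The presentation enters through two invariants
  of words, the operator on V and the parity of the length. Together with a computation in rank two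
  they yield that every root is positive or negative, on which all later arguments rest. In the
  dihedral step the product of the two reflections may have infinite order, so no list of dihedral
  root systems is used; positivity itself forces a finite orbit.\<close>

abbreviation coef :: "'a vec_space \<Rightarrow> 'a \<Rightarrow> real" where
  "coef \<equiv> Poly_Mapping.lookup"

abbreviation supp :: "'a vec_space \<Rightarrow> 'a set" where
  "supp \<equiv> Poly_Mapping.keys"

lemma coef_vscale [simp]: "coef (vscale c v) s = c * coef v s"
  unfolding vscale_def by (simp add: Poly_Mapping.map.rep_eq when_def)

lemma coef_simple_root: "coef (simple_root s) t = (if s = t then 1 else 0)"
  unfolding simple_root_def by (simp add: lookup_single when_def)

lemma simple_root_inject [simp]: "simple_root s = simple_root t \<longleftrightarrow> s = t"
  by (metis coef_simple_root zero_neq_one)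

lemma supp_simple_root [simp]: "supp (simple_root s) = {s}"
  unfolding simple_root_def by simp

lemma not_in_supp: "t \<notin> supp v \<Longrightarrow> coef v t = 0"
  by (simp add: in_keys_iff)

lemma supp_vscale: "supp (vscale c v) \<subseteq> supp v"
  by (auto simp: in_keys_iff)

lemma supp_add: "supp (u + v :: 'a vec_space) \<subseteq> supp u \<union> supp v"
  by (rule Poly_Mapping.keys_add)

lemma vec_expand: "v = (\<Sum>t\<in>supp v. vscale (coef v t) (simple_root t))"
proof (rule poly_mapping_eqI)
  fix k
  have "coef (\<Sum>t\<in>supp v. vscale (coef v t) (simple_root t)) k
      = (\<Sum>t\<in>supp v. coef v t * (if t = k then 1 else 0))"
    by (simp add: lookup_sum coef_simple_root)
  also have "\<dots> = coef v k"
    by (simp add: if_distrib sum.delta not_in_supp cong: if_cong)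
  finally show "coef v k = coef (\<Sum>t\<in>supp v. vscale (coef v t) (simple_root t)) k" ..
qed

text \<open>\<open>vform\<close> sums over the supports, which change when vectors are added or
  scaled. With index sets fixed in advance, bilinearity becomes a termwise identity.\<close>

lemma vform_eq_sum:
  assumes "finite A" "finite B" "supp u \<subseteq> A" "supp v \<subseteq> B"
  shows "vform W u v = (\<Sum>s\<in>A. \<Sum>t\<in>B. coef u s * coef v t * gram W s t)"
proof -
  have "(\<Sum>s\<in>A. \<Sum>t\<in>B. coef u s * coef v t * gram W s t)
      = (\<Sum>s\<in>supp u. \<Sum>t\<in>B. coef u s * coef v t * gram W s t)"
    by (rule sum.mono_neutral_right) (use assms in \<open>auto simp: not_in_supp\<close>)
  also have "\<dots> = (\<Sum>s\<in>supp u. \<Sum>t\<in>supp v. coef u s * coef v t * gram W s t)"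
    by (intro sum.cong refl sum.mono_neutral_right) (use assms in \<open>auto simp: not_in_supp\<close>)
  finally show ?thesis
    by (simp add: vform_def)
qed

lemma vform_add_left: "vform W (u + u') v = vform W u v + vform W u' v"
proof -
  let ?A = "supp u \<union> supp u'"
  have "vform W x v = (\<Sum>s\<in>?A. \<Sum>t\<in>supp v. coef x s * coef v t * gram W s t)"
    if "x \<in> {u, u', u + u'}" for x
    using that supp_add[of u u'] by (intro vform_eq_sum) auto
  then show ?thesis
    by (simp add: lookup_add sum.distrib[symmetric] algebra_simps)
qed

lemma vform_add_right: "vform W v (u + u') = vform W v u + vform W v u'"
proof -
  let ?A = "supp u \<union> supp u'"
  have "vform W v x = (\<Sum>s\<in>supp v. \<Sum>t\<in>?A. coef v s * coef x t * gram W s t)"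
    if "x \<in> {u, u', u + u'}" for x
    using that supp_add[of u u'] by (intro vform_eq_sum) auto
  then show ?thesis
    by (simp add: lookup_add sum.distrib[symmetric] algebra_simps)
qed

lemma vform_scale_left: "vform W (vscale c u) v = c * vform W u v"
proof -
  have "vform W (vscale c u) v
      = (\<Sum>s\<in>supp u. \<Sum>t\<in>supp v. coef (vscale c u) s * coef v t * gram W s t)"
    using supp_vscale[of c u] by (intro vform_eq_sum) auto
  then show ?thesis
    by (simp add: vform_def sum_distrib_left mult.assoc)
qed

lemma vform_scale_right: "vform W v (vscale c u) = c * vform W v u"
proof -
  have "vform W v (vscale c u)
      = (\<Sum>s\<in>supp v. \<Sum>t\<in>supp u. coef v s * coef (vscale c u) t * gram W s t)"
    using supp_vscale[of c u] by (intro vform_eq_sum) auto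
  then show ?thesis
    by (simp add: vform_def sum_distrib_left mult_ac)
qed

lemma vscale_minus_one: "vscale (-1) v = - v"
  by (rule poly_mapping_eqI) simp

lemma vform_minus_left: "vform W (- u) v = - vform W u v"
  using vform_scale_left[of W "-1" u v] by (simp add: vscale_minus_one)

lemma vform_minus_right: "vform W v (- u) = - vform W v u"
  using vform_scale_right[of W v "-1" u] by (simp add: vscale_minus_one)

lemma vform_diff_left: "vform W (u - u') v = vform W u v - vform W u' v"
  using vform_add_left[of W u "- u'" v] by (simp add: vform_minus_left)

lemma vform_diff_right: "vform W v (u - u') = vform W v u - vform W v u'"
  using vform_add_right[of W v u "- u'"] by (simp add: vform_minus_right)

lemma vform_zero_left [simp]: "vform W 0 v = 0"
  and vform_zero_right [simp]: "vform W v 0 = 0"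
  by (simp_all add: vform_def)

lemma vform_simple_root: "vform W (simple_root s) (simple_root t) = gram W s t"
  by (simp add: vform_def coef_simple_root)

lemmas vform_bilinear = vform_add_left vform_add_right vform_scale_left vform_scale_right
  vform_minus_left vform_minus_right vform_diff_left vform_diff_right

lemma coef_simple_act:
  "coef (simple_act W s v) t = coef v t - (if t = s then 2 * vform W (simple_root s) v else 0)"
  by (simp add: simple_act_def lookup_minus coef_simple_root)

lemma simple_act_add: "simple_act W s (u + v) = simple_act W s u + simple_act W s v"
  by (rule poly_mapping_eqI) (simp add: coef_simple_act vform_bilinear lookup_add algebra_simps)

lemma simple_act_scale: "simple_act W s (vscale c v) = vscale c (simple_act W s v)"
  by (rule poly_mapping_eqI) (simp add: coef_simple_act vform_bilinear algebra_simps)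

abbreviation word_act :: "('a, 'm) monoid_scheme \<Rightarrow> 'a list \<Rightarrow> 'a vec_space \<Rightarrow> 'a vec_space" where
  "word_act W \<equiv> foldr (simple_act W)"

lemma word_act_add: "word_act W ss (u + v) = word_act W ss u + word_act W ss v"
  by (induction ss) (simp_all add: simple_act_add)

lemma word_act_scale: "word_act W ss (vscale c v) = vscale c (word_act W ss v)"
  by (induction ss) (simp_all add: simple_act_scale)


section \<open>Dihedral computations\<close>

text \<open>The Chebyshev polynomial U_{n-1} of the second kind, shifted so that
  \<open>cheb c 0 = 0\<close>. For c = cos(pi/m) its values are the coordinates of roots in the
  plane of two simple roots.\<close>

fun cheb :: "real \<Rightarrow> nat \<Rightarrow> real" where
  "cheb c 0 = 0"
| "cheb c (Suc 0) = 1"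
| "cheb c (Suc (Suc n)) = 2 * c * cheb c (Suc n) - cheb c n"

lemma cheb_one: "cheb 1 n = real n"
  by (induction "1 :: real" n rule: cheb.induct) auto

lemma cheb_cos: "sin \<theta> \<noteq> 0 \<Longrightarrow> cheb (cos \<theta>) n = sin (real n * \<theta>) / sin \<theta>"
proof (induction "cos \<theta>" n rule: cheb.induct)
  case (3 n)
  have "sin (real (Suc (Suc n)) * \<theta>) = sin (real (Suc n) * \<theta> + \<theta>)"
    and "sin (real n * \<theta>) = sin (real (Suc n) * \<theta> - \<theta>)"
    by (simp_all add: algebra_simps)
  then have "sin (real (Suc (Suc n)) * \<theta>) = 2 * cos \<theta> * sin (real (Suc n) * \<theta>) - sin (real n * \<theta>)"
    by (simp add: sin_add sin_diff)
  with 3 show ?case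
    by (simp add: diff_divide_distrib)
qed auto

text \<open>Letters alternate between \<open>s\<close> and \<open>t\<close>; the last letter is \<open>t\<close>.\<close>

fun alt_word :: "'a \<Rightarrow> 'a \<Rightarrow> nat \<Rightarrow> 'a list" where
  "alt_word s t 0 = []"
| "alt_word s t (Suc n) = (if even n then t else s) # alt_word s t n"

lemma set_alt_word: "set (alt_word s t n) \<subseteq> {s, t}"
  by (induction n) auto

lemma length_alt_word [simp]: "length (alt_word s t n) = n"
  by (induction n) auto

lemma alt_word_even: "alt_word s t (2 * n) = concat (replicate n [s, t])"
  by (induction n) auto

text \<open>Read from the left, a word of even length begins with s; its first k letters are thus
  the reversal of an alternating word that ends in s. The cut at k = m turns (st)^m = 1 into the
  braid relation.\<close>

lemma alt_word_split:
  "k \<le> 2 * m \<Longrightarrow> alt_word s t (2 * m) = rev (alt_word t s k) @ alt_word s t (2 * m - k)"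
proof (induction k)
  case (Suc k)
  then obtain j where j: "2 * m - k = Suc j"
    by (metis Suc_diff_Suc less_eq_Suc_le)
  then have "2 * m = k + Suc j"
    using Suc.prems by simp
  then have "even j \<longleftrightarrow> odd k"
    by presburger
  moreover have "2 * m - Suc k = j"
    using j by simp
  ultimately show ?case
    using Suc j by simp
qed simp

lemma distinct_adj_alt_word:
  assumes "set b \<subseteq> {s, t}" "distinct_adj b" "b \<noteq> [] \<Longrightarrow> last b = t" "s \<noteq> t"
  shows "b = alt_word s t (length b)"
  using assms
proof (induction b)
  case (Cons x b)
  show ?case
  proof (cases b)
    case Nil
    with Cons.prems show ?thesis by simp
  next
    case (Cons y c)
    then have b: "b = alt_word s t (Suc (length c))"
      using Cons.IH Cons.prems by (auto simp: distinct_adj_Cons)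
    then have "y = (if even (length c) then t else s)"
      using Cons by simp
    with Cons Cons.prems b show ?thesis
      by (auto simp: distinct_adj_Cons)
  qed
qed simp

text \<open>A letter changes one coordinate only: if a is the coordinate at its own simple root and
  b the other one, then a becomes 2cb - a. This is the recursion of \<open>cheb\<close>, and the
  parity of n tells which coordinate was changed last.\<close>

lemma word_act_alt_word:
  assumes "gram W s s = 1" "gram W t t = 1" "gram W s t = - c" "gram W t s = - c"
  shows "word_act W (alt_word s t n) (simple_root s) =
    (if even n then vscale (cheb c (Suc n)) (simple_root s) + vscale (cheb c n) (simple_root t)
     else vscale (cheb c n) (simple_root s) + vscale (cheb c (Suc n)) (simple_root t))"
proof (induction n)
  case 0
  then show ?case
    by (auto intro!: poly_mapping_eqI simp: lookup_add coef_simple_root)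
next
  case (Suc n)
  then show ?case
    using assms
    by (auto intro!: poly_mapping_eqI
        simp: lookup_add coef_simple_root coef_simple_act vform_bilinear vform_simple_root algebra_simps)
qed


section \<open>The geometric representation\<close>

lemma (in group) generate_conj:
  assumes w: "w \<in> carrier G" and R: "R \<subseteq> carrier G" "R' \<subseteq> carrier G"
    and conj: "\<And>r. r \<in> R \<Longrightarrow> w \<otimes> r \<otimes> inv w \<in> generate G R'" and x: "x \<in> generate G R"
  shows "w \<otimes> x \<otimes> inv w \<in> generate G R'"
  using x
proof (induction rule: generate.induct)
  case one
  then show ?case using w by (simp add: generate.one)
next
  case (inv r)
  have "w \<otimes> inv r \<otimes> inv w = inv (w \<otimes> r \<otimes> inv w)"
    using w subsetD[OF R(1) inv] by (simp add: inv_mult_group m_assoc)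
  then show ?case
    using conj[OF inv] generate_m_inv_closed[OF R(2)] by simp
next
  case (eng x y)
  have c: "x \<in> carrier G" "y \<in> carrier G"
    using eng generate_in_carrier[OF R(1)] by auto
  then have "w \<otimes> (x \<otimes> y) \<otimes> inv w = (w \<otimes> x \<otimes> (inv w \<otimes> w)) \<otimes> y \<otimes> inv w"
    using w by (simp add: m_assoc)
  also have "\<dots> = (w \<otimes> x \<otimes> inv w) \<otimes> (w \<otimes> y \<otimes> inv w)"
    using c w by (simp only: m_assoc m_closed inv_closed)
  finally show ?case
    using eng.IH by (simp add: generate.eng)
qed (rule conj)

section \<open>Words over the generators and the action of words on V\<close>

locale coxeter =
  fixes W :: "('a, 'm) monoid_scheme" (structure) and S :: "'a set"
  assumes coxeter_system: "coxeter_system W S"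
begin

sublocale group W
  using coxeter_system by (simp add: coxeter_system_def)

lemma S_closed: "s \<in> S \<Longrightarrow> s \<in> carrier W"
  and generate_S: "generate W S = carrier W"
  and ord_S: "s \<in> S \<Longrightarrow> ord s = 2"
  and presentation: "set u \<subseteq> S \<Longrightarrow> set v \<subseteq> S \<Longrightarrow> word_prod W u = word_prod W v
        \<Longrightarrow> equivclp (coxeter_step W S) u v"
  using coxeter_system by (auto simp: coxeter_system_def)

lemma S_square: "s \<in> S \<Longrightarrow> s \<otimes> s = \<one>"
  using pow_ord_eq_1[of s] S_closed[of s] by (simp add: ord_S numeral_2_eq_2)

lemma inv_S: "s \<in> S \<Longrightarrow> inv s = s"
  by (simp add: S_closed S_square inv_equality)

lemma cox_m_self: "s \<in> S \<Longrightarrow> cox_m W s s = 1"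
  using ord_eq_1[of \<one>] by (simp add: cox_m_def S_square)

lemma cox_m_commute: "s \<in> S \<Longrightarrow> t \<in> S \<Longrightarrow> cox_m W s t = cox_m W t s"
  using ord_inv[of "s \<otimes> t"] by (simp add: cox_m_def S_closed inv_mult_group inv_S)

lemma cox_m_eq_1:
  assumes "s \<in> S" "t \<in> S" "cox_m W s t = 1"
  shows "s = t"
proof -
  have "s \<otimes> t = \<one>"
    using assms ord_eq_1[of "s \<otimes> t"] by (simp add: cox_m_def S_closed)
  then show ?thesis
    using assms by (metis S_closed inv_S inv_equality)
qed

lemma gram_self: "s \<in> S \<Longrightarrow> gram W s s = 1"
  by (simp add: gram_def cox_m_self)

lemma gram_commute: "s \<in> S \<Longrightarrow> t \<in> S \<Longrightarrow> gram W s t = gram W t s"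
  by (simp add: gram_def cox_m_commute)

lemma cox_m_cases:
  assumes "s \<in> S" "t \<in> S" "s \<noteq> t"
  shows "cox_m W s t = 0 \<or> cox_m W s t \<ge> 2"
  using cox_m_eq_1[OF assms(1,2)] assms(3) by fastforce

lemma gram_cases:
  assumes "s \<in> S" "t \<in> S" "s \<noteq> t"
  obtains (adj) "cox_m W s t = 0 \<or> cox_m W s t \<ge> 3" "gram W s t < 0"
    | (non_adj) "cox_m W s t = 2" "gram W s t = 0"
proof -
  consider "cox_m W s t = 0" | "cox_m W s t = 2" | "cox_m W s t \<ge> 3"
    using cox_m_cases[OF assms] by linarith
  then show thesis
  proof cases
    case 3
    have "pi / real (cox_m W s t) \<le> pi / 3"
      using 3 by (intro divide_left_mono) auto
    also have "\<dots> < pi / 2"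
      by simp
    finally have "cos (pi / real (cox_m W s t)) > 0"
      using 3 by (intro cos_gt_zero_pi) (auto intro: order_less_le_trans[of _ 0])
    with 3 adj show thesis by (simp add: gram_def)
  qed (use that in \<open>auto simp: gram_def\<close>)
qed

lemma gram_nonpos: "s \<in> S \<Longrightarrow> t \<in> S \<Longrightarrow> s \<noteq> t \<Longrightarrow> gram W s t \<le> 0"
  by (metis gram_cases less_eq_real_def)

lemma word_prod_Nil [simp]: "word_prod W [] = \<one>"
  and word_prod_Cons [simp]: "word_prod W (s # ss) = s \<otimes> word_prod W ss"
  by (simp_all add: word_prod_def)

lemma word_prod_closed: "set ss \<subseteq> carrier W \<Longrightarrow> word_prod W ss \<in> carrier W"
  by (induction ss) auto

lemma word_prod_append:
  "set u \<subseteq> carrier W \<Longrightarrow> set v \<subseteq> carrier W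
    \<Longrightarrow> word_prod W (u @ v) = word_prod W u \<otimes> word_prod W v"
  by (induction u) (auto simp: word_prod_closed m_assoc)

lemma S_subset_carrier: "S \<subseteq> carrier W"
  using S_closed by blast

lemma word_prod_S [simp]: "set ss \<subseteq> S \<Longrightarrow> word_prod W ss \<in> carrier W"
  using S_subset_carrier by (intro word_prod_closed) auto

lemma word_prod_append_S:
  "set u \<subseteq> S \<Longrightarrow> set v \<subseteq> S \<Longrightarrow> word_prod W (u @ v) = word_prod W u \<otimes> word_prod W v"
  using S_subset_carrier by (intro word_prod_append) auto

lemma word_prod_rev: "set ss \<subseteq> S \<Longrightarrow> word_prod W (rev ss) = inv (word_prod W ss)"
  by (induction ss) (auto simp: word_prod_append_S S_closed inv_mult_group inv_S)

lemma word_prod_power: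
  assumes "s \<in> S" "t \<in> S"
  shows "word_prod W (concat (replicate n [s, t])) = (s \<otimes> t) [^] n"
proof (induction n)
  case (Suc n)
  have "(s \<otimes> t) [^] Suc n = (s \<otimes> t) \<otimes> (s \<otimes> t) [^] n"
    using assms by (intro nat_pow_Suc2) (auto simp: S_closed)
  with Suc assms show ?case
    by (simp add: S_closed m_assoc)
qed simp

lemma generate_word:
  assumes "w \<in> generate W J" "J \<subseteq> S"
  obtains ss where "set ss \<subseteq> J" "word_prod W ss = w"
proof -
  have "\<exists>ss. set ss \<subseteq> J \<and> word_prod W ss = w"
    using assms
  proof (induction rule: generate.induct)
    case one
    show ?case by (intro exI[of _ "[]"]) simp
  next
    case (incl h)
    then show ?case by (intro exI[of _ "[h]"]) (auto simp: S_closed)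
  next
    case (inv h)
    then show ?case by (intro exI[of _ "[h]"]) (auto simp: S_closed inv_S subset_iff)
  next
    case (eng h1 h2)
    then obtain u v where "set u \<subseteq> J" "word_prod W u = h1" "set v \<subseteq> J" "word_prod W v = h2"
      by auto
    with eng show ?case
      by (intro exI[of _ "u @ v"]) (auto simp: word_prod_append_S)
  qed
  with that show ?thesis by blast
qed

lemma carrier_word:
  assumes "w \<in> carrier W"
  obtains ss where "set ss \<subseteq> S" "word_prod W ss = w"
  using generate_word[of w S] assms by (auto simp: generate_S)

lemma simple_act_involution:
  assumes "s \<in> S"
  shows "simple_act W s (simple_act W s v) = v"
proof -
  have "vform W (simple_root s) (simple_act W s v) = - vform W (simple_root s) v"
    using assms by (simp add: simple_act_def vform_bilinear vform_simple_root gram_self)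
  then show ?thesis
    by (intro poly_mapping_eqI) (simp add: coef_simple_act)
qed

lemma word_act_rev: "set ss \<subseteq> S \<Longrightarrow> word_act W (rev ss) (word_act W ss v) = v"
  by (induction ss arbitrary: v) (auto simp: simple_act_involution)

text \<open>With \<theta> = pi/m the coordinates after 2m letters are sin((2m+1)\<theta>)/sin
  \<theta> and sin(2m\<theta>)/sin \<theta>. Since 2m\<theta> = 2 pi, these are 1 and 0.\<close>

lemma braid_fixes_root:
  assumes "s \<in> S" "t \<in> S" "s \<noteq> t" "m = cox_m W s t" "m > 0"
  shows "word_act W (concat (replicate m [s, t])) (simple_root s) = simple_root s"
proof -
  have m: "m \<ge> 2"
    using cox_m_cases[OF assms(1-3)] assms(4,5) by simp
  define \<theta> where "\<theta> = pi / real m"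
  have th: "0 < \<theta>" "\<theta> < pi" "real (2 * m) * \<theta> = 2 * pi"
    using m by (auto simp: \<theta>_def field_simps)
  then have s: "sin \<theta> \<noteq> 0"
    using sin_gt_zero[of \<theta>] by linarith
  have "real (Suc (2 * m)) * \<theta> = \<theta> + 2 * pi"
    using th by (simp add: algebra_simps)
  then have "sin (real (2 * m) * \<theta>) = 0" "sin (real (Suc (2 * m)) * \<theta>) = sin \<theta>"
    using th(3) by (simp_all only: sin_periodic sin_two_pi)
  then have "cheb (cos \<theta>) (2 * m) = 0" "cheb (cos \<theta>) (Suc (2 * m)) = 1"
    using s by (simp_all only: cheb_cos[OF s]) simp_all
  moreover have "gram W s t = - cos \<theta>"
    using assms by (simp add: gram_def \<theta>_def)
  moreover have "gram W t s = - cos \<theta>"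
    using assms by (simp add: gram_def \<theta>_def cox_m_commute)
  ultimately show ?thesis
    using word_act_alt_word[of W s t "cos \<theta>" "2 * m"] assms
    by (auto simp: alt_word_even gram_self lookup_add intro!: poly_mapping_eqI)
qed

lemma word_act_braid:
  assumes "s \<in> S" "t \<in> S"
  shows "word_act W (concat (replicate (cox_m W s t) [s, t])) v = v"
proof -
  define m where "m = cox_m W s t"
  let ?R = "word_act W (concat (replicate m [s, t]))"
  have "s = t \<or> m = 0 \<or> s \<noteq> t \<and> m \<ge> 2"
    using cox_m_cases[OF assms] by (cases "s = t") (auto simp: m_def)
  then consider "s = t" | "m = 0" | "s \<noteq> t" "m \<ge> 2"
    by blast
  then have "?R v = v"
  proof cases
    case 1
    then show ?thesis
      using assms by (simp add: m_def cox_m_self simple_act_involution)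
  next
    case 3
    have fix_s: "?R (simple_root s) = simple_root s"
      using 3 assms m_def by (intro braid_fixes_root) auto
    \<comment> \<open>For the other simple root the roles of s and t are exchanged. The word for
      (ts)^m reversed is the word for (st)^m, and the reversed word undoes the original one.\<close>
    have "word_act W (concat (replicate m [t, s])) (simple_root t) = simple_root t"
      using 3 assms m_def by (intro braid_fixes_root) (auto simp: cox_m_commute)
    moreover have "rev (concat (replicate m [t, s])) = concat (replicate m [s, t])"
      by (simp add: rev_concat)
    moreover have "set (concat (replicate m [t, s])) \<subseteq> S"
      using assms by auto
    ultimately have fix_t: "?R (simple_root t) = simple_root t"
      using word_act_rev by metis
    define c where "c = cos (pi / real m)"
    have c: "gram W s t = - c" "gram W t s = - c"
      using 3 assms by (simp_all add: gram_def c_def m_def cox_m_commute)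
    have "0 < sin (pi / real m)"
      using 3 by (intro sin_gt_zero) (auto simp: field_simps)
    \<comment> \<open>This is the determinant of the Gram matrix of the two simple roots. The form
      is nondegenerate on their span, so v splits into a part in the span and a part orthogonal to
      it, which s and t fix.\<close>
    then have c2: "1 - c\<^sup>2 \<noteq> 0"
      by (simp add: c_def sin_squared_eq[symmetric])
    define p q where "p = vform W (simple_root s) v" and "q = vform W (simple_root t) v"
    \<comment> \<open>Cramer's rule for a - cb = p and b - ca = q, the equations that make u below
      orthogonal to both simple roots.\<close>
    define a b where "a = (p + c * q) / (1 - c\<^sup>2)" and "b = (q + c * p) / (1 - c\<^sup>2)"
    have ab: "a - c * b = p" "b - c * a = q"
    proof -
      have "a - c * b = (1 - c\<^sup>2) * p / (1 - c\<^sup>2)" "b - c * a = (1 - c\<^sup>2) * q / (1 - c\<^sup>2)"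
        by (simp_all add: a_def b_def diff_divide_distrib[symmetric] algebra_simps power2_eq_square)
      then show "a - c * b = p" "b - c * a = q"
        using c2 by simp_all
    qed
    define u where "u = v - vscale a (simple_root s) - vscale b (simple_root t)"
    have "vform W (simple_root s) u = 0" "vform W (simple_root t) u = 0"
      using ab[symmetric] assms
      by (simp_all add: u_def vform_bilinear vform_simple_root gram_self c p_def[symmetric]
          q_def[symmetric] algebra_simps)
    then have "simple_act W s u = u" "simple_act W t u = u"
      by (auto intro!: poly_mapping_eqI simp: coef_simple_act)
    then have "word_act W (concat (replicate n [s, t])) u = u" for n
      by (induction n) auto
    moreover have "v = u + vscale a (simple_root s) + vscale b (simple_root t)"
      by (simp add: u_def)
    ultimately show ?thesis
      by (simp only: word_act_add word_act_scale fix_s fix_t)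
  qed simp
  then show ?thesis by (simp add: m_def)
qed

lemma coxeter_step_act:
  "coxeter_step W S u v \<Longrightarrow> word_act W u x = word_act W v x"
  by (auto simp: coxeter_step_def word_act_braid)

text \<open>The presentation leads from one word to the other by inserting and deleting relators,
  each of which acts trivially on V.\<close>

lemma word_act_cong:
  assumes "set u \<subseteq> S" "set v \<subseteq> S" "word_prod W u = word_prod W v"
  shows "word_act W u = word_act W v"
proof -
  have "equivclp (coxeter_step W S) u v"
    using assms by (rule presentation)
  then show ?thesis
    by (induction rule: equivclp_induct) (auto simp: fun_eq_iff coxeter_step_act)
qed

lemma coxeter_step_parity: "coxeter_step W S u v \<Longrightarrow> even (length u) = even (length v)"
  by (auto simp: coxeter_step_def length_concat sum_list_replicate)

text \<open>A relator (st)^m has the even length 2m, so each element has a sign. This is what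
  prevents w and ws from having equal length.\<close>

lemma word_parity:
  assumes "set u \<subseteq> S" "set v \<subseteq> S" "word_prod W u = word_prod W v"
  shows "even (length u) = even (length v)"
proof -
  have "equivclp (coxeter_step W S) u v"
    using assms by (rule presentation)
  then show ?thesis
    by (induction rule: equivclp_induct) (auto simp: coxeter_step_parity)
qed

section \<open>The action of W on V and the invariance of the form\<close>

abbreviation W_act :: "'a \<Rightarrow> 'a vec_space \<Rightarrow> 'a vec_space"  (infixr \<open>\<bullet>\<close> 75) where
  "w \<bullet> v \<equiv> act W S w v"

abbreviation root :: "'a \<Rightarrow> 'a vec_space" (\<open>\<alpha>\<close>) where
  "\<alpha> \<equiv> simple_root"

text \<open>\<open>act\<close> picks an arbitrary word for the element; by
  \<open>word_act_cong\<close> the choice is irrelevant, and the action can be computed along any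
  word.\<close>

lemma act_word_prod:
  assumes "set ss \<subseteq> S"
  shows "word_prod W ss \<bullet> v = word_act W ss v"
proof -
  let ?u = "SOME u. set u \<subseteq> S \<and> word_prod W u = word_prod W ss"
  have "set ?u \<subseteq> S \<and> word_prod W ?u = word_prod W ss"
    using assms by (intro someI[of "\<lambda>u. set u \<subseteq> S \<and> word_prod W u = word_prod W ss" ss]) auto
  then have "word_act W ?u = word_act W ss"
    using assms by (intro word_act_cong) auto
  then show ?thesis
    by (simp add: act_def)
qed

lemma act_one [simp]: "\<one> \<bullet> v = v"
  using act_word_prod[of "[]"] by simp

lemma act_S: "s \<in> S \<Longrightarrow> s \<bullet> v = simple_act W s v"
  using act_word_prod[of "[s]"] by (simp add: S_closed)

lemma act_mult:
  assumes "x \<in> carrier W" "y \<in> carrier W"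
  shows "(x \<otimes> y) \<bullet> v = x \<bullet> y \<bullet> v"
proof -
  obtain u u' where "set u \<subseteq> S" "word_prod W u = x" "set u' \<subseteq> S" "word_prod W u' = y"
    using carrier_word assms by metis
  then show ?thesis
    using act_word_prod[of "u @ u'" v] act_word_prod by (auto simp: word_prod_append_S)
qed

lemma act_inv_left [simp]: "w \<in> carrier W \<Longrightarrow> inv w \<bullet> w \<bullet> v = v"
  by (simp flip: act_mult)

lemma act_inv_right [simp]: "w \<in> carrier W \<Longrightarrow> w \<bullet> inv w \<bullet> v = v"
  by (simp flip: act_mult)

lemma act_eq_iff: "w \<in> carrier W \<Longrightarrow> w \<bullet> u = w \<bullet> v \<longleftrightarrow> u = v"
  by (metis act_inv_left)

lemma act_eq_inv_iff: "w \<in> carrier W \<Longrightarrow> w \<bullet> u = v \<longleftrightarrow> u = inv w \<bullet> v"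
  by (metis act_inv_left act_inv_right)

lemma act_add: "w \<bullet> (u + v) = w \<bullet> u + w \<bullet> v"
  and act_scale: "w \<bullet> vscale c v = vscale c (w \<bullet> v)"
  by (simp_all add: act_def word_act_add word_act_scale)

lemma act_minus: "w \<bullet> (- v) = - (w \<bullet> v)"
  by (metis act_scale vscale_minus_one)

lemma act_diff: "w \<bullet> (u - v) = w \<bullet> u - w \<bullet> v"
  by (metis act_add act_minus diff_conv_add_uminus)

lemma act_zero [simp]: "w \<bullet> 0 = 0"
  by (metis act_diff cancel_comm_monoid_add_class.diff_cancel)

lemma act_sum: "w \<bullet> (\<Sum>i\<in>A. f i) = (\<Sum>i\<in>A. w \<bullet> f i)"
  by (induction A rule: infinite_finite_induct) (auto simp: act_add)

lemma coef_act: "coef (w \<bullet> v) k = (\<Sum>t\<in>supp v. coef v t * coef (w \<bullet> \<alpha> t) k)"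
proof -
  have "w \<bullet> v = (\<Sum>t\<in>supp v. vscale (coef v t) (w \<bullet> \<alpha> t))"
    by (subst vec_expand[of v]) (simp only: act_sum act_scale)
  then show ?thesis
    by (simp add: lookup_sum)
qed

lemma supp_simple_act: "supp (simple_act W s v) \<subseteq> insert s (supp v)"
  by (auto simp: in_keys_iff coef_simple_act split: if_splits)

lemma generate_closed: "J \<subseteq> S \<Longrightarrow> w \<in> generate W J \<Longrightarrow> w \<in> carrier W"
  using generate_in_carrier S_subset_carrier by blast

text \<open>A letter s changes the coefficient at s only. A positive coefficient outside J therefore
  certifies that a root stays positive under the parabolic subgroup of J.\<close>

lemma generate_act_coef:
  assumes "J \<subseteq> S" "w \<in> generate W J" "k \<notin> J"
  shows "coef (w \<bullet> v) k = coef v k"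
proof -
  obtain ss where "set ss \<subseteq> J" "word_prod W ss = w"
    using generate_word assms by blast
  moreover have "coef (word_act W ss v) k = coef v k" if "set ss \<subseteq> J"
    using that assms(3) by (induction ss) (auto simp: coef_simple_act)
  ultimately show ?thesis
    using assms(1) act_word_prod by fastforce
qed

text \<open>The supports are confined to S because the symmetry of \<open>gram\<close> is derived
  there, from the fact that st and ts are inverse to each other.\<close>

lemma vform_commute:
  assumes "supp u \<subseteq> S" "supp v \<subseteq> S"
  shows "vform W u v = vform W v u"
proof -
  have "vform W u v = (\<Sum>t\<in>supp v. \<Sum>s\<in>supp u. coef u s * coef v t * gram W s t)"
    unfolding vform_def by (rule sum.swap)
  also have "\<dots> = vform W v u"
    unfolding vform_def using assms by (intro sum.cong refl) (auto simp: gram_commute subset_iff)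
  finally show ?thesis .
qed

lemma supp_act: "w \<in> carrier W \<Longrightarrow> supp v \<subseteq> S \<Longrightarrow> supp (w \<bullet> v) \<subseteq> S"
  using generate_act_coef[OF order_refl, of w _ v] by (auto simp: generate_S in_keys_iff subset_iff)

lemma vform_act:
  assumes "w \<in> carrier W" "supp u \<subseteq> S" "supp v \<subseteq> S"
  shows "vform W (w \<bullet> u) (w \<bullet> v) = vform W u v"
proof -
  obtain ss where ss: "set ss \<subseteq> S" "word_prod W ss = w"
    using carrier_word assms by blast
  have step: "vform W (simple_act W s x) (simple_act W s y) = vform W x y"
    if "s \<in> S" "supp x \<subseteq> S" "supp y \<subseteq> S" for s x y
    using that vform_commute[of x "\<alpha> s"]
    by (simp add: simple_act_def vform_bilinear vform_simple_root gram_self)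
  have V: "supp (word_act W ss x) \<subseteq> S" if "set ss \<subseteq> S" "supp x \<subseteq> S" for x
    using supp_act[of "word_prod W ss"] that by (simp add: act_word_prod)
  have "vform W (word_act W ss u) (word_act W ss v) = vform W u v \<and>
      supp (word_act W ss u) \<subseteq> S \<and> supp (word_act W ss v) \<subseteq> S"
    using ss(1) assms(2,3)
  proof (induction ss)
    case (Cons s ss)
    then show ?case
      using step[of s] supp_simple_act[of s] by simp (meson insert_subset subset_trans)
  qed simp
  with ss show ?thesis
    using act_word_prod by metis
qed

end


section \<open>Lengths and positivity\<close>

definition nonneg :: "'a vec_space \<Rightarrow> bool" where
  "nonneg v \<longleftrightarrow> (\<forall>s. 0 \<le> coef v s)"

lemma nonneg_simple_root: "nonneg (simple_root s)"
  by (simp add: nonneg_def coef_simple_root)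

lemma nonneg_add: "nonneg u \<Longrightarrow> nonneg v \<Longrightarrow> nonneg (u + v)"
  by (simp add: nonneg_def lookup_add)

lemma nonneg_scale: "nonneg u \<Longrightarrow> c \<ge> 0 \<Longrightarrow> nonneg (vscale c u)"
  by (simp add: nonneg_def)

lemma nonneg_antisym: "nonneg v \<Longrightarrow> nonneg (- v) \<Longrightarrow> v = 0"
  by (rule poly_mapping_eqI) (simp add: nonneg_def antisym)

lemma alt_word_snoc: "alt_word s t (Suc n) = alt_word t s n @ [t]"
  by (induction n) auto

lemma alt_word_suffix: "m \<le> n \<Longrightarrow> \<exists>xs. alt_word s t n = xs @ alt_word s t m"
proof (induction n)
  case (Suc n)
  show ?case
  proof (cases "m = Suc n")
    case False
    with Suc obtain xs where "alt_word s t n = xs @ alt_word s t m"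
      by fastforce
    then show ?thesis
      by (intro exI[of _ "(if even n then t else s) # xs"]) simp
  qed (auto intro: exI[of _ "[]"])
qed auto

context coxeter
begin

abbreviation len :: "'a \<Rightarrow> nat" where
  "len \<equiv> word_length W S"

lemma len_le: "set ss \<subseteq> S \<Longrightarrow> len (word_prod W ss) \<le> length ss"
  unfolding word_length_def by (rule Least_le) auto

lemma reduced_word:
  assumes "w \<in> carrier W"
  obtains ss where "set ss \<subseteq> S" "word_prod W ss = w" "length ss = len w"
proof -
  obtain u where "set u \<subseteq> S" "word_prod W u = w"
    using carrier_word assms by blast
  then have "\<exists>n ss. set ss \<subseteq> S \<and> word_prod W ss = w \<and> length ss = n"
    by blast
  then have "\<exists>ss. set ss \<subseteq> S \<and> word_prod W ss = w \<and> length ss = len w"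
    unfolding word_length_def by (rule LeastI_ex)
  with that show thesis by blast
qed

lemma len_mult_word:
  assumes "w \<in> carrier W" "set ss \<subseteq> S"
  shows "len (w \<otimes> word_prod W ss) \<le> len w + length ss"
proof -
  obtain u where u: "set u \<subseteq> S" "word_prod W u = w" "length u = len w"
    using reduced_word assms by blast
  then show ?thesis
    using len_le[of "u @ ss"] assms by (simp add: word_prod_append_S)
qed

lemma len_mult_S: "w \<in> carrier W \<Longrightarrow> s \<in> S \<Longrightarrow> len (w \<otimes> s) \<le> Suc (len w)"
  using len_mult_word[of w "[s]"] by (simp add: S_closed)

lemma mult_S_cancel: "w \<in> carrier W \<Longrightarrow> s \<in> S \<Longrightarrow> w \<otimes> s \<otimes> s = w"
  by (simp add: m_assoc S_closed S_square)

lemma len_mult_S': "w \<in> carrier W \<Longrightarrow> s \<in> S \<Longrightarrow> len w \<le> Suc (len (w \<otimes> s))"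
  using len_mult_S[of "w \<otimes> s" s] by (simp add: mult_S_cancel S_closed)

lemma len_mult_S_neq:
  assumes "w \<in> carrier W" "s \<in> S"
  shows "len (w \<otimes> s) \<noteq> len w"
proof -
  obtain u where u: "set u \<subseteq> S" "word_prod W u = w" "length u = len w"
    using reduced_word assms by blast
  obtain v where v: "set v \<subseteq> S" "word_prod W v = w \<otimes> s" "length v = len (w \<otimes> s)"
    using reduced_word[of "w \<otimes> s"] assms by (auto simp: S_closed)
  have "even (length v) = even (length (u @ [s]))"
    using u v assms by (intro word_parity) (auto simp: word_prod_append_S S_closed)
  with u v show ?thesis by auto
qed

lemma shorten_non_reduced:
  "set b \<subseteq> S \<Longrightarrow> \<not> distinct_adj b
    \<Longrightarrow> \<exists>c. set c \<subseteq> set b \<and> word_prod W c = word_prod W b \<and> length c < length b"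
proof (induction b)
  case (Cons x b)
  show ?case
  proof (cases "distinct_adj b")
    case True
    then obtain b' where "b = x # b'"
      using Cons.prems by (cases b) (auto simp: distinct_adj_Cons)
    then show ?thesis
      using Cons.prems by (intro exI[of _ b']) (auto simp: m_assoc[symmetric] S_closed S_square)
  next
    case False
    with Cons obtain c where "set c \<subseteq> set b" "word_prod W c = word_prod W b" "length c < length b"
      by auto
    then show ?thesis
      by (intro exI[of _ "x # c"]) auto
  qed
qed simp

text \<open>The word for (st)^m = 1 is cut in the middle, and its left half is the inverse of an
  alternating word of length m. For m = \<infinity>, coded as 0, both sides are empty words.\<close>

lemma alt_word_braid:
  assumes "s \<in> S" "t \<in> S" "m = cox_m W s t"
  shows "word_prod W (alt_word s t m) = word_prod W (alt_word t s m)"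
proof -
  have sub: "set (alt_word s t m) \<subseteq> S" "set (alt_word t s m) \<subseteq> S"
    using set_alt_word[of s t m] set_alt_word[of t s m] assms by auto
  have "word_prod W (alt_word s t (2 * m)) = \<one>"
    using assms by (simp add: alt_word_even word_prod_power cox_m_def S_closed)
  then have "inv (word_prod W (alt_word t s m)) \<otimes> word_prod W (alt_word s t m) = \<one>"
    using alt_word_split[of m m s t] sub by (simp add: word_prod_append_S word_prod_rev)
  then show ?thesis
    using sub by (metis inv_closed inv_equality inv_inv word_prod_S)
qed

text \<open>For k up to m the angle k pi/m stays within [0, pi], where the sine is nonnegative; just
  beyond m the sign changes, hence the bound. For m = \<infinity> the value is k itself.\<close>

lemma cheb_gram_nonneg:
  assumes "s \<in> S" "t \<in> S" "s \<noteq> t" "cox_m W s t = 0 \<or> k \<le> cox_m W s t"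
  shows "cheb (- gram W s t) k \<ge> 0"
proof (cases "cox_m W s t = 0")
  case True
  then show ?thesis by (simp add: gram_def cheb_one)
next
  case False
  define \<theta> where "\<theta> = pi / real (cox_m W s t)"
  have m: "cox_m W s t \<ge> 2"
    using cox_m_cases[OF assms(1-3)] False by simp
  then have th: "0 < \<theta>" "\<theta> < pi"
    by (auto simp: \<theta>_def field_simps)
  have "real k * \<theta> \<le> real (cox_m W s t) * \<theta>"
    using assms False th by (intro mult_right_mono) auto
  also have "\<dots> = pi"
    using False by (simp add: \<theta>_def)
  finally have "sin (real k * \<theta>) \<ge> 0"
    using th by (intro sin_ge_zero) auto
  moreover have "sin \<theta> > 0"
    using th by (rule sin_gt_zero)
  ultimately show ?thesis
    using False cheb_cos[of \<theta> k] by (simp add: gram_def \<theta>_def)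
qed

lemma simple_act_self: "s \<in> S \<Longrightarrow> s \<bullet> \<alpha> s = - \<alpha> s"
  by (intro poly_mapping_eqI)
    (auto simp: act_S coef_simple_act coef_simple_root vform_simple_root gram_self)

text \<open>Induction on the length. With t the last letter of a reduced word, w is written as v b,
  with lengths adding up and b a longest possible word in s and t. Then v has no descent at s or t,
  so it makes \<alpha>_s and \<alpha>_t positive by induction, while the rank two computation gives
  b \<alpha>_s as a combination of them with nonnegative coefficients.\<close>

lemma ascent_nonneg:
  assumes "w \<in> carrier W" "s \<in> S" "len w < len (w \<otimes> s)"
  shows "nonneg (w \<bullet> \<alpha> s)"
  using assms
proof (induction "len w" arbitrary: w s rule: less_induct)
  case less
  show ?case
  proof (cases "w = \<one>")
    case False
    obtain ss where ss: "set ss \<subseteq> S" "word_prod W ss = w" "length ss = len w"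
      using reduced_word less.prems by blast
    with False obtain r t where rt: "ss = r @ [t]"
      by (cases ss rule: rev_cases) auto
    with ss have r: "set r \<subseteq> S" "t \<in> S" "w = word_prod W r \<otimes> t" "len w = Suc (length r)"
      by (auto simp: word_prod_append_S S_closed)
    have st: "s \<noteq> t"
    proof
      assume "s = t"
      then have "w \<otimes> s = word_prod W r"
        using r by (simp add: mult_S_cancel)
      with less.prems r len_le[of r] show False by simp
    qed
    define P where "P = (\<lambda>(v, b). v \<in> carrier W \<and> set b \<subseteq> {s, t} \<and> w = v \<otimes> word_prod W b
        \<and> len w = len v + length b)"
    have "len (word_prod W r) = length r"
      using len_le[of r] len_mult_S[of "word_prod W r" t] r by auto
    then have P0: "P (word_prod W r, [t])"
      using r by (simp add: P_def S_closed)
    \<comment> \<open>The length of b is bounded by that of w, and \<open>[t]\<close> is an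
      admissible b. So a longest b exists and is not empty, which makes v shorter than w.\<close>
    have "\<exists>x. P x \<and> (\<forall>y. P y \<longrightarrow> length (snd y) \<le> length (snd x))"
      by (rule ex_has_greatest_nat[of P "(word_prod W r, [t])" _ "Suc (len w)"])
        (use P0 in \<open>auto simp: P_def\<close>)
    then obtain v b where vb: "P (v, b)" "\<And>v' b'. P (v', b') \<Longrightarrow> length b' \<le> length b"
      by auto
    then have v: "v \<in> carrier W" "set b \<subseteq> {s, t}" "w = v \<otimes> word_prod W b" "len w = len v + length b"
      by (auto simp: P_def)
    have bS: "set b \<subseteq> S"
      using v(2) less.prems(2) r(2) by blast
    have b1: "length b \<ge> 1"
      using vb(2)[OF P0] by simp
    have pos: "nonneg (v \<bullet> \<alpha> x)" if x: "x \<in> {s, t}" for x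
    proof (rule less.hyps)
      have xS: "x \<in> S"
        using x less.prems r by auto
      \<comment> \<open>A descent x of v could be moved from v to the front of b, against the
        maximality of b.\<close>
      show "len v < len (v \<otimes> x)"
      proof (rule ccontr)
        assume "\<not> len v < len (v \<otimes> x)"
        then have "len v = Suc (len (v \<otimes> x))"
          using len_mult_S'[of v x] len_mult_S_neq[of v x] v xS by simp
        then have "P (v \<otimes> x, x # b)"
          using v x xS bS by (auto simp: P_def S_closed m_assoc[symmetric] mult_S_cancel)
        then show False
          using vb(2) by fastforce
      qed
    qed (use v b1 x less.prems r in auto)
    have "distinct_adj b"
    proof (rule ccontr)
      assume "\<not> distinct_adj b"
      then obtain c where "set c \<subseteq> set b" "word_prod W c = word_prod W b" "length c < length b"
        using shorten_non_reduced bS by blast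
      then show False
        using len_mult_word[of v c] v bS by auto
    qed
    \<comment> \<open>An expression b' s for b with b' shorter than b would give ws = v b', against
      the assumption that s lengthens w. This excludes that b ends in s, and also that b has m
      letters or more: the braid relation would let it end in s.\<close>
    have not_s: "word_prod W b \<noteq> word_prod W b' \<otimes> s" if "set b' \<subseteq> S" "length b' < length b" for b'
    proof
      assume "word_prod W b = word_prod W b' \<otimes> s"
      then have "w \<otimes> s = v \<otimes> word_prod W b'"
        using v that less.prems by (simp add: m_assoc S_closed S_square)
      then show False
        using len_mult_word[of v b'] that v less.prems by simp
    qed
    have "last b = t"
    proof (rule ccontr)
      assume "last b \<noteq> t"
      then have "last b = s"
        using v(2) b1 last_in_set[of b] by fastforce
      then have "b = butlast b @ [s]"
        using b1 by (metis append_butlast_last_id list.size(3) not_one_le_zero)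
      moreover have "set (butlast b) \<subseteq> S"
        using bS by (meson in_set_butlastD subset_iff)
      ultimately show False
        using not_s[of "butlast b"] b1 less.prems(2) word_prod_append_S[of "butlast b" "[s]"]
        by (simp add: S_closed)
    qed
    then have b: "b = alt_word s t (length b)"
      using \<open>distinct_adj b\<close> v(2) st by (intro distinct_adj_alt_word) auto
    define m where "m = cox_m W s t"
    have nm: "m = 0 \<or> Suc (length b) \<le> m"
    proof (rule ccontr)
      assume "\<not> ?thesis"
      then obtain k where k: "m = Suc k" "m \<le> length b"
        by (cases m) auto
      then obtain xs where xs: "b = xs @ alt_word s t m"
        using alt_word_suffix[of m "length b" s t] b by metis
      have sub: "set xs \<subseteq> S" "set (alt_word s t m) \<subseteq> S" "set (alt_word s t k) \<subseteq> S"
          "set (alt_word t s m) \<subseteq> S"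
        using xs bS set_alt_word[of s t k] set_alt_word[of t s m] less.prems(2) r(2) by auto
      have "word_prod W (alt_word s t m) = word_prod W (alt_word s t k @ [s])"
        using alt_word_braid[of s t m] less.prems(2) r(2) k alt_word_snoc[of t s k]
        by (simp add: m_def)
      then have "word_prod W b = word_prod W (xs @ alt_word s t k) \<otimes> s"
        using xs sub less.prems(2) by (simp add: word_prod_append_S m_assoc S_closed)
      moreover have "length (xs @ alt_word s t k) < length b"
        using xs k by simp
      ultimately show False
        using not_s sub by (metis set_append Un_subset_iff)
    qed
    define c where "c = - gram W s t"
    have ch: "cheb c (length b) \<ge> 0" "cheb c (Suc (length b)) \<ge> 0"
      unfolding c_def using nm less.prems(2) r(2) st by (auto intro!: cheb_gram_nonneg simp: m_def)
    have "word_prod W b \<bullet> \<alpha> s = word_act W (alt_word s t (length b)) (\<alpha> s)"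
      using act_word_prod[OF bS] b by metis
    also have "\<dots> = (if even (length b)
        then vscale (cheb c (Suc (length b))) (\<alpha> s) + vscale (cheb c (length b)) (\<alpha> t)
        else vscale (cheb c (length b)) (\<alpha> s) + vscale (cheb c (Suc (length b))) (\<alpha> t))"
      using less.prems(2) r(2) by (intro word_act_alt_word) (auto simp: gram_self c_def gram_commute)
    finally show ?thesis
      using v bS ch pos by (auto simp: act_mult act_add act_scale intro!: nonneg_add nonneg_scale)
  qed (simp add: nonneg_simple_root)
qed

lemma descent_nonneg:
  assumes "w \<in> carrier W" "s \<in> S" "len (w \<otimes> s) < len w"
  shows "nonneg (- (w \<bullet> \<alpha> s))"
  using ascent_nonneg[of "w \<otimes> s" s] assms
  by (simp add: mult_S_cancel S_closed act_mult simple_act_self act_minus)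


section \<open>Roots and reflections\<close>

abbreviation \<Phi> :: "'a vec_space set" where
  "\<Phi> \<equiv> roots W S"

abbreviation \<Phi>p :: "'a vec_space set" where
  "\<Phi>p \<equiv> pos_roots W S"

lemma pos_roots_iff: "\<gamma> \<in> \<Phi>p \<longleftrightarrow> \<gamma> \<in> \<Phi> \<and> nonneg \<gamma>"
  by (auto simp: pos_roots_def nonneg_def)

lemma rootE:
  assumes "\<gamma> \<in> \<Phi>"
  obtains w s where "w \<in> carrier W" "s \<in> S" "\<gamma> = w \<bullet> \<alpha> s"
  using assms by (auto simp: roots_def)

lemma act_root: "w \<in> carrier W \<Longrightarrow> \<gamma> \<in> \<Phi> \<Longrightarrow> w \<bullet> \<gamma> \<in> \<Phi>"
  unfolding roots_def by clarsimp (metis act_mult m_closed)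

lemma simple_root_in_roots: "s \<in> S \<Longrightarrow> \<alpha> s \<in> \<Phi>"
  unfolding roots_def by clarsimp (metis act_one one_closed)

lemma simple_root_pos: "s \<in> S \<Longrightarrow> \<alpha> s \<in> \<Phi>p"
  by (simp add: pos_roots_iff simple_root_in_roots nonneg_simple_root)

lemma minus_root: "\<gamma> \<in> \<Phi> \<Longrightarrow> - \<gamma> \<in> \<Phi>"
  by (metis rootE act_minus act_root simple_act_self simple_root_in_roots S_closed)

lemma supp_root: "\<gamma> \<in> \<Phi> \<Longrightarrow> supp \<gamma> \<subseteq> S"
  by (auto elim!: rootE dest!: subsetD[OF supp_act])

lemma root_norm: "\<gamma> \<in> \<Phi> \<Longrightarrow> vform W \<gamma> \<gamma> = 1"
  by (auto elim!: rootE simp: vform_act vform_simple_root gram_self)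

lemma root_nonzero: "\<gamma> \<in> \<Phi> \<Longrightarrow> \<gamma> \<noteq> 0"
  using root_norm by fastforce

lemma root_sign: "\<gamma> \<in> \<Phi> \<Longrightarrow> nonneg \<gamma> \<or> nonneg (- \<gamma>)"
  by (metis rootE ascent_nonneg descent_nonneg len_mult_S_neq linorder_neqE_nat)

lemma neg_root_iff: "\<gamma> \<in> \<Phi> \<Longrightarrow> - \<gamma> \<in> \<Phi>p \<longleftrightarrow> \<gamma> \<notin> \<Phi>p"
  using root_sign nonneg_antisym root_nonzero minus_root by (auto simp: pos_roots_iff)

lemma pos_root_in_roots: "\<gamma> \<in> \<Phi>p \<Longrightarrow> \<gamma> \<in> \<Phi>"
  by (simp add: pos_roots_iff)

lemma nonneg_pos_root: "\<gamma> \<in> \<Phi>p \<Longrightarrow> 0 \<le> coef \<gamma> s"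
  by (simp add: pos_roots_iff nonneg_def)

lemma root_posI: "\<gamma> \<in> \<Phi> \<Longrightarrow> coef \<gamma> s > 0 \<Longrightarrow> \<gamma> \<in> \<Phi>p"
  using root_sign[of \<gamma>] by (auto simp: pos_roots_iff nonneg_def dest: spec[of _ s])

lemma act_pos_root_iff_ascent:
  assumes "w \<in> carrier W" "s \<in> S"
  shows "w \<bullet> \<alpha> s \<in> \<Phi>p \<longleftrightarrow> len w < len (w \<otimes> s)"
proof -
  have r: "w \<bullet> \<alpha> s \<in> \<Phi>"
    using assms by (simp add: act_root simple_root_in_roots)
  then show ?thesis
    using ascent_nonneg[OF assms] descent_nonneg[OF assms] len_mult_S_neq[OF assms] neg_root_iff[OF r]
      minus_root[OF r]
    by (auto simp: pos_roots_iff linorder_neq_iff)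
qed

text \<open>The last letter of a reduced word for a nontrivial element is a descent. Applied to
  \<open>inv y \<otimes> x\<close>, the lemma reduces equalities in W to signs.\<close>

lemma all_simple_pos_imp_one:
  assumes "w \<in> carrier W" "\<And>s. s \<in> S \<Longrightarrow> w \<bullet> \<alpha> s \<in> \<Phi>p"
  shows "w = \<one>"
proof (rule ccontr)
  assume "w \<noteq> \<one>"
  obtain ss where ss: "set ss \<subseteq> S" "word_prod W ss = w" "length ss = len w"
    using reduced_word assms by blast
  then obtain r s where "ss = r @ [s]"
    using \<open>w \<noteq> \<one>\<close> by (cases ss rule: rev_cases) auto
  with ss have r: "set r \<subseteq> S" "s \<in> S" "w = word_prod W r \<otimes> s" "len w = Suc (length r)"
    by (auto simp: word_prod_append_S S_closed)
  then have "w \<otimes> s = word_prod W r"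
    by (simp add: mult_S_cancel)
  then show False
    using assms r len_le[of r] act_pos_root_iff_ascent[of w s] by simp
qed

lemma act_faithful:
  assumes "x \<in> carrier W" "y \<in> carrier W" "\<And>s. s \<in> S \<Longrightarrow> x \<bullet> \<alpha> s = y \<bullet> \<alpha> s"
  shows "x = y"
proof -
  have "inv y \<otimes> x = \<one>"
    using assms by (intro all_simple_pos_imp_one) (auto simp: act_mult simple_root_pos)
  then show ?thesis
    using assms by (metis inv_closed inv_equality inv_inv)
qed

text \<open>Otherwise the root is a multiple of \<alpha>_s, and since all roots have norm 1 it is
  \<alpha>_s itself.\<close>

lemma pos_root_coef_pos:
  assumes "\<gamma> \<in> \<Phi>p" "s \<in> S" "\<gamma> \<noteq> \<alpha> s"
  shows "\<exists>t. t \<noteq> s \<and> coef \<gamma> t > 0"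
proof (rule ccontr)
  assume "\<not> ?thesis"
  then have "coef \<gamma> t = 0" if "t \<noteq> s" for t
    using that assms by (metis nonneg_pos_root less_eq_real_def)
  then have eq: "\<gamma> = vscale (coef \<gamma> s) (\<alpha> s)"
    by (intro poly_mapping_eqI) (auto simp: coef_simple_root)
  have "vform W \<gamma> \<gamma> = coef \<gamma> s * coef \<gamma> s"
    using assms by (subst (1 2) eq) (simp add: vform_bilinear vform_simple_root gram_self)
  then have "coef \<gamma> s * coef \<gamma> s = 1"
    using assms root_norm by (simp add: pos_root_in_roots)
  then have "coef \<gamma> s = 1"
    using assms nonneg_pos_root[of \<gamma> s] square_eq_1_iff by force
  then show False
    using eq assms by (simp add: poly_mapping_eq_iff fun_eq_iff)
qed

text \<open>The reflection s leaves the positive coefficient at some t \<noteq> s unchanged, and a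
  single positive coefficient makes a root positive.\<close>

lemma simple_reflection_permutes:
  assumes "\<gamma> \<in> \<Phi>p" "s \<in> S" "\<gamma> \<noteq> \<alpha> s"
  shows "s \<bullet> \<gamma> \<in> \<Phi>p"
proof -
  obtain t where "t \<noteq> s" "coef \<gamma> t > 0"
    using pos_root_coef_pos assms by blast
  then show ?thesis
    using assms act_root[of s \<gamma>]
    by (intro root_posI[of _ t]) (auto simp: pos_root_in_roots S_closed act_S coef_simple_act)
qed

abbreviation refl :: "'a vec_space \<Rightarrow> 'a" where
  "refl \<equiv> root_reflection W S"

lemma conj_simple_act:
  assumes "w \<in> carrier W" "s \<in> S" "supp v \<subseteq> S"
  shows "(w \<otimes> s \<otimes> inv w) \<bullet> v = v - vscale (2 * vform W (w \<bullet> \<alpha> s) v) (w \<bullet> \<alpha> s)"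
proof -
  have "vform W (\<alpha> s) (inv w \<bullet> v) = vform W (w \<bullet> \<alpha> s) (w \<bullet> inv w \<bullet> v)"
    using assms by (intro vform_act[symmetric]) (simp_all add: supp_act)
  then show ?thesis
    using assms by (simp add: act_mult S_closed act_S simple_act_def act_diff act_scale)
qed

text \<open>For \<open>THE\<close>, the conjugate must depend on the root alone. It does: its action
  on V is given by a formula in the root, and the action is faithful.\<close>

lemma refl_simple_conj:
  assumes "w \<in> carrier W" "s \<in> S"
  shows "refl (w \<bullet> \<alpha> s) = w \<otimes> s \<otimes> inv w"
  unfolding root_reflection_def
proof (rule the_equality)
  fix r
  assume "\<exists>w'\<in>carrier W. \<exists>t\<in>S. w \<bullet> \<alpha> s = w' \<bullet> \<alpha> t \<and> r = w' \<otimes> t \<otimes> inv w'"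
  then obtain w' t where "w' \<in> carrier W" "t \<in> S" "w \<bullet> \<alpha> s = w' \<bullet> \<alpha> t" "r = w' \<otimes> t \<otimes> inv w'"
    by blast
  with assms show "r = w \<otimes> s \<otimes> inv w"
    by (intro act_faithful) (auto simp: S_closed conj_simple_act)
qed (use assms in blast)

lemma refl_closed: "\<gamma> \<in> \<Phi> \<Longrightarrow> refl \<gamma> \<in> carrier W"
  by (auto elim!: rootE simp: refl_simple_conj S_closed)

lemma refl_act: "\<gamma> \<in> \<Phi> \<Longrightarrow> supp v \<subseteq> S \<Longrightarrow> refl \<gamma> \<bullet> v = v - vscale (2 * vform W \<gamma> v) \<gamma>"
  by (auto elim!: rootE simp: refl_simple_conj conj_simple_act)

lemma refl_simple: "s \<in> S \<Longrightarrow> refl (\<alpha> s) = s"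
  using refl_simple_conj[of \<one> s] by (simp add: S_closed)

lemma refl_conj: "w \<in> carrier W \<Longrightarrow> \<gamma> \<in> \<Phi> \<Longrightarrow> refl (w \<bullet> \<gamma>) = w \<otimes> refl \<gamma> \<otimes> inv w"
proof (elim rootE)
  fix x s
  assume "w \<in> carrier W" "x \<in> carrier W" "s \<in> S" "\<gamma> = x \<bullet> \<alpha> s"
  then show "refl (w \<bullet> \<gamma>) = w \<otimes> refl \<gamma> \<otimes> inv w"
    using refl_simple_conj[of "w \<otimes> x" s]
    by (simp add: refl_simple_conj act_mult S_closed inv_mult_group m_assoc)
qed

lemma inv_cancel_left: "x \<in> carrier W \<Longrightarrow> y \<in> carrier W \<Longrightarrow> inv x \<otimes> (x \<otimes> y) = y"
  by (simp add: m_assoc[symmetric])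

lemma refl_square: "\<gamma> \<in> \<Phi> \<Longrightarrow> refl \<gamma> \<otimes> refl \<gamma> = \<one>"
proof (elim rootE)
  fix x s
  assume x: "x \<in> carrier W" "s \<in> S" "\<gamma> = x \<bullet> \<alpha> s"
  then have "refl \<gamma> \<otimes> refl \<gamma> = x \<otimes> (s \<otimes> (s \<otimes> inv x))"
    by (simp add: refl_simple_conj S_closed m_assoc inv_cancel_left)
  also have "\<dots> = x \<otimes> ((s \<otimes> s) \<otimes> inv x)"
    using x by (simp add: S_closed m_assoc)
  finally show "refl \<gamma> \<otimes> refl \<gamma> = \<one>"
    using x by (simp add: S_square)
qed

lemma refl_self: "\<gamma> \<in> \<Phi> \<Longrightarrow> refl \<gamma> \<bullet> \<gamma> = - \<gamma>"
  by (intro poly_mapping_eqI) (simp add: refl_act supp_root root_norm lookup_minus)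

lemma refl_minus: "\<gamma> \<in> \<Phi> \<Longrightarrow> refl (- \<gamma>) = refl \<gamma>"
  using refl_conj[of "refl \<gamma>" \<gamma>]
  by (simp add: refl_self refl_closed m_assoc refl_square inv_equality)

section \<open>The strong exchange condition and inversions\<close>

lemma exchange:
  assumes "set ss \<subseteq> S" "\<gamma> \<in> \<Phi>p" "word_prod W ss \<bullet> \<gamma> \<notin> \<Phi>p"
  shows "\<exists>ss'. set ss' \<subseteq> set ss \<and> length ss = Suc (length ss')
    \<and> word_prod W ss' = word_prod W ss \<otimes> refl \<gamma>"
  using assms
proof (induction ss)
  case (Cons s ss)
  let ?w = "word_prod W ss"
  have c: "?w \<in> carrier W" "s \<in> carrier W" "s \<in> S" "refl \<gamma> \<in> carrier W"
    using Cons.prems by (auto simp: S_closed refl_closed pos_root_in_roots)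
  show ?case
  proof (cases "?w \<bullet> \<gamma> \<in> \<Phi>p")
    case True
    \<comment> \<open>The letter s turns a positive root negative, and \<alpha>_s is the only such
      root. Multiplication by the reflection in \<gamma> then deletes this letter.\<close>
    then have "?w \<bullet> \<gamma> = \<alpha> s"
      using Cons.prems c simple_reflection_permutes[of "?w \<bullet> \<gamma>" s] by (auto simp: act_mult)
    then have "?w \<otimes> refl \<gamma> \<otimes> inv ?w = s"
      using refl_conj[of ?w \<gamma>] Cons.prems c by (simp add: pos_root_in_roots refl_simple)
    then have "?w \<otimes> refl \<gamma> = s \<otimes> ?w"
      using c by (metis inv_solve_right' m_closed)
    then have "s \<otimes> ?w \<otimes> refl \<gamma> = ?w"
      using c by (simp add: m_assoc) (simp add: m_assoc[symmetric] S_square)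
    then show ?thesis
      using Cons.prems by (intro exI[of _ ss]) auto
  next
    case False
    with Cons obtain ss' where "set ss' \<subseteq> set ss" "length ss = Suc (length ss')"
        "word_prod W ss' = ?w \<otimes> refl \<gamma>"
      by auto
    then show ?thesis
      using c by (intro exI[of _ "s # ss'"]) (auto simp: m_assoc)
  qed
qed simp

lemma len_mult_refl:
  assumes "w \<in> carrier W" "\<gamma> \<in> \<Phi>p" "w \<bullet> \<gamma> \<notin> \<Phi>p"
  shows "len (w \<otimes> refl \<gamma>) < len w"
proof -
  obtain ss where ss: "set ss \<subseteq> S" "word_prod W ss = w" "length ss = len w"
    using reduced_word assms by blast
  then obtain ss' where ss': "set ss' \<subseteq> set ss" "length ss = Suc (length ss')"
      "word_prod W ss' = w \<otimes> refl \<gamma>"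
    using exchange assms by metis
  then have "set ss' \<subseteq> S"
    using ss by blast
  from len_le[OF this] show ?thesis
    using ss ss' by simp
qed

text \<open>Each further letter s adds at most one inversion, the root that the rest of the word
  carries to \<alpha>_s.\<close>

lemma finite_inversions: "w \<in> carrier W \<Longrightarrow> finite {\<gamma> \<in> \<Phi>p. w \<bullet> \<gamma> \<notin> \<Phi>p}"
proof (elim carrier_word)
  fix ss
  assume "set ss \<subseteq> S" "word_prod W ss = w"
  moreover have "finite {\<gamma> \<in> \<Phi>p. word_prod W ss \<bullet> \<gamma> \<notin> \<Phi>p}" if "set ss \<subseteq> S"
    using that
  proof (induction ss)
    case (Cons s ss)
    let ?w = "word_prod W ss"
    have "{\<gamma> \<in> \<Phi>p. word_prod W (s # ss) \<bullet> \<gamma> \<notin> \<Phi>p}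
        \<subseteq> insert (inv ?w \<bullet> \<alpha> s) {\<gamma> \<in> \<Phi>p. ?w \<bullet> \<gamma> \<notin> \<Phi>p}"
      using Cons.prems simple_reflection_permutes
      by (auto simp: act_mult S_closed act_eq_inv_iff[symmetric])
    moreover have "finite (insert (inv ?w \<bullet> \<alpha> s) {\<gamma> \<in> \<Phi>p. ?w \<bullet> \<gamma> \<notin> \<Phi>p})"
      using Cons by simp
    ultimately show ?case
      by (rule finite_subset)
  qed simp
  ultimately show ?thesis by simp
qed


section \<open>Parabolic subgroups\<close>

text \<open>The word is chosen shortest among those over J, which avoids a comparison of the lengths
  in W_J and in W. Exchange only deletes letters, so it stays within words over J.\<close>

lemma parabolic_pos_imp_one:
  assumes J: "J \<subseteq> S" and w: "w \<in> generate W J" and pos: "\<And>j. j \<in> J \<Longrightarrow> w \<bullet> \<alpha> j \<in> \<Phi>p"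
  shows "w = \<one>"
proof -
  obtain u where u: "set u \<subseteq> J" "word_prod W u = w"
    using generate_word w J by blast
  then obtain ss where ss: "set ss \<subseteq> J \<and> word_prod W ss = w"
      and min: "\<And>v. set v \<subseteq> J \<and> word_prod W v = w \<Longrightarrow> length ss \<le> length v"
    using ex_has_least_nat[of "\<lambda>u. set u \<subseteq> J \<and> word_prod W u = w" u length] by blast
  have "ss = []"
  proof (rule ccontr)
    assume "ss \<noteq> []"
    then obtain b s where bs: "ss = b @ [s]"
      by (cases ss rule: rev_cases) auto
    with ss J have bS: "set b \<subseteq> S" "s \<in> S" "s \<in> J" "w = word_prod W (b @ [s])"
      by auto
    then have b: "set b \<subseteq> S" "s \<in> S" "s \<in> J" "w = word_prod W b \<otimes> s"
      using word_prod_append_S[of b "[s]"] by (auto simp: S_closed)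
    \<comment> \<open>Since b makes \<alpha>_s negative, exchange shortens b to a word for b s,
      which is w again.\<close>
    have "word_prod W b \<bullet> \<alpha> s = - (w \<bullet> \<alpha> s)"
      using b by (simp add: act_mult S_closed simple_act_self act_minus)
    moreover have "w \<bullet> \<alpha> s \<in> \<Phi>p"
      using pos b by simp
    ultimately have "word_prod W b \<bullet> \<alpha> s \<notin> \<Phi>p"
      by (metis neg_root_iff pos_root_in_roots)
    then obtain b' where "set b' \<subseteq> set b" "length b = Suc (length b')" "word_prod W b' = w"
      using exchange[of b "\<alpha> s"] b by (auto simp: refl_simple simple_root_pos)
    then show False
      using min[of b'] ss bs by auto
  qed
  with ss show ?thesis by simp
qed

lemma parabolic_pos_outside:
  assumes "J \<subseteq> S" "w \<in> generate W J" "\<gamma> \<in> \<Phi>p" "\<not> supp \<gamma> \<subseteq> J"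
  shows "w \<bullet> \<gamma> \<in> \<Phi>p"
proof -
  obtain k where "k \<notin> J" "k \<in> supp \<gamma>"
    using assms by blast
  then have "coef \<gamma> k > 0" "coef (w \<bullet> \<gamma>) k = coef \<gamma> k"
    using assms nonneg_pos_root[of \<gamma> k] generate_act_coef[of J w k \<gamma>]
    by (auto simp: in_keys_iff less_le)
  then show ?thesis
    using assms generate_closed by (intro root_posI[of _ k]) (auto simp: act_root pos_root_in_roots)
qed

lemma parabolic_fix:
  assumes "J \<subseteq> S" "w \<in> generate W J" "supp v \<subseteq> S" "\<And>j. j \<in> J \<Longrightarrow> vform W v (\<alpha> j) = 0"
  shows "w \<bullet> v = v"
proof -
  have "simple_act W j v = v" if "j \<in> J" for j
    using that assms vform_commute[of v "\<alpha> j"]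
    by (intro poly_mapping_eqI) (auto simp: coef_simple_act)
  moreover obtain ss where "set ss \<subseteq> J" "word_prod W ss = w"
    using generate_word assms by blast
  moreover have "word_act W ss v = v" if "set ss \<subseteq> J"
    using that calculation(1) by (induction ss) auto
  ultimately show ?thesis
    using act_word_prod[of ss v] assms(1) by auto
qed

lemma parabolic_supp:
  assumes "J \<subseteq> S" "w \<in> generate W J" "supp v \<subseteq> J"
  shows "supp (w \<bullet> v) \<subseteq> J"
  using generate_act_coef[OF assms(1,2)] assms(3) by (auto simp: in_keys_iff subset_iff)


section \<open>Longest elements\<close>

lemma root_multiple:
  assumes "\<gamma> \<in> \<Phi>" "\<delta> \<in> \<Phi>" "\<gamma> = vscale c \<delta>"
  shows "\<gamma> = \<delta> \<or> \<gamma> = - \<delta>"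
proof -
  have "vform W \<gamma> \<gamma> = c * c"
    using assms by (simp add: vform_bilinear root_norm)
  then have "c = 1 \<or> c = - 1"
    using assms root_norm[of \<gamma>] by (simp add: square_eq_1_iff)
  moreover have "vscale 1 \<delta> = \<delta>"
    by (rule poly_mapping_eqI) simp
  ultimately show ?thesis
    using assms(3) vscale_minus_one by metis
qed

text \<open>The common reflection negates \<gamma>. Written out as the reflection in \<delta>, this
  says that \<gamma> is a multiple of \<delta>.\<close>

lemma refl_eq_imp:
  assumes "\<gamma> \<in> \<Phi>" "\<delta> \<in> \<Phi>" "refl \<gamma> = refl \<delta>"
  shows "\<gamma> = \<delta> \<or> \<gamma> = - \<delta>"
proof (rule root_multiple[OF assms(1,2)])
  have "\<gamma> - vscale (2 * vform W \<delta> \<gamma>) \<delta> = - \<gamma>"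
    using assms refl_self[of \<gamma>] by (simp add: refl_act supp_root)
  then show "\<gamma> = vscale (vform W \<delta> \<gamma>) \<delta>"
    by (simp add: poly_mapping_eq_iff fun_eq_iff lookup_minus)
qed

lemma pos_root_supp_singleton:
  assumes "\<gamma> \<in> \<Phi>p" "s \<in> S" "supp \<gamma> \<subseteq> {s}"
  shows "\<gamma> = \<alpha> s"
proof (rule ccontr)
  assume "\<gamma> \<noteq> \<alpha> s"
  then obtain t where "t \<noteq> s" "coef \<gamma> t > 0"
    using pos_root_coef_pos assms by blast
  then show False
    using assms(3) by (auto simp: in_keys_iff subset_iff)
qed

lemma pos_root_not_neg: "\<gamma> \<in> \<Phi>p \<Longrightarrow> - \<gamma> \<notin> \<Phi>p"
  using neg_root_iff[of \<gamma>] by (simp add: pos_root_in_roots)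

lemma supp_minus [simp]: "supp (- v :: 'a vec_space) = supp v"
  by (auto simp: in_keys_iff)

text \<open>If \<open>\<epsilon>w\<close> and its inverse preserve positivity, then \<open>\<epsilon>w\<close> maps simple roots to simple roots since these
  are the indecomposable positive roots.\<close>

lemma simple_root_image:
  assumes w: "w \<in> carrier W" and j: "j \<in> S" and K: "K \<subseteq> S"
    and eps: "\<epsilon> = 1 \<or> \<epsilon> = (-1::real)"
    and fwd: "vscale \<epsilon> (w \<bullet> \<alpha> j) \<in> \<Phi>p" "supp (w \<bullet> \<alpha> j) \<subseteq> K"
    and bwd: "\<And>k. k \<in> K \<Longrightarrow> vscale \<epsilon> (inv w \<bullet> \<alpha> k) \<in> \<Phi>p"
  obtains k where "k \<in> K" "w \<bullet> \<alpha> j = vscale \<epsilon> (\<alpha> k)"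
proof -
  define \<gamma> where "\<gamma> = vscale \<epsilon> (w \<bullet> \<alpha> j)"
  have dbl: "vscale \<epsilon> (vscale \<epsilon> v) = v" for v :: "'a vec_space"
    using eps by (auto intro!: poly_mapping_eqI)
  have supp: "supp \<gamma> \<subseteq> K"
    unfolding \<gamma>_def by (rule subset_trans[OF supp_vscale fwd(2)])
  have "\<gamma> \<noteq> 0"
    using fwd(1) root_nonzero pos_root_in_roots by (auto simp: \<gamma>_def)
  then obtain k where k: "k \<in> supp \<gamma>"
    by fastforce
  define \<beta> where "\<beta> = (\<lambda>i. vscale \<epsilon> (inv w \<bullet> \<alpha> i))"
  have beta_pos: "\<beta> i \<in> \<Phi>p" if "i \<in> supp \<gamma>" for i
    using that supp bwd by (auto simp: \<beta>_def)
  have "\<alpha> j = vscale \<epsilon> (inv w \<bullet> \<gamma>)"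
    using w by (simp add: \<gamma>_def act_scale dbl)
  also have "inv w \<bullet> \<gamma> = (\<Sum>i\<in>supp \<gamma>. vscale (coef \<gamma> i) (inv w \<bullet> \<alpha> i))"
    by (subst vec_expand[of \<gamma>]) (simp only: act_sum act_scale)
  \<comment> \<open>This expresses \<alpha>_j by the positive roots \<open>\<beta> i\<close> with
    nonnegative coefficients, so at every t \<noteq> j all terms vanish. A \<open>\<beta> k\<close>
    that really occurs is thus supported on j alone.\<close>
  finally have sum: "coef (\<alpha> j) t = (\<Sum>i\<in>supp \<gamma>. coef \<gamma> i * coef (\<beta> i) t)" for t
    by (simp add: \<beta>_def lookup_sum sum_distrib_left mult_ac)
  have "coef (\<beta> k) t = 0" if "t \<noteq> j" for t
  proof -
    have nn: "coef \<gamma> i * coef (\<beta> i) t \<ge> 0" if "i \<in> supp \<gamma>" for i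
      using that fwd(1) beta_pos by (intro mult_nonneg_nonneg) (auto simp only: \<gamma>_def nonneg_pos_root)
    have "(\<Sum>i\<in>supp \<gamma>. coef \<gamma> i * coef (\<beta> i) t) = 0"
      using sum[of t] that by (simp add: coef_simple_root)
    then have "coef \<gamma> k * coef (\<beta> k) t = 0"
      using k nn by (simp add: sum_nonneg_eq_0_iff)
    then show ?thesis
      using k by (simp add: in_keys_iff)
  qed
  then have "supp (\<beta> k) \<subseteq> {j}"
    by (auto simp: in_keys_iff)
  then have "\<beta> k = \<alpha> j"
    using beta_pos k j pos_root_supp_singleton by blast
  then have "w \<bullet> vscale \<epsilon> (\<beta> k) = vscale \<epsilon> (w \<bullet> \<alpha> j)"
    by (simp add: act_scale)
  then have "w \<bullet> \<alpha> j = vscale \<epsilon> (\<alpha> k)"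
    using w by (metis \<beta>_def act_inv_right dbl)
  with k supp that show thesis
    by blast
qed

lemma neg_on_supp:
  assumes w: "w \<in> carrier W" and J: "J \<subseteq> S" and neg: "\<And>j. j \<in> J \<Longrightarrow> w \<bullet> \<alpha> j \<notin> \<Phi>p"
    and \<gamma>: "\<gamma> \<in> \<Phi>p" "supp \<gamma> \<subseteq> J"
  shows "w \<bullet> \<gamma> \<notin> \<Phi>p"
proof -
  have "nonneg (- (w \<bullet> \<alpha> j))" if "j \<in> J" for j
    using that neg[of j] w J root_sign[of "w \<bullet> \<alpha> j"]
    by (auto simp: pos_roots_iff act_root simple_root_in_roots)
  then have "coef (w \<bullet> \<alpha> j) k \<le> 0" if "j \<in> J" for j k
    using that by (auto simp: nonneg_def)
  then have "coef (w \<bullet> \<gamma>) k \<le> 0" for k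
    unfolding coef_act[of w \<gamma>] using \<gamma>
    by (intro sum_nonpos mult_nonneg_nonpos) (auto simp: nonneg_pos_root)
  then have "nonneg (- (w \<bullet> \<gamma>))"
    by (auto simp: nonneg_def)
  then have "- (w \<bullet> \<gamma>) \<in> \<Phi>p"
    using w \<gamma> by (simp add: pos_roots_iff act_root minus_root)
  then show ?thesis
    using pos_root_not_neg by fastforce
qed

text \<open>All positive roots supported on J are inversions of w, so only finitely many roots are
  supported on J. The parabolic subgroup permutes them, and it does so faithfully because the signs
  on the simple roots of J detect the identity. The point is that w may lie outside W_J.\<close>

lemma finite_type_if_neg:
  assumes w: "w \<in> carrier W" and J: "J \<subseteq> S" and neg: "\<And>j. j \<in> J \<Longrightarrow> w \<bullet> \<alpha> j \<notin> \<Phi>p"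
  shows "finite_type W J"
proof -
  define P where "P = {\<gamma> \<in> \<Phi>p. supp \<gamma> \<subseteq> J}"
  define R where "R = {\<gamma> \<in> \<Phi>. supp \<gamma> \<subseteq> J}"
  have "P \<subseteq> {\<gamma> \<in> \<Phi>p. w \<bullet> \<gamma> \<notin> \<Phi>p}"
    using neg_on_supp[OF w J neg] by (auto simp: P_def)
  then have "finite P"
    using finite_inversions[OF w] finite_subset by blast
  moreover have "R \<subseteq> P \<union> uminus ` P"
  proof
    fix \<gamma>
    assume g: "\<gamma> \<in> R"
    show "\<gamma> \<in> P \<union> uminus ` P"
    proof (cases "\<gamma> \<in> \<Phi>p")
      case False
      then have "- \<gamma> \<in> P"
        using g neg_root_iff by (auto simp: R_def P_def)
      then show ?thesis
        by (metis UnI2 imageI minus_minus)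
    qed (use g in \<open>auto simp: P_def R_def\<close>)
  qed
  ultimately have R: "finite R"
    by (meson finite_Un finite_imageI finite_subset)
  have "inj_on (\<lambda>u. restrict (act W S u) R) (generate W J)"
  proof (rule inj_onI)
    fix u v
    assume uv: "u \<in> generate W J" "v \<in> generate W J"
      "restrict (act W S u) R = restrict (act W S v) R"
    have c: "u \<in> carrier W" "v \<in> carrier W"
      using uv J generate_closed by auto
    have "u \<bullet> \<alpha> j = v \<bullet> \<alpha> j" if "j \<in> J" for j
      using fun_cong[OF uv(3), of "\<alpha> j"] that J by (auto simp: R_def simple_root_in_roots)
    then have "inv v \<otimes> u = \<one>"
      using uv J c
      by (intro parabolic_pos_imp_one[OF J])
        (auto simp: act_mult simple_root_pos subset_iff
          intro: generate.eng generate_m_inv_closed[OF subset_trans[OF J S_subset_carrier]])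
    then show "u = v"
      using c by (metis inv_closed inv_equality inv_inv)
  qed
  moreover have "(\<lambda>u. restrict (act W S u) R) ` generate W J \<subseteq> R \<rightarrow>\<^sub>E R"
    using generate_closed[OF J] subsetD[OF parabolic_supp[OF J]]
    by (intro image_subsetI restrict_PiE_iff[THEN iffD2] ballI) (auto simp: R_def act_root)
  ultimately show ?thesis
    using R finite_PiE[of R "\<lambda>_. R"] unfolding finite_type_def
    by (meson finite_imageD finite_subset)
qed

lemma generate_inv_closed: "J \<subseteq> S \<Longrightarrow> w \<in> generate W J \<Longrightarrow> inv w \<in> generate W J"
  by (rule generate_m_inv_closed[OF subset_trans[OF _ S_subset_carrier]])

lemma finite_type_mono: "finite_type W J \<Longrightarrow> K \<subseteq> J \<Longrightarrow> finite_type W K"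
  unfolding finite_type_def by (meson mono_generate finite_subset)

abbreviation w0 :: "'a set \<Rightarrow> 'a" where
  "w0 \<equiv> longest_elt W S"

text \<open>Two sign reversals on J compose to an element of W_J that keeps the simple roots of J
  positive, which is the identity.\<close>

lemma negative_unique:
  assumes J: "J \<subseteq> S" and u: "u \<in> generate W J" "\<And>j. j \<in> J \<Longrightarrow> u \<bullet> \<alpha> j \<notin> \<Phi>p"
    and v: "v \<in> generate W J" "\<And>j. j \<in> J \<Longrightarrow> v \<bullet> \<alpha> j \<notin> \<Phi>p"
  shows "u = v"
proof -
  have c: "u \<in> carrier W" "v \<in> carrier W"
    using u v J generate_closed by auto
  have "(inv v \<otimes> u) \<bullet> \<alpha> j \<in> \<Phi>p" if j: "j \<in> J" for j
  proof (rule ccontr)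
    assume "(inv v \<otimes> u) \<bullet> \<alpha> j \<notin> \<Phi>p"
    then have n: "- ((inv v \<otimes> u) \<bullet> \<alpha> j) \<in> \<Phi>p"
      using j J c by (subst neg_root_iff) (auto simp: act_root simple_root_in_roots)
    have iv: "inv v \<otimes> u \<in> generate W J"
      using u v J by (simp add: generate.eng generate_inv_closed)
    have "supp (- ((inv v \<otimes> u) \<bullet> \<alpha> j)) \<subseteq> J"
      using parabolic_supp[OF J iv, of "\<alpha> j"] j by simp
    then have "v \<bullet> (- ((inv v \<otimes> u) \<bullet> \<alpha> j)) \<notin> \<Phi>p"
      using neg_on_supp[OF c(2) J _ n] v(2) by blast
    then have "- (u \<bullet> \<alpha> j) \<notin> \<Phi>p"
      using c by (simp add: act_minus act_mult)
    then show False
      using u(2)[OF j] j J c neg_root_iff[of "u \<bullet> \<alpha> j"] by (auto simp: act_root simple_root_in_roots)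
  qed
  then have "inv v \<otimes> u = \<one>"
    using u v J by (intro parabolic_pos_imp_one[OF J]) (auto simp: generate.eng generate_inv_closed)
  then show ?thesis
    using c by (metis inv_closed inv_equality inv_inv)
qed

lemma maximal_length_neg:
  assumes J: "J \<subseteq> S" and w: "w \<in> generate W J" "\<And>v. v \<in> generate W J \<Longrightarrow> len v \<le> len w"
    and j: "j \<in> J"
  shows "w \<bullet> \<alpha> j \<notin> \<Phi>p"
proof
  assume "w \<bullet> \<alpha> j \<in> \<Phi>p"
  then have "len w < len (w \<otimes> j)"
    using act_pos_root_iff_ascent[of w j] w(1) j J generate_closed by auto
  moreover have "w \<otimes> j \<in> generate W J"
    using w(1) j by (auto intro: generate.intros)
  ultimately show False
    using w(2) by force
qed

text \<open>This replaces maximal length by a sign condition. An element of maximal length has no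
  ascent in J, and \<open>negative_unique\<close> leaves only one such element; finiteness provides
  the maximum.\<close>

lemma longest_elt_eqI:
  assumes J: "J \<subseteq> S" "finite_type W J"
    and v: "v \<in> generate W J" "\<And>j. j \<in> J \<Longrightarrow> v \<bullet> \<alpha> j \<notin> \<Phi>p"
  shows "w0 J = v"
proof -
  let ?max = "\<lambda>w. w \<in> generate W J \<and> (\<forall>v \<in> generate W J. len v \<le> len w)"
  have eq: "w = v" if "?max w" for w
    using that maximal_length_neg J v by (intro negative_unique[of J]) auto
  have "\<exists>w. ?max w"
  proof -
    have fin: "finite (len ` generate W J)"
      using J by (simp add: finite_type_def)
    have "len ` generate W J \<noteq> {}"
      using v by auto
    then have "Max (len ` generate W J) \<in> len ` generate W J"
      using fin by (rule Max_in[rotated])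
    then obtain w where "w \<in> generate W J" "len w = Max (len ` generate W J)"
      by auto
    with fin show ?thesis
      by (intro exI[of _ w]) simp
  qed
  then have "?max v"
    using eq by blast
  then show ?thesis
    unfolding longest_elt_def using eq by (rule the_equality)
qed

lemma longest_elt:
  assumes J: "J \<subseteq> S" "finite_type W J"
  shows longest_elt_in: "w0 J \<in> generate W J"
    and longest_elt_neg: "j \<in> J \<Longrightarrow> w0 J \<bullet> \<alpha> j \<notin> \<Phi>p"
proof -
  have fin: "finite (len ` generate W J)"
    using J by (simp add: finite_type_def)
  have "len ` generate W J \<noteq> {}"
    using generate.one by blast
  then have "Max (len ` generate W J) \<in> len ` generate W J"
    using fin by (rule Max_in[rotated])
  then obtain w where w: "w \<in> generate W J" "len w = Max (len ` generate W J)"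
    by auto
  then have "w \<bullet> \<alpha> j \<notin> \<Phi>p" if "j \<in> J" for j
    using fin that by (intro maximal_length_neg[OF J(1)]) auto
  moreover from this w have "w0 J = w"
    using J by (intro longest_elt_eqI) auto
  ultimately show "w0 J \<in> generate W J" "j \<in> J \<Longrightarrow> w0 J \<bullet> \<alpha> j \<notin> \<Phi>p"
    using w by auto
qed

lemma longest_elt_closed: "J \<subseteq> S \<Longrightarrow> finite_type W J \<Longrightarrow> w0 J \<in> carrier W"
  by (rule generate_closed[OF _ longest_elt_in])

lemma inv_longest_elt:
  assumes J: "J \<subseteq> S" "finite_type W J"
  shows "inv (w0 J) = w0 J"
proof (rule longest_elt_eqI[OF J, symmetric])
  have c: "w0 J \<in> carrier W"
    using J by (rule longest_elt_closed)
  show iv: "inv (w0 J) \<in> generate W J"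
    using J longest_elt_in by (simp add: generate_inv_closed)
  show "inv (w0 J) \<bullet> \<alpha> j \<notin> \<Phi>p" if j: "j \<in> J" for j
  proof
    assume "inv (w0 J) \<bullet> \<alpha> j \<in> \<Phi>p"
    then have "w0 J \<bullet> inv (w0 J) \<bullet> \<alpha> j \<notin> \<Phi>p"
      using j parabolic_supp[OF J(1) iv, of "\<alpha> j"]
      by (intro neg_on_supp[OF c J(1) longest_elt_neg[OF J]]) auto
    then show False
      using c j J simple_root_pos by auto
  qed
qed

lemma longest_elt_square: "J \<subseteq> S \<Longrightarrow> finite_type W J \<Longrightarrow> w0 J \<otimes> w0 J = \<one>"
  using r_inv[OF longest_elt_closed] by (simp only: inv_longest_elt)

lemma longest_elt_act_twice: "J \<subseteq> S \<Longrightarrow> finite_type W J \<Longrightarrow> w0 J \<bullet> w0 J \<bullet> v = v"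
  using act_mult[OF longest_elt_closed longest_elt_closed, of J J v]
  by (simp only: longest_elt_square act_one)

text \<open>The negative of w_0(J) preserves the positivity of simple roots of J, and w_0(J) is its
  own inverse, so \<open>simple_root_image\<close> applies with \<epsilon> = -1.\<close>

lemma longest_elt_simple:
  assumes J: "J \<subseteq> S" "finite_type W J" and j: "j \<in> J"
  obtains k where "k \<in> J" "w0 J \<bullet> \<alpha> j = - \<alpha> k"
proof -
  have c: "w0 J \<in> carrier W"
    using J by (rule longest_elt_closed)
  have neg: "vscale (-1) (w0 J \<bullet> \<alpha> i) \<in> \<Phi>p" if "i \<in> J" for i
  proof -
    have "w0 J \<bullet> \<alpha> i \<in> \<Phi>"
      using that J c by (auto intro!: act_root simple_root_in_roots)
    then show ?thesis
      using longest_elt_neg[OF J that] by (simp add: vscale_minus_one neg_root_iff)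
  qed
  have "supp (w0 J \<bullet> \<alpha> j) \<subseteq> J"
    using parabolic_supp[OF J(1) longest_elt_in[OF J]] j by simp
  moreover have "vscale (-1) (inv (w0 J) \<bullet> \<alpha> k) \<in> \<Phi>p" if "k \<in> J" for k
    using neg[OF that] by (simp only: inv_longest_elt[OF J])
  ultimately obtain k where "k \<in> J" "w0 J \<bullet> \<alpha> j = vscale (-1) (\<alpha> k)"
    using simple_root_image[OF c _ J(1), of j "-1"] neg[OF j] j J(1) by blast
  with that show thesis
    by (simp only: vscale_minus_one)
qed

lemma conj_simple_eqI:
  assumes "w \<in> carrier W" "s \<in> S" "t \<in> S" "w \<bullet> \<alpha> s = \<alpha> t \<or> w \<bullet> \<alpha> s = - \<alpha> t"
  shows "w \<otimes> s \<otimes> inv w = t"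
proof -
  have "refl (w \<bullet> \<alpha> s) = t"
    using assms(3,4) refl_minus[of "\<alpha> t"] by (auto simp: refl_simple simple_root_in_roots)
  then show ?thesis
    using refl_simple_conj[OF assms(1,2)] by simp
qed


section \<open>Reflection subgroups\<close>

lemma generate_involutions_word:
  assumes "w \<in> generate W R" and R: "R \<subseteq> carrier W" "\<And>r. r \<in> R \<Longrightarrow> inv r = r"
  obtains rs where "set rs \<subseteq> R" "word_prod W rs = w"
proof -
  have "\<exists>rs. set rs \<subseteq> R \<and> word_prod W rs = w"
    using assms(1)
  proof (induction rule: generate.induct)
    case one
    show ?case by (intro exI[of _ "[]"]) simp
  next
    case (incl h)
    then show ?case using R by (intro exI[of _ "[h]"]) auto
  next
    case (inv h)
    then show ?case using R by (intro exI[of _ "[h]"]) auto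
  next
    case (eng h1 h2)
    then obtain u v where uv: "set u \<subseteq> R" "word_prod W u = h1" "set v \<subseteq> R" "word_prod W v = h2"
      by auto
    then have "word_prod W (u @ v) = h1 \<otimes> h2"
      using R word_prod_append[of u v] by auto
    with uv show ?case
      by (intro exI[of _ "u @ v"]) auto
  qed
  with that show ?thesis by blast
qed

text \<open>An alternating word of odd length is a palindrome, that is, a conjugate of its middle
  letter. The induction exchanges a and b, since stripping the two outer letters b leaves a word
  that begins and ends with a.\<close>

lemma odd_alt_word_conj:
  assumes "a \<in> carrier W" "b \<in> carrier W" "a \<otimes> a = \<one>" "b \<otimes> b = \<one>"
  shows "\<exists>x\<in>generate W {a, b}. \<exists>r\<in>{a, b}. word_prod W (alt_word a b (Suc (2 * n))) = x \<otimes> r \<otimes> inv x"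
  using assms
proof (induction n arbitrary: a b)
  case 0
  then show ?case
    by (intro bexI[of _ \<one>] bexI[of _ b]) (auto intro: generate.one)
next
  case (Suc n)
  obtain x r where x: "x \<in> generate W {b, a}" "r \<in> {b, a}"
      and eq: "word_prod W (alt_word b a (Suc (2 * n))) = x \<otimes> r \<otimes> inv x"
    using Suc.IH[OF Suc.prems(2,1,4,3)] by blast
  have c: "x \<in> carrier W" "r \<in> carrier W" "set (alt_word b a (Suc (2 * n))) \<subseteq> carrier W"
    using x Suc.prems generate_in_carrier[of "{b, a}" x] set_alt_word[of b a "Suc (2 * n)"] by auto
  have "alt_word a b (Suc (2 * Suc n)) = b # alt_word b a (Suc (2 * n)) @ [b]"
    using alt_word_snoc[of a b "Suc (2 * n)"] by simp
  then have "word_prod W (alt_word a b (Suc (2 * Suc n))) = b \<otimes> (x \<otimes> r \<otimes> inv x \<otimes> b)"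
    using c Suc.prems word_prod_append[of "alt_word b a (Suc (2 * n))" "[b]"] eq by simp
  also have "\<dots> = (b \<otimes> x) \<otimes> r \<otimes> inv (b \<otimes> x)"
  proof -
    have "inv b = b"
      using Suc.prems by (simp add: inv_equality)
    then show ?thesis
      using c Suc.prems by (simp add: inv_mult_group m_assoc)
  qed
  finally show ?case
    using x by (intro bexI[of _ "b \<otimes> x"] bexI[of _ r])
      (auto intro: generate.eng generate.incl simp: insert_commute)
qed

text \<open>Words in two involutions reduce to alternating ones. Those of odd length are conjugates
  of a or b; one of even length becomes odd by one more letter, so it is a conjugate times a
  generator. This includes the empty word.\<close>

lemma dihedral_elements:
  assumes ab: "a \<in> carrier W" "b \<in> carrier W" "a \<otimes> a = \<one>" "b \<otimes> b = \<one>"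
    and u: "u \<in> generate W {a, b}"
  obtains x r where "x \<in> generate W {a, b}" "r \<in> {a, b}" "u = x \<otimes> r \<otimes> inv x"
  | x r q where "x \<in> generate W {a, b}" "r \<in> {a, b}" "q \<in> {a, b}" "u = x \<otimes> r \<otimes> inv x \<otimes> q"
proof -
  have ivab: "inv a = a" "inv b = b"
    using ab by (simp_all add: inv_equality)
  obtain ws where ws: "set ws \<subseteq> {a, b}" "word_prod W ws = u"
    using ab ivab u by (elim generate_involutions_word) auto
  have alt: "\<exists>n. word_prod W ws = word_prod W (alt_word a b n) \<or> word_prod W ws = word_prod W (alt_word b a n)"
    if "set ws \<subseteq> {a, b}"
    using that
  proof (induction ws)
    case Nil
    show ?case by (intro exI[of _ 0]) simp
  next
    case (Cons x ws)
    have step: "\<exists>n'. x \<otimes> word_prod W (alt_word s t n) = word_prod W (alt_word s t n')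
          \<or> x \<otimes> word_prod W (alt_word s t n) = word_prod W (alt_word t s n')"
      if "{s, t} = {a, b}" "x \<in> {s, t}" for s t n
    proof -
      have st: "s \<in> carrier W" "t \<in> carrier W" "s \<otimes> s = \<one>" "t \<otimes> t = \<one>"
        using that ab by (auto simp: doubleton_eq_iff)
      consider "x = (if even n then t else s)" | "x \<noteq> (if even n then t else s)" "n = 0"
        | m where "x \<noteq> (if even n then t else s)" "n = Suc m"
        by (cases n) auto
      then show ?thesis
      proof cases
        case 1
        then show ?thesis by (intro exI[of _ "Suc n"]) simp
      next
        case 2
        then have "x = s"
          using that by auto
        then show ?thesis
          using 2 by (intro exI[of _ "Suc 0"]) simp
      next
        case (3 m)
        then have x: "x = (if even m then t else s)"
          using that by (auto split: if_splits)
        moreover have "word_prod W (alt_word s t m) \<in> carrier W"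
          using st set_alt_word[of s t m] by (intro word_prod_closed) auto
        ultimately have "x \<otimes> word_prod W (alt_word s t n) = word_prod W (alt_word s t m)"
          using st 3 by (auto simp flip: m_assoc)
        then show ?thesis by blast
      qed
    qed
    from Cons obtain n where "word_prod W ws = word_prod W (alt_word a b n)
        \<or> word_prod W ws = word_prod W (alt_word b a n)"
      by auto
    then show ?case
      using step[of a b n] step[of b a n] Cons.prems by (auto simp: insert_commute)
  qed
  then obtain n where n: "u = word_prod W (alt_word a b n) \<or> u = word_prod W (alt_word b a n)"
    using ws by blast
  have "\<exists>x\<in>generate W {a, b}. \<exists>r\<in>{a, b}. u = x \<otimes> r \<otimes> inv x \<or> (\<exists>q\<in>{a, b}. u = x \<otimes> r \<otimes> inv x \<otimes> q)"
    if st: "{s, t} = {a, b}" "u = word_prod W (alt_word s t n)" for s t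
  proof -
    have sc: "s \<in> carrier W" "t \<in> carrier W" "s \<otimes> s = \<one>" "t \<otimes> t = \<one>"
      using that ab by (auto simp: doubleton_eq_iff)
    show ?thesis
    proof (cases "even n")
      case True
      then obtain k where k: "n = 2 * k" by blast
      obtain x r where x: "x \<in> generate W {t, s}" "r \<in> {t, s}"
          "word_prod W (alt_word t s (Suc (2 * k))) = x \<otimes> r \<otimes> inv x"
        using odd_alt_word_conj[of t s k] sc by blast
      have "alt_word t s (Suc n) = alt_word s t n @ [s]"
        by (rule alt_word_snoc)
      then have "x \<otimes> r \<otimes> inv x = u \<otimes> s"
        using x(3) sc st(2) k word_prod_append[of "alt_word s t n" "[s]"] set_alt_word[of s t n] by auto
      moreover have "u \<in> carrier W"
        using sc st(2) set_alt_word[of s t n] by (auto intro!: word_prod_closed)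
      ultimately have "x \<otimes> r \<otimes> inv x \<otimes> s = u"
        using sc by (simp add: m_assoc)
      then have "u = x \<otimes> r \<otimes> inv x \<otimes> s" ..
      moreover have "x \<in> generate W {a, b}" "r \<in> {a, b}" "s \<in> {a, b}"
        using x st(1) by (auto simp: insert_commute)
      ultimately show ?thesis by blast
    next
      case False
      then obtain k where k: "n = Suc (2 * k)" by (auto elim: oddE)
      then show ?thesis
        using odd_alt_word_conj[of s t k] sc that by auto
    qed
  qed
  from this[of a b] this[of b a] n
  have "\<exists>x\<in>generate W {a, b}. \<exists>r\<in>{a, b}. u = x \<otimes> r \<otimes> inv x \<or> (\<exists>q\<in>{a, b}. u = x \<otimes> r \<otimes> inv x \<otimes> q)"
    by (auto simp: insert_commute)
  with that show thesis by blast
qed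

section \<open>Root subsystems and products of two reflections\<close>

definition root_subsystem :: "'a vec_space set \<Rightarrow> bool" where
  "root_subsystem \<Psi> \<longleftrightarrow> \<Psi> \<subseteq> \<Phi> \<and> (\<forall>\<gamma>\<in>\<Psi>. \<forall>\<delta>\<in>\<Psi>. refl \<gamma> \<bullet> \<delta> \<in> \<Psi>)"

lemma root_subsystem_minus: "root_subsystem \<Psi> \<Longrightarrow> \<gamma> \<in> \<Psi> \<Longrightarrow> - \<gamma> \<in> \<Psi>"
  unfolding root_subsystem_def by (metis refl_self subsetD)

lemma inv_refl: "\<gamma> \<in> \<Phi> \<Longrightarrow> inv (refl \<gamma>) = refl \<gamma>"
  by (simp add: inv_equality refl_closed refl_square)

lemma refl_image_closed: "\<Psi> \<subseteq> \<Phi> \<Longrightarrow> refl ` \<Psi> \<subseteq> carrier W"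
  using refl_closed by auto

lemma generate_refl_act:
  assumes "root_subsystem \<Psi>" "u \<in> generate W (refl ` \<Psi>)" "\<gamma> \<in> \<Psi>"
  shows "u \<bullet> \<gamma> \<in> \<Psi>"
proof -
  have P: "\<Psi> \<subseteq> \<Phi>" "\<And>\<gamma> \<delta>. \<gamma> \<in> \<Psi> \<Longrightarrow> \<delta> \<in> \<Psi> \<Longrightarrow> refl \<gamma> \<bullet> \<delta> \<in> \<Psi>"
    using assms(1) by (auto simp: root_subsystem_def)
  have c: "h \<in> carrier W" if "h \<in> generate W (refl ` \<Psi>)" for h
    using that generate_in_carrier[OF refl_image_closed[OF P(1)]] by blast
  from assms(2,3) show ?thesis
  proof (induction arbitrary: \<gamma> rule: generate.induct)
    case (inv h)
    then show ?case using P by (auto simp: inv_refl subset_iff)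
  next
    case (eng h1 h2)
    then show ?case by (simp add: act_mult c)
  qed (use P in auto)
qed

text \<open>If \<open>u = r\<^sub>\<beta>r\<^sub>\<delta>\<close> permutes the positive roots then the \<open>u\<^sup>i\<beta>\<close> are inversions of \<open>r\<^sub>\<beta>\<close>, hence they form a
  finite orbit, whose sum is a multiple of \<open>\<beta>\<close> fixed by \<open>u\<close>.\<close>

lemma two_reflections_pos_imp_one:
  assumes \<Psi>: "root_subsystem \<Psi>" and \<beta>: "\<beta> \<in> \<Psi> \<inter> \<Phi>p" and \<delta>: "\<delta> \<in> \<Phi>"
    and u: "u = refl \<beta> \<otimes> refl \<delta>" and stable: "\<And>\<gamma>. \<gamma> \<in> \<Psi> \<Longrightarrow> u \<bullet> \<gamma> \<in> \<Psi> \<and> inv u \<bullet> \<gamma> \<in> \<Psi>"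
    and pos: "\<And>\<gamma>. \<gamma> \<in> \<Psi> \<inter> \<Phi>p \<Longrightarrow> u \<bullet> \<gamma> \<in> \<Phi>p"
  shows "u = \<one>"
proof -
  have \<beta>': "\<beta> \<in> \<Phi>" "\<beta> \<in> \<Phi>p" "supp \<beta> \<subseteq> S"
    using \<beta> supp_root by (auto simp: pos_root_in_roots)
  have c: "u \<in> carrier W" "refl \<beta> \<in> carrier W" "refl \<delta> \<in> carrier W"
    using \<beta>' \<delta> u by (auto simp: refl_closed)
  have P: "\<Psi> \<subseteq> \<Phi>"
    using \<Psi> by (simp add: root_subsystem_def)
  \<comment> \<open>Positivity passes to the inverse because \<Psi> is closed under negation: if the
    inverse made \<gamma> negative, then u would send the opposite of this image, a positive root,
    to -\<gamma>.\<close>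
  have invpos: "inv u \<bullet> \<gamma> \<in> \<Phi>p" if g: "\<gamma> \<in> \<Psi> \<inter> \<Phi>p" for \<gamma>
  proof (rule ccontr)
    assume "inv u \<bullet> \<gamma> \<notin> \<Phi>p"
    then have "- (inv u \<bullet> \<gamma>) \<in> \<Psi> \<inter> \<Phi>p"
      using g stable P root_subsystem_minus[OF \<Psi>] neg_root_iff[of "inv u \<bullet> \<gamma>"] by auto
    then have "u \<bullet> - (inv u \<bullet> \<gamma>) \<in> \<Phi>p"
      by (rule pos)
    then show False
      using g c pos_root_not_neg[of "- \<gamma>"] by (simp add: act_minus)
  qed
  have it: "(act W S u ^^ i) \<beta> \<in> \<Psi> \<inter> \<Phi>p" "(act W S (inv u) ^^ i) \<beta> \<in> \<Psi> \<inter> \<Phi>p" for i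
    by (induction i) (use \<beta> stable pos invpos in auto)
  \<comment> \<open>In the dihedral group of the two reflections, conjugation by either of them
    inverts u.\<close>
  have conj: "refl \<beta> \<otimes> u = inv u \<otimes> refl \<beta>"
  proof -
    have "refl \<beta> \<otimes> u = refl \<delta>"
      using c u \<beta>' by (simp add: m_assoc[symmetric] refl_square)
    moreover have "inv u \<otimes> refl \<beta> = refl \<delta>"
      using c u \<beta>' \<delta> by (simp add: inv_mult_group inv_refl m_assoc refl_square)
    ultimately show ?thesis by simp
  qed
  have negate: "refl \<beta> \<bullet> (act W S u ^^ i) \<beta> = - (act W S (inv u) ^^ i) \<beta>" for i
  proof (induction i)
    case 0
    then show ?case using \<beta>' by (simp add: refl_self)
  next
    case (Suc i)
    have "refl \<beta> \<bullet> (act W S u ^^ Suc i) \<beta> = (refl \<beta> \<otimes> u) \<bullet> (act W S u ^^ i) \<beta>"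
      using c by (simp add: act_mult)
    also have "\<dots> = inv u \<bullet> refl \<beta> \<bullet> (act W S u ^^ i) \<beta>"
      unfolding conj using c by (simp add: act_mult)
    finally show ?case
      by (simp add: Suc act_minus)
  qed
  have "range (\<lambda>i. (act W S u ^^ i) \<beta>) \<subseteq> {\<gamma> \<in> \<Phi>p. refl \<beta> \<bullet> \<gamma> \<notin> \<Phi>p}"
    using it pos_root_not_neg by (auto simp: negate)
  then have "finite (range (\<lambda>i. (act W S u ^^ i) \<beta>))"
    using finite_inversions[OF c(2)] finite_subset by blast
  then have "\<not> inj (\<lambda>i. (act W S u ^^ i) \<beta>)"
    using finite_imageD by blast
  then obtain i j where ij: "i < j" "(act W S u ^^ i) \<beta> = (act W S u ^^ j) \<beta>"
    using linorder_injI[of "\<lambda>i. (act W S u ^^ i) \<beta>"] by blast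
  define k where "k = j - i"
  have injp: "inj (act W S u ^^ i)"
    using c by (intro inj_fn injI) (auto simp: act_eq_iff)
  have k: "k > 0" "(act W S u ^^ k) \<beta> = \<beta>"
  proof -
    have "(act W S u ^^ i) ((act W S u ^^ k) \<beta>) = (act W S u ^^ i) \<beta>"
      using ij by (simp add: k_def flip: funpow_add[THEN fun_cong, unfolded o_def])
    then show "(act W S u ^^ k) \<beta> = \<beta>"
      using injp by (simp add: inj_eq)
  qed (use ij k_def in simp)
  \<comment> \<open>As u^k fixes \<beta>, the backward orbit is the forward orbit in reverse order.
    Together with \<open>negate\<close> this shows that the reflection in \<beta> negates the orbit
    sum v.\<close>
  have backward: "(act W S (inv u) ^^ i) \<beta> = (act W S u ^^ (k - i)) \<beta>" if "i \<le> k" for i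
    using that
  proof (induction i)
    case (Suc i)
    then have "k - i = Suc (k - Suc i)"
      by simp
    then have "(act W S (inv u) ^^ Suc i) \<beta> = inv u \<bullet> u \<bullet> (act W S u ^^ (k - Suc i)) \<beta>"
      using Suc by simp
    then show ?case
      using c by simp
  qed (use k in simp)
  define v where "v = (\<Sum>i<k. (act W S u ^^ i) \<beta>)"
  have shift: "(\<Sum>i<k. (act W S u ^^ Suc i) \<beta>) = v"
  proof -
    have "(\<Sum>i<Suc k. (act W S u ^^ i) \<beta>) = \<beta> + (\<Sum>i<k. (act W S u ^^ Suc i) \<beta>)"
      by (subst sum.lessThan_Suc_shift) simp
    moreover have "(\<Sum>i<Suc k. (act W S u ^^ i) \<beta>) = v + \<beta>"
      using k by (simp add: v_def)
    ultimately show ?thesis by (simp add: add.commute)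
  qed
  have uv: "u \<bullet> v = v"
    using shift by (simp add: v_def act_sum)
  have "refl \<beta> \<bullet> v = - (\<Sum>i<k. (act W S u ^^ (k - i)) \<beta>)"
    by (simp add: v_def act_sum negate backward sum_negf)
  also have "(\<Sum>i<k. (act W S u ^^ (k - i)) \<beta>) = (\<Sum>i<k. (act W S u ^^ Suc i) \<beta>)"
    by (rule sum.reindex_bij_witness[where i = "\<lambda>i. k - Suc i" and j = "\<lambda>i. k - Suc i"])
      (auto simp: Suc_diff_Suc simp del: funpow.simps)
  finally have "refl \<beta> \<bullet> v = - v"
    unfolding shift .
  moreover have vS: "supp v \<subseteq> S"
  proof -
    have "coef v s = 0" if "s \<notin> S" for s
      unfolding v_def lookup_sum using that it(1) P supp_root
      by (intro sum.neutral) (auto simp: in_keys_iff subset_iff)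
    then show ?thesis by (auto simp: in_keys_iff)
  qed
  ultimately have "v - vscale (2 * vform W \<beta> v) \<beta> = - v"
    using \<beta>' by (simp add: refl_act)
  then have veq: "v = vscale (vform W \<beta> v) \<beta>"
    by (simp add: poly_mapping_eq_iff fun_eq_iff lookup_minus)
  \<comment> \<open>All summands of v are positive roots and \<beta> is one of them, so nothing
    cancels.\<close>
  have "v \<noteq> 0"
  proof -
    obtain s where s: "coef \<beta> s > 0"
      using \<beta>' root_nonzero by (metis nonneg_pos_root less_eq_real_def poly_mapping_eqI lookup_zero)
    have "coef \<beta> s \<le> coef v s"
      unfolding v_def lookup_sum using k it(1)
        member_le_sum[of 0 "{..<k}" "\<lambda>i. coef ((act W S u ^^ i) \<beta>) s"]
      by (auto simp: nonneg_pos_root)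
    with s show ?thesis by auto
  qed
  then have n0: "vform W \<beta> v \<noteq> 0"
    using veq by (auto simp: poly_mapping_eq_iff fun_eq_iff)
  have "vscale (vform W \<beta> v) (u \<bullet> \<beta>) = vscale (vform W \<beta> v) \<beta>"
    using uv veq by (metis act_scale)
  then have "u \<bullet> \<beta> = \<beta>"
    using n0 by (simp add: poly_mapping_eq_iff fun_eq_iff)
  moreover have "refl \<beta> \<otimes> u = refl \<delta>"
    using c u \<beta>' by (simp add: m_assoc[symmetric] refl_square)
  then have "refl \<delta> \<bullet> \<beta> = refl \<beta> \<bullet> u \<bullet> \<beta>"
    using c by (simp flip: act_mult)
  \<comment> \<open>As u fixes \<beta>, both reflections negate \<beta>. A root negated by the
    reflection in \<delta> is \<delta> or its negative, so the two reflections agree.\<close>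
  ultimately have "refl \<delta> \<bullet> \<beta> = - \<beta>"
    using \<beta>' by (simp add: refl_self)
  then have "\<beta> - vscale (2 * vform W \<delta> \<beta>) \<delta> = - \<beta>"
    using \<delta> \<beta>' by (simp add: refl_act)
  then have "\<beta> = vscale (vform W \<delta> \<beta>) \<delta>"
    by (simp add: poly_mapping_eq_iff fun_eq_iff lookup_minus)
  then have "\<beta> = \<delta> \<or> \<beta> = - \<delta>"
    using root_multiple \<beta>' \<delta> by blast
  then have "refl \<beta> = refl \<delta>"
    using refl_minus \<delta> by auto
  then show ?thesis
    using u \<delta> by (simp add: refl_square)
qed

text \<open>By \<open>dihedral_elements\<close>, u is either a reflection in a root of the dihedral
  subsystem, which negates this root, or a product of two reflections, which is the case treated
  before. Positivity is assumed only for roots whose reflections lie in the dihedral subgroup, which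
  is all that the confluence argument supplies.\<close>

lemma dihedral_pos_imp_one:
  assumes \<Psi>: "root_subsystem \<Psi>" and \<gamma>: "\<gamma> \<in> \<Psi>" "\<delta> \<in> \<Psi>"
    and u: "u \<in> generate W {refl \<gamma>, refl \<delta>}"
    and pos: "\<And>\<beta>. \<beta> \<in> \<Psi> \<inter> \<Phi>p \<Longrightarrow> refl \<beta> \<in> generate W {refl \<gamma>, refl \<delta>} \<Longrightarrow> u \<bullet> \<beta> \<in> \<Phi>p"
  shows "u = \<one>"
proof -
  let ?D = "generate W {refl \<gamma>, refl \<delta>}"
  define \<Psi>' where "\<Psi>' = {\<beta> \<in> \<Psi>. refl \<beta> \<in> ?D}"
  have P: "\<Psi> \<subseteq> \<Phi>"
    using \<Psi> by (simp add: root_subsystem_def)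
  have gen: "{refl \<gamma>, refl \<delta>} \<subseteq> carrier W"
    using \<gamma> P by (auto simp: refl_closed)
  have c: "x \<in> carrier W" if "x \<in> ?D" for x
    using that generate_in_carrier[OF gen] by blast
  have iD: "inv x \<in> ?D" if "x \<in> ?D" for x
    using that generate_m_inv_closed[OF gen] by blast
  have D\<Psi>: "x \<bullet> \<beta> \<in> \<Psi>" if "x \<in> ?D" "\<beta> \<in> \<Psi>" for x \<beta>
  proof (rule generate_refl_act[OF \<Psi> _ that(2)])
    have "?D \<subseteq> generate W (refl ` \<Psi>)"
      using \<gamma> by (intro mono_generate) auto
    then show "x \<in> generate W (refl ` \<Psi>)"
      using that by blast
  qed
  have D: "x \<bullet> \<beta> \<in> \<Psi>'" if "x \<in> ?D" "\<beta> \<in> \<Psi>'" for x \<beta>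
    using that P D\<Psi> refl_conj[of x \<beta>] c by (auto simp: \<Psi>'_def intro!: generate.eng iD)
  have sub: "root_subsystem \<Psi>'"
    using P D by (auto simp: root_subsystem_def \<Psi>'_def)
  have gD: "\<gamma> \<in> \<Psi>'" "\<delta> \<in> \<Psi>'"
    using \<gamma> by (auto simp: \<Psi>'_def intro: generate.incl)
  have conj: "\<exists>\<beta> \<in> \<Psi>' \<inter> \<Phi>p. x \<otimes> r \<otimes> inv x = refl \<beta>" if x: "x \<in> ?D" "r \<in> {refl \<gamma>, refl \<delta>}" for x r
  proof -
    obtain \<eta> where e: "\<eta> \<in> \<Psi>'" "r = refl \<eta>"
      using x gD by blast
    have xe: "x \<bullet> \<eta> \<in> \<Psi>'"
      using x(1) e(1) by (rule D)
    moreover have "x \<otimes> r \<otimes> inv x = refl (x \<bullet> \<eta>)"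
      using refl_conj[of x \<eta>] c[OF x(1)] e P by (auto simp: \<Psi>'_def)
    ultimately have xe: "x \<bullet> \<eta> \<in> \<Psi>'" "x \<bullet> \<eta> \<in> \<Phi>" "x \<otimes> r \<otimes> inv x = refl (x \<bullet> \<eta>)"
      using P by (auto simp: \<Psi>'_def)
    show ?thesis
    proof (cases "x \<bullet> \<eta> \<in> \<Phi>p")
      case False
      then have "- (x \<bullet> \<eta>) \<in> \<Psi>' \<inter> \<Phi>p"
        using xe root_subsystem_minus[OF sub] neg_root_iff by blast
      then show ?thesis
        using xe refl_minus by metis
    qed (use xe in blast)
  qed
  have pos': "u \<bullet> \<beta> \<in> \<Phi>p" if "\<beta> \<in> \<Psi>' \<inter> \<Phi>p" for \<beta>
    using that pos by (auto simp: \<Psi>'_def)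
  show ?thesis
  proof (rule dihedral_elements[of "refl \<gamma>" "refl \<delta>" u])
    fix x r
    assume x: "x \<in> ?D" "r \<in> {refl \<gamma>, refl \<delta>}" and ux: "u = x \<otimes> r \<otimes> inv x"
    then obtain \<beta> where b: "\<beta> \<in> \<Psi>' \<inter> \<Phi>p" "u = refl \<beta>"
      using conj by metis
    then have "- \<beta> \<in> \<Phi>p"
      using pos'[of \<beta>] refl_self[of \<beta>] pos_root_in_roots by auto
    then show "u = \<one>"
      using b pos_root_not_neg by blast
  next
    fix x r q
    assume x: "x \<in> ?D" "r \<in> {refl \<gamma>, refl \<delta>}" "q \<in> {refl \<gamma>, refl \<delta>}" and ux: "u = x \<otimes> r \<otimes> inv x \<otimes> q"
    obtain \<beta> where b: "\<beta> \<in> \<Psi>' \<inter> \<Phi>p" "x \<otimes> r \<otimes> inv x = refl \<beta>"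
      using conj x by blast
    obtain \<eta> where e: "\<eta> \<in> \<Phi>" "q = refl \<eta>"
      using x \<gamma> P by blast
    show "u = \<one>"
      using sub b(1) e(1) D[OF u] D[OF iD[OF u]] pos'
      by (intro two_reflections_pos_imp_one[of \<Psi>' \<beta> \<eta>]) (auto simp: ux b e)
  qed (use gen u \<gamma> P in \<open>auto simp: refl_square\<close>)
qed

section \<open>Minimal elements of cosets by rewriting\<close>

definition descends :: "'a vec_space set \<Rightarrow> 'a \<Rightarrow> 'a \<Rightarrow> bool" where
  "descends \<Psi> x y \<longleftrightarrow> (\<exists>\<gamma>\<in>\<Psi> \<inter> \<Phi>p. x \<bullet> \<gamma> \<notin> \<Phi>p \<and> y = x \<otimes> refl \<gamma>)"

text \<open>These are the normal forms of the relation \<open>descends\<close>, which terminates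
  because each step shortens the element.\<close>

definition minimal_in_coset :: "'a vec_space set \<Rightarrow> 'a \<Rightarrow> bool" where
  "minimal_in_coset \<Psi> x \<longleftrightarrow> (\<forall>\<gamma>\<in>\<Psi> \<inter> \<Phi>p. x \<bullet> \<gamma> \<in> \<Phi>p)"

lemma descends_len:
  "x \<in> carrier W \<Longrightarrow> descends \<Psi> x y \<Longrightarrow> y \<in> carrier W \<and> len y < len x"
  by (auto simp: descends_def len_mult_refl refl_closed pos_root_in_roots)

lemma descends_star_coset:
  assumes "(descends \<Psi>)\<^sup>*\<^sup>* x y" "x \<in> carrier W" "\<Psi> \<subseteq> \<Phi>"
  shows "\<exists>u\<in>generate W (refl ` \<Psi>). y = x \<otimes> u"
  using assms(1)
proof (induction rule: rtranclp_induct)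
  case base
  show ?case using assms by (intro bexI[of _ \<one>]) (auto intro: generate.one)
next
  case (step y z)
  then obtain u \<gamma> where u: "u \<in> generate W (refl ` \<Psi>)" "y = x \<otimes> u" "\<gamma> \<in> \<Psi>" "z = y \<otimes> refl \<gamma>"
    by (auto simp: descends_def)
  moreover have "u \<in> carrier W"
    using u assms generate_in_carrier[OF refl_image_closed] by blast
  ultimately show ?case
    using assms by (intro bexI[of _ "u \<otimes> refl \<gamma>"])
      (auto simp: m_assoc refl_closed subset_iff intro: generate.eng generate.incl)
qed

lemma ex_minimal_in_coset:
  assumes "x \<in> carrier W"
  shows "\<exists>y. (descends \<Psi>)\<^sup>*\<^sup>* x y \<and> minimal_in_coset \<Psi> y"
  using assms
proof (induction "len x" arbitrary: x rule: less_induct)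
  case less
  show ?case
  proof (cases "minimal_in_coset \<Psi> x")
    case False
    then obtain z where z: "descends \<Psi> x z"
      by (auto simp: minimal_in_coset_def descends_def)
    then obtain y where "(descends \<Psi>)\<^sup>*\<^sup>* z y" "minimal_in_coset \<Psi> y"
      using less descends_len by blast
    with z show ?thesis
      by (meson converse_rtranclp_into_rtranclp)
  qed blast
qed

text \<open>From y and z the rewriting continues with reflections in the dihedral subgroup D of the
  two given steps only. The ends m and n then lie in one coset of D, so u = m^-1 n lies in D, and
  the dihedral case shows that u is trivial.\<close>

lemma descends_confluent:
  assumes \<Psi>: "root_subsystem \<Psi>" and x: "x \<in> carrier W" and d: "descends \<Psi> x y" "descends \<Psi> x z"
  shows "\<exists>u. (descends \<Psi>)\<^sup>*\<^sup>* y u \<and> (descends \<Psi>)\<^sup>*\<^sup>* z u"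
proof -
  have P: "\<Psi> \<subseteq> \<Phi>"
    using \<Psi> by (simp add: root_subsystem_def)
  obtain \<gamma> \<delta> where g: "\<gamma> \<in> \<Psi>" "y = x \<otimes> refl \<gamma>" "\<delta> \<in> \<Psi>" "z = x \<otimes> refl \<delta>"
    using d by (auto simp: descends_def)
  let ?D = "generate W {refl \<gamma>, refl \<delta>}"
  have gen: "{refl \<gamma>, refl \<delta>} \<subseteq> carrier W"
    using g P by (auto simp: refl_closed)
  have c: "a \<in> carrier W" if "a \<in> ?D" for a
    using that generate_in_carrier[OF gen] by blast
  have iD: "inv a \<in> ?D" if "a \<in> ?D" for a
    using that generate_m_inv_closed[OF gen] by blast
  define \<Psi>' where "\<Psi>' = {\<beta> \<in> \<Psi>. refl \<beta> \<in> ?D}"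
  have sub: "\<Psi>' \<subseteq> \<Psi>" "\<Psi>' \<subseteq> \<Phi>"
    using P by (auto simp: \<Psi>'_def)
  have gD: "refl ` \<Psi>' \<subseteq> ?D"
    by (auto simp: \<Psi>'_def)
  have genD: "generate W (refl ` \<Psi>') \<subseteq> ?D"
    by (rule generate_subgroup_incl[OF gD generate_is_subgroup[OF gen]])
  have mono: "(descends \<Psi>)\<^sup>*\<^sup>* a b" if "(descends \<Psi>')\<^sup>*\<^sup>* a b" for a b
    using that by (rule rtranclp_mono[THEN predicate2D, rotated]) (use sub in \<open>fastforce simp: descends_def\<close>)
  have yz: "y \<in> carrier W" "z \<in> carrier W"
    using d x descends_len by blast+
  obtain m n where m: "(descends \<Psi>')\<^sup>*\<^sup>* y m" "minimal_in_coset \<Psi>' m"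
      and n: "(descends \<Psi>')\<^sup>*\<^sup>* z n" "minimal_in_coset \<Psi>' n"
    using ex_minimal_in_coset yz by meson
  obtain a b where ab: "a \<in> ?D" "m = y \<otimes> a" "b \<in> ?D" "n = z \<otimes> b"
    using descends_star_coset[OF m(1) yz(1) sub(2)] descends_star_coset[OF n(1) yz(2) sub(2)] genD by blast
  define u where "u = inv m \<otimes> n"
  have mc: "m \<in> carrier W" "n \<in> carrier W"
    using ab yz c by auto
  have "u = inv a \<otimes> refl \<gamma> \<otimes> refl \<delta> \<otimes> b"
    using ab c x g P yz
    by (simp add: u_def inv_mult_group refl_closed subset_iff m_assoc inv_refl inv_cancel_left)
  then have uD: "u \<in> ?D"
    using ab iD by (auto intro!: generate.eng intro: generate.incl)
  have "u = \<one>"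
  proof (rule dihedral_pos_imp_one[OF \<Psi> g(1,3) uD])
    fix \<beta>
    assume b: "\<beta> \<in> \<Psi> \<inter> \<Phi>p" "refl \<beta> \<in> ?D"
    show "u \<bullet> \<beta> \<in> \<Phi>p"
    proof (rule ccontr)
      assume neg: "u \<bullet> \<beta> \<notin> \<Phi>p"
      have uP: "u \<bullet> \<beta> \<in> \<Psi>"
      proof (rule generate_refl_act[OF \<Psi>])
        have "?D \<subseteq> generate W (refl ` \<Psi>)"
          using g by (intro mono_generate) auto
        then show "u \<in> generate W (refl ` \<Psi>)"
          using uD by blast
      qed (use b in auto)
      have "refl (u \<bullet> \<beta>) \<in> ?D"
        unfolding refl_conj[OF c[OF uD] subsetD[OF P IntD1[OF b(1)]]]
        by (rule generate.eng[OF generate.eng[OF uD b(2)] iD[OF uD]])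
      \<comment> \<open>By minimality m makes this root positive, and n makes \<beta> positive. But
        m u \<beta> = n \<beta>, so the two images are opposite.\<close>
      then have "- (u \<bullet> \<beta>) \<in> \<Psi>' \<inter> \<Phi>p"
        using uP neg P root_subsystem_minus[OF \<Psi>] neg_root_iff[of "u \<bullet> \<beta>"] refl_minus[of "u \<bullet> \<beta>"]
        by (auto simp: \<Psi>'_def)
      then have "m \<bullet> - (u \<bullet> \<beta>) \<in> \<Phi>p"
        using m(2) by (simp add: minimal_in_coset_def)
      moreover have "m \<bullet> u \<bullet> \<beta> = n \<bullet> \<beta>"
        using mc by (simp add: u_def act_mult)
      moreover have "n \<bullet> \<beta> \<in> \<Phi>p"
        using n(2) b by (simp add: minimal_in_coset_def \<Psi>'_def)
      ultimately show False
        using pos_root_not_neg by (simp add: act_minus)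
    qed
  qed
  then have "m = n"
    using mc unfolding u_def by (metis inv_closed inv_equality inv_inv)
  then show ?thesis
    using m n mono by blast
qed

text \<open>Newman's lemma.\<close>

lemma minimal_unique:
  assumes \<Psi>: "root_subsystem \<Psi>" and "x \<in> carrier W"
    and "(descends \<Psi>)\<^sup>*\<^sup>* x y" "minimal_in_coset \<Psi> y"
    and "(descends \<Psi>)\<^sup>*\<^sup>* x z" "minimal_in_coset \<Psi> z"
  shows "y = z"
  using assms(2-)
proof (induction "len x" arbitrary: x y z rule: less_induct)
  case less
  have stop: "x = v" if "minimal_in_coset \<Psi> x" "(descends \<Psi>)\<^sup>*\<^sup>* x v" for v
    using that(2,1) by (cases rule: converse_rtranclpE) (auto simp: minimal_in_coset_def descends_def)
  show ?case
  proof (cases "minimal_in_coset \<Psi> x")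
    case True
    then show ?thesis using stop less.prems by metis
  next
    case False
    then have "x \<noteq> y" "x \<noteq> z"
      using less.prems by auto
    then obtain y' z' where y': "descends \<Psi> x y'" "(descends \<Psi>)\<^sup>*\<^sup>* y' y"
        and z': "descends \<Psi> x z'" "(descends \<Psi>)\<^sup>*\<^sup>* z' z"
      using less.prems by (metis converse_rtranclpE)
    obtain u where u: "(descends \<Psi>)\<^sup>*\<^sup>* y' u" "(descends \<Psi>)\<^sup>*\<^sup>* z' u"
      using descends_confluent[OF \<Psi> less.prems(1) y'(1) z'(1)] by blast
    have c: "y' \<in> carrier W" "len y' < len x" "z' \<in> carrier W" "len z' < len x"
      using descends_len less.prems(1) y' z' by blast+
    obtain v where v: "u \<in> carrier W \<longrightarrow> (descends \<Psi>)\<^sup>*\<^sup>* u v \<and> minimal_in_coset \<Psi> v"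
      using ex_minimal_in_coset by blast
    have "u \<in> carrier W"
      using u(1) c(1) by (induction rule: rtranclp_induct) (auto dest: descends_len)
    with v u have "(descends \<Psi>)\<^sup>*\<^sup>* y' v" "(descends \<Psi>)\<^sup>*\<^sup>* z' v" "minimal_in_coset \<Psi> v"
      by auto
    then have "y = v" "z = v"
      using less.hyps[OF c(2,1) y'(2)] less.hyps[OF c(4,3) z'(2)] less.prems by auto
    then show ?thesis by simp
  qed
qed

text \<open>For positive \<gamma> in \<Psi>, one of x and \<open>x \<otimes> refl \<gamma>\<close>
  descends to the other, so both have the same normal form. Along a word in reflections the normal
  form remains that of \<one>; and u, being minimal, is its own normal form.\<close>

lemma reflection_subgroup_pos_imp_one:
  assumes \<Psi>: "root_subsystem \<Psi>" and u: "u \<in> generate W (refl ` \<Psi>)"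
    and pos: "\<And>\<gamma>. \<gamma> \<in> \<Psi> \<inter> \<Phi>p \<Longrightarrow> u \<bullet> \<gamma> \<in> \<Phi>p"
  shows "u = \<one>"
proof -
  have P: "\<Psi> \<subseteq> \<Phi>"
    using \<Psi> by (simp add: root_subsystem_def)
  obtain rs where rs: "set rs \<subseteq> refl ` \<Psi>" "word_prod W rs = u"
    using u P by (elim generate_involutions_word[OF _ refl_image_closed]) (auto simp: inv_refl subset_iff)
  define nf where "nf = (\<lambda>x y. (descends \<Psi>)\<^sup>*\<^sup>* x y \<and> minimal_in_coset \<Psi> y)"
  have step: "nf x n \<Longrightarrow> nf (x \<otimes> refl \<gamma>) m \<Longrightarrow> n = m" if "x \<in> carrier W" "\<gamma> \<in> \<Psi> \<inter> \<Phi>p" for x \<gamma> n m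
  proof -
    assume nm: "nf x n" "nf (x \<otimes> refl \<gamma>) m"
    have g: "\<gamma> \<in> \<Phi>" "refl \<gamma> \<in> carrier W"
      using that P by (auto simp: refl_closed)
    show "n = m"
    proof (cases "x \<bullet> \<gamma> \<in> \<Phi>p")
      case True
      then have "(x \<otimes> refl \<gamma>) \<bullet> \<gamma> \<notin> \<Phi>p"
        using that g pos_root_not_neg by (simp add: act_mult refl_self act_minus)
      then have "descends \<Psi> (x \<otimes> refl \<gamma>) x"
        unfolding descends_def using that g
        by (intro bexI[of _ \<gamma>]) (auto simp: m_assoc refl_square)
      then show ?thesis
        using nm that g unfolding nf_def
        by (intro minimal_unique[OF \<Psi>, of "x \<otimes> refl \<gamma>"]) (auto intro: converse_rtranclp_into_rtranclp)
    next
      case False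
      then have "descends \<Psi> x (x \<otimes> refl \<gamma>)"
        unfolding descends_def using that by blast
      then show ?thesis
        using nm that g unfolding nf_def
        by (intro minimal_unique[OF \<Psi>, of x]) (auto intro: converse_rtranclp_into_rtranclp)
    qed
  qed
  have main: "n = \<one>" if "nf (word_prod W rs) n" "set rs \<subseteq> refl ` \<Psi>" for n
    using that
  proof (induction rs arbitrary: n rule: rev_induct)
    case Nil
    have "minimal_in_coset \<Psi> \<one>"
      by (auto simp: minimal_in_coset_def)
    then show ?case
      using Nil unfolding nf_def by (intro minimal_unique[OF \<Psi>, of \<one>]) auto
  next
    case (snoc r rs)
    then obtain \<gamma> where g: "\<gamma> \<in> \<Psi>" "r = refl \<gamma>"
      by auto
    have "\<exists>\<gamma> \<in> \<Psi> \<inter> \<Phi>p. r = refl \<gamma>"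
    proof (cases "\<gamma> \<in> \<Phi>p")
      case False
      then have "- \<gamma> \<in> \<Psi> \<inter> \<Phi>p"
        using g P root_subsystem_minus[OF \<Psi>] neg_root_iff by auto
      then show ?thesis
        using g P refl_minus[of \<gamma>] by (intro bexI[of _ "- \<gamma>"]) auto
    qed (use g in blast)
    then obtain \<eta> where e: "\<eta> \<in> \<Psi> \<inter> \<Phi>p" "r = refl \<eta>"
      by blast
    have rc: "set rs \<subseteq> carrier W" "r \<in> carrier W"
      using snoc.prems refl_image_closed[OF P] by auto
    then have xc: "word_prod W rs \<in> carrier W" "word_prod W (rs @ [r]) = word_prod W rs \<otimes> r"
      by (auto simp: word_prod_closed word_prod_append)
    obtain m where m: "nf (word_prod W rs) m"
      using ex_minimal_in_coset xc by (auto simp: nf_def)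
    then have "m = n"
      using step[OF xc(1) e(1) m] snoc.prems xc e by auto
    then show ?case
      using snoc.IH[OF m] snoc.prems by simp
  qed
  have "nf u u"
    using pos by (simp add: nf_def minimal_in_coset_def)
  then show ?thesis
    using main[of u] rs by simp
qed

lemma ex_coset_minimal:
  assumes "\<Psi> \<subseteq> \<Phi>" "w \<in> carrier W"
  obtains u where "u \<in> generate W (refl ` \<Psi>)" "\<And>\<gamma>. \<gamma> \<in> \<Psi> \<inter> \<Phi>p \<Longrightarrow> (w \<otimes> u) \<bullet> \<gamma> \<in> \<Phi>p"
proof -
  obtain y where y: "(descends \<Psi>)\<^sup>*\<^sup>* w y" "minimal_in_coset \<Psi> y"
    using ex_minimal_in_coset assms by blast
  then obtain u where "u \<in> generate W (refl ` \<Psi>)" "y = w \<otimes> u"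
    using descends_star_coset assms by blast
  with y that show thesis
    by (auto simp: minimal_in_coset_def)
qed


section \<open>Irreducible components\<close>

lemma sym_cox_adj: "J \<subseteq> S \<Longrightarrow> sym (cox_adj W J)"
  using cox_m_commute by (intro symI) (fastforce simp: cox_adj_def)

lemma gram_not_adj:
  assumes "J \<subseteq> S" "s \<in> J" "t \<in> J" "s \<noteq> t" "(s, t) \<notin> cox_adj W J"
  shows "gram W s t = 0"
proof -
  have "s \<in> S" "t \<in> S"
    using assms by auto
  then show ?thesis
    using assms(4) by (cases rule: gram_cases) (use assms in \<open>auto simp: cox_adj_def\<close>)
qed

lemma gram_adj:
  assumes "J \<subseteq> S" "(s, t) \<in> cox_adj W J"
  shows "gram W s t < 0"
proof -
  have "s \<in> S" "t \<in> S" "s \<noteq> t" "cox_m W s t \<noteq> 2"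
    using assms by (auto simp: cox_adj_def)
  then show ?thesis by (cases rule: gram_cases) auto
qed

lemma components_iff: "C \<in> irreducible_components W J \<longleftrightarrow> (\<exists>s\<in>J. C = (cox_adj W J)\<^sup>* `` {s})"
  by (auto simp: irreducible_components_def quotient_def)

lemma reachable_subset: "(s, t) \<in> (cox_adj W J)\<^sup>* \<Longrightarrow> s \<in> J \<Longrightarrow> t \<in> J"
  by (induction rule: rtrancl_induct) (auto simp: cox_adj_def)

lemma component_subset: "C \<in> irreducible_components W J \<Longrightarrow> C \<subseteq> J"
  by (auto simp: components_iff reachable_subset)

lemma component_eq:
  assumes "J \<subseteq> S" "C \<in> irreducible_components W J" "s \<in> C"
  shows "C = (cox_adj W J)\<^sup>* `` {s}"
proof -
  obtain r where r: "C = (cox_adj W J)\<^sup>* `` {r}"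
    using assms by (auto simp: components_iff)
  then have "(r, s) \<in> (cox_adj W J)\<^sup>*" "(s, r) \<in> (cox_adj W J)\<^sup>*"
    using assms(3) sym_rtrancl[OF sym_cox_adj[OF assms(1)]] by (auto dest: symD)
  with r show ?thesis
    by (auto intro: rtrancl_trans)
qed

lemma component_orthogonal:
  assumes "J \<subseteq> S" "C \<in> irreducible_components W J" "c \<in> C" "j \<in> J" "j \<notin> C"
  shows "gram W j c = 0"
proof -
  have "(c, j) \<notin> cox_adj W J"
    using assms(5) component_eq[OF assms(1-3)] by auto
  then have "(j, c) \<notin> cox_adj W J"
    using sym_cox_adj[OF assms(1)] by (meson symD)
  then show ?thesis
    using assms component_subset by (intro gram_not_adj[of J]) auto
qed

text \<open>A path in J that starts in C never leaves C, so it is a path in the graph of C.\<close>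

lemma component_irreducible:
  assumes "J \<subseteq> S" "C \<in> irreducible_components W J"
  shows "irreducible_subset W C"
proof -
  have *: "(s, t) \<in> (cox_adj W C)\<^sup>*" if "s \<in> C" "(s, t) \<in> (cox_adj W J)\<^sup>*" for s t
    using that(2)
  proof (induction rule: rtrancl_induct)
    case (step t u)
    have "C = (cox_adj W J)\<^sup>* `` {s}"
      using component_eq assms that(1) by blast
    then have "t \<in> C" "u \<in> C"
      using step by (auto intro: rtrancl_into_rtrancl)
    then have "(t, u) \<in> cox_adj W C"
      using step by (auto simp: cox_adj_def)
    with step show ?case by (meson rtrancl_into_rtrancl)
  qed simp
  have "C \<noteq> {}"
    using assms by (auto simp: components_iff)
  moreover have "(s, t) \<in> (cox_adj W C)\<^sup>*" if "s \<in> C" "t \<in> C" for s t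
    using component_eq[OF assms that(1)] that * by auto
  ultimately show ?thesis
    by (auto simp: irreducible_subset_def)
qed

text \<open>Only one component contains s, so the union in the definition is the set reachable from
  s. This form admits induction along paths.\<close>

lemma link_component_eq:
  assumes "insert s J \<subseteq> S"
  shows "link_component W J {s} = (cox_adj W (insert s J))\<^sup>* `` {s}"
proof -
  have "C = (cox_adj W (insert s J))\<^sup>* `` {s}"
    if "C \<in> irreducible_components W (insert s J)" "s \<in> C" for C
    using component_eq[OF assms that] .
  moreover have "(cox_adj W (insert s J))\<^sup>* `` {s} \<in> irreducible_components W (insert s J)"
    by (auto simp: components_iff)
  ultimately have "{C \<in> irreducible_components W (insert s J). s \<in> C} = {(cox_adj W (insert s J))\<^sup>* `` {s}}"
    by blast
  then show ?thesis
    by (simp add: link_component_def)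
qed

lemma link_component:
  assumes "insert s J \<subseteq> S"
  shows link_component_in: "link_component W J {s} \<in> irreducible_components W (insert s J)"
    and link_component_self: "s \<in> link_component W J {s}"
    and link_component_subset: "link_component W J {s} \<subseteq> insert s J"
proof -
  show *: "link_component W J {s} \<in> irreducible_components W (insert s J)"
    unfolding link_component_eq[OF assms] by (auto simp: components_iff)
  then show "link_component W J {s} \<subseteq> insert s J"
    by (rule component_subset)
  show "s \<in> link_component W J {s}"
    unfolding link_component_eq[OF assms] by blast
qed

lemma parabolic_fix_simple:
  assumes "K \<subseteq> S" "w \<in> generate W K" "j \<in> S" "\<And>k. k \<in> K \<Longrightarrow> gram W j k = 0"
  shows "w \<bullet> \<alpha> j = \<alpha> j"
  using assms by (intro parabolic_fix[OF assms(1,2)]) (auto simp: vform_simple_root)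


section \<open>The edges of the graph\<close>

text \<open>This is \<open>w\<^sub>x\<^sup>s\<close> if \<open>K\<close> is the component of \<open>s\<close> in \<open>[x] \<union> {s}\<close>.\<close>

definition edge_elt :: "'a set \<Rightarrow> 'a \<Rightarrow> 'a" where
  "edge_elt K s = w0 K \<otimes> w0 (K - {s})"

lemma arc_elt_eq: "arc_elt W S \<Lambda> (x, s) = edge_elt (link_component W (x ` \<Lambda>) {s}) s"
  by (simp add: arc_elt_def edge_elt_def Let_def)

context
  fixes K :: "'a set" and s :: 'a
  assumes K: "K \<subseteq> S" "finite_type W K" "s \<in> K"
begin

lemma K_minus: "K - {s} \<subseteq> S" "finite_type W (K - {s})"
  using K finite_type_mono[of K "K - {s}"] by auto

lemma w0_K_closed: "w0 K \<in> carrier W" "w0 (K - {s}) \<in> carrier W"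
  using K K_minus longest_elt_closed by auto

lemma edge_elt_act: "edge_elt K s \<bullet> v = w0 K \<bullet> w0 (K - {s}) \<bullet> v"
  using w0_K_closed by (simp add: edge_elt_def act_mult)

lemma edge_elt_in: "edge_elt K s \<in> generate W K"
proof -
  have "generate W (K - {s}) \<subseteq> generate W K"
    by (rule mono_generate) auto
  then show ?thesis
    unfolding edge_elt_def using longest_elt_in[OF K(1,2)] longest_elt_in[OF K_minus]
    by (auto intro: generate.eng)
qed

lemma edge_elt_closed: "edge_elt K s \<in> carrier W"
  using edge_elt_in generate_closed K by blast

lemma inv_edge_elt: "inv (edge_elt K s) = w0 (K - {s}) \<otimes> w0 K"
  using w0_K_closed K K_minus by (simp add: edge_elt_def inv_mult_group inv_longest_elt)

lemma longest_neg_on_supp: "\<gamma> \<in> \<Phi>p \<Longrightarrow> supp \<gamma> \<subseteq> K \<Longrightarrow> w0 K \<bullet> \<gamma> \<notin> \<Phi>p"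
  using neg_on_supp[OF w0_K_closed(1) K(1) longest_elt_neg[OF K(1,2)]] by blast

lemma longest_minus_neg_on_supp: "\<gamma> \<in> \<Phi>p \<Longrightarrow> supp \<gamma> \<subseteq> K - {s} \<Longrightarrow> w0 (K - {s}) \<bullet> \<gamma> \<notin> \<Phi>p"
  using neg_on_supp[OF w0_K_closed(2) K_minus(1) longest_elt_neg[OF K_minus]] by blast

lemma longest_minus_supp: "supp \<gamma> \<subseteq> K \<Longrightarrow> supp (w0 (K - {s}) \<bullet> \<gamma>) \<subseteq> K"
proof -
  have "generate W (K - {s}) \<subseteq> generate W K"
    by (rule mono_generate) auto
  then show "supp \<gamma> \<subseteq> K \<Longrightarrow> supp (w0 (K - {s}) \<bullet> \<gamma>) \<subseteq> K"
    using parabolic_supp[OF K(1)] longest_elt_in[OF K_minus] by blast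
qed

lemma longest_minus_coef: "coef (w0 (K - {s}) \<bullet> \<gamma>) s = coef \<gamma> s"
  using generate_act_coef[OF K_minus(1) longest_elt_in[OF K_minus]] by simp

text \<open>The inner factor w_0(K - {s}) keeps the coefficient 1 of \<alpha>_s at s, so the root
  remains positive and supported on K, and w_0(K) makes it negative.\<close>

lemma edge_elt_self_neg: "edge_elt K s \<bullet> \<alpha> s \<notin> \<Phi>p"
proof -
  let ?\<delta> = "w0 (K - {s}) \<bullet> \<alpha> s"
  have "s \<in> S" using K by auto
  then have "?\<delta> \<in> \<Phi>p"
    using longest_minus_coef[of "\<alpha> s"] w0_K_closed
    by (intro root_posI[of _ s]) (auto simp: coef_simple_root act_root simple_root_in_roots)
  then show ?thesis
    unfolding edge_elt_act using longest_neg_on_supp longest_minus_supp[of "\<alpha> s"] K by auto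
qed

text \<open>On roots supported on \<open>K - {s}\<close> both longest elements reverse the sign, so
  the edge keeps them positive; roots not supported on K stay positive under W_K.\<close>

lemma edge_elt_inversion:
  assumes \<gamma>: "\<gamma> \<in> \<Phi>p" "edge_elt K s \<bullet> \<gamma> \<notin> \<Phi>p"
  shows "supp \<gamma> \<subseteq> K" "coef \<gamma> s > 0"
proof -
  show supp: "supp \<gamma> \<subseteq> K"
    using parabolic_pos_outside[OF K(1) edge_elt_in] \<gamma> by blast
  show "coef \<gamma> s > 0"
  proof (rule ccontr)
    assume "\<not> coef \<gamma> s > 0"
    then have "coef \<gamma> s = 0"
      using \<gamma> nonneg_pos_root[of \<gamma> s] by simp
    then have "supp \<gamma> \<subseteq> K - {s}"
      using supp by (auto simp: in_keys_iff)
    then have "w0 (K - {s}) \<bullet> \<gamma> \<notin> \<Phi>p"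
      using \<gamma> longest_minus_neg_on_supp by blast
    then have "- (w0 (K - {s}) \<bullet> \<gamma>) \<in> \<Phi>p"
      using \<gamma> w0_K_closed by (simp add: neg_root_iff act_root pos_root_in_roots)
    moreover have "supp (- (w0 (K - {s}) \<bullet> \<gamma>)) \<subseteq> K"
      using longest_minus_supp[OF supp] by simp
    ultimately have "w0 K \<bullet> - (w0 (K - {s}) \<bullet> \<gamma>) \<notin> \<Phi>p"
      by (rule longest_neg_on_supp)
    then have "- (edge_elt K s \<bullet> \<gamma>) \<notin> \<Phi>p"
      by (simp add: edge_elt_act act_minus)
    moreover have "edge_elt K s \<bullet> \<gamma> \<in> \<Phi>"
      using \<gamma> edge_elt_closed by (simp add: act_root pos_root_in_roots)
    ultimately show False
      using \<gamma> neg_root_iff by blast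
  qed
qed

text \<open>With \<open>r = s\<^sub>\<gamma>\<close>, both \<open>r w\<^sub>0(K - {s})\<close> and \<open>w\<^sub>0(K)\<close> make all simple roots of \<open>K\<close> negative, hence they
  agree.\<close>

lemma edge_elt_eq_refl:
  assumes \<gamma>: "\<gamma> \<in> \<Phi>p" "supp \<gamma> \<subseteq> K" "coef \<gamma> s > 0"
    and perp: "\<And>k. k \<in> K - {s} \<Longrightarrow> vform W \<gamma> (\<alpha> k) = 0"
  shows "edge_elt K s = refl \<gamma>"
proof -
  let ?w = "w0 (K - {s})" and ?r = "refl \<gamma>"
  have g: "\<gamma> \<in> \<Phi>" "?r \<in> carrier W" "supp \<gamma> \<subseteq> S"
    using \<gamma> K by (auto simp: pos_root_in_roots refl_closed)
  have s: "s \<in> S" using K by auto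
  have fix_g: "?w \<bullet> \<gamma> = \<gamma>"
    using perp g by (intro parabolic_fix[OF K_minus(1) longest_elt_in[OF K_minus]]) auto
  \<comment> \<open>When the second argument of <\<gamma>, \<gamma>> = 1 is expanded, only the term
    at s survives, because \<gamma> is orthogonal to the other simple roots of K.\<close>
  have "vform W \<gamma> \<gamma> = vform W \<gamma> (\<Sum>t\<in>supp \<gamma>. vscale (coef \<gamma> t) (\<alpha> t))"
    by (subst (2) vec_expand[of \<gamma>]) simp
  also have "\<dots> = (\<Sum>t\<in>supp \<gamma>. coef \<gamma> t * vform W \<gamma> (\<alpha> t))"
  proof -
    have "vform W \<gamma> (\<Sum>t\<in>A. vscale (coef \<gamma> t) (\<alpha> t)) = (\<Sum>t\<in>A. coef \<gamma> t * vform W \<gamma> (\<alpha> t))" for A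
      by (induction A rule: infinite_finite_induct) (auto simp: vform_bilinear)
    then show ?thesis .
  qed
  also have "\<dots> = (\<Sum>t\<in>{s}. coef \<gamma> t * vform W \<gamma> (\<alpha> t))"
    using perp \<gamma> by (intro sum.mono_neutral_right) (auto simp: in_keys_iff subset_iff)
  finally have cs: "coef \<gamma> s * vform W \<gamma> (\<alpha> s) = 1"
    using root_norm[OF g(1)] by simp
  let ?u = "?r \<otimes> ?w"
  have uc: "?u \<in> carrier W"
    using g w0_K_closed by simp
  have uact: "?u \<bullet> v = ?r \<bullet> ?w \<bullet> v" for v
    using g w0_K_closed by (simp add: act_mult)
  have r_off: "coef (?r \<bullet> v) t = coef v t" if "supp v \<subseteq> S" "t \<notin> K" for v t
  proof -
    have "coef \<gamma> t = 0"
      using that \<gamma> by (auto simp: in_keys_iff)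
    then show ?thesis
      using that g by (simp add: refl_act lookup_minus)
  qed
  have neg: "?u \<bullet> \<alpha> k \<notin> \<Phi>p" if k: "k \<in> K" for k
  proof (cases "k = s")
    case False
    then obtain k' where k': "k' \<in> K - {s}" "?w \<bullet> \<alpha> k = - \<alpha> k'"
      using longest_elt_simple[OF K_minus, of k] k by blast
    then have "?r \<bullet> \<alpha> k' = \<alpha> k'"
      using perp[OF k'(1)] g K by (intro poly_mapping_eqI) (auto simp: refl_act lookup_minus)
    then have "?u \<bullet> \<alpha> k = - \<alpha> k'"
      using k' by (simp add: uact act_minus)
    then show ?thesis
      using pos_root_not_neg simple_root_pos k' K by fastforce
  next
    case True
    let ?\<delta> = "?w \<bullet> \<alpha> s"
    have dS: "supp ?\<delta> \<subseteq> S" "coef ?\<delta> s = 1"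
      using supp_act[OF w0_K_closed(2)] s longest_minus_coef by (auto simp: coef_simple_root)
    have "vform W \<gamma> ?\<delta> = vform W (?w \<bullet> \<gamma>) ?\<delta>"
      by (simp add: fix_g)
    also have "\<dots> = vform W \<gamma> (\<alpha> s)"
      using w0_K_closed g s by (intro vform_act) auto
    \<comment> \<open>By \<open>cs\<close> the right hand side is 1 - 2 = -1, so the image has a
      negative coefficient at s.\<close>
    finally have "coef (?r \<bullet> ?\<delta>) s = 1 - 2 * (coef \<gamma> s * vform W \<gamma> (\<alpha> s))"
      using g dS by (simp add: refl_act lookup_minus)
    then have "coef (?u \<bullet> \<alpha> s) s < 0"
      by (simp add: uact cs)
    then show ?thesis
      using True nonneg_pos_root[of "?u \<bullet> \<alpha> s" s] by auto
  qed
  \<comment> \<open>The reflection has not been shown to lie in W_K, so the criterion for the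
    identity is applied with all of S. For t outside K, none of the factors changes the coefficient
    1 at t.\<close>
  have "(w0 K \<otimes> ?u) \<bullet> \<alpha> t \<in> \<Phi>p" if t: "t \<in> S" for t
  proof (cases "t \<in> K")
    case True
    have "- (?u \<bullet> \<alpha> t) \<in> \<Phi>p"
      using neg[OF True] uc t by (simp add: neg_root_iff act_root simple_root_in_roots)
    moreover have "supp (- (?u \<bullet> \<alpha> t)) \<subseteq> K"
    proof -
      have "supp (?w \<bullet> \<alpha> t) \<subseteq> K"
        using True by (intro longest_minus_supp) simp
      then have "coef (?r \<bullet> ?w \<bullet> \<alpha> t) q = 0" if "q \<notin> K" for q
        using r_off[of "?w \<bullet> \<alpha> t" q] K that by (auto simp: in_keys_iff)
      then show ?thesis
        by (auto simp: uact in_keys_iff)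
    qed
    ultimately have "w0 K \<bullet> - (?u \<bullet> \<alpha> t) \<notin> \<Phi>p"
      by (rule longest_neg_on_supp)
    moreover have "(w0 K \<otimes> ?u) \<bullet> \<alpha> t \<in> \<Phi>"
      using uc t w0_K_closed by (simp add: act_root simple_root_in_roots)
    ultimately show ?thesis
      using neg_root_iff uc w0_K_closed by (auto simp: act_mult act_minus)
  next
    case False
    have "coef (w0 K \<bullet> ?u \<bullet> \<alpha> t) t = coef (?u \<bullet> \<alpha> t) t"
      using generate_act_coef[OF K(1) longest_elt_in[OF K(1,2)] False] .
    also have "\<dots> = coef (?w \<bullet> \<alpha> t) t"
      using r_off[OF _ False] supp_act[OF w0_K_closed(2)] t by (simp add: uact)
    also have "\<dots> = 1"
      using generate_act_coef[OF K_minus(1) longest_elt_in[OF K_minus], of t] False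
      by (simp add: coef_simple_root)
    finally have "coef ((w0 K \<otimes> ?u) \<bullet> \<alpha> t) t = 1"
      using uc w0_K_closed by (simp add: act_mult)
    then show ?thesis
      using uc t w0_K_closed by (intro root_posI[of _ t]) (auto simp: act_root simple_root_in_roots)
  qed
  then have "w0 K \<otimes> ?u = \<one>"
    using uc w0_K_closed by (intro all_simple_pos_imp_one) auto
  then have "w0 K = inv ?u"
    using uc w0_K_closed by (simp add: inv_equality)
  then have "w0 K = ?u"
    using uc inv_longest_elt[OF K(1,2)] by (metis inv_inv)
  then show ?thesis
    using g w0_K_closed longest_elt_square[OF K_minus] by (simp add: edge_elt_def m_assoc)
qed

end


section \<open>Targets and reversal of edges\<close>

lemma C_grpd_iff:
  "w \<in> C_grpd W S \<Lambda> x y \<longleftrightarrow> w \<in> carrier W \<and> (\<forall>l\<in>\<Lambda>. w \<bullet> \<alpha> (y l) = \<alpha> (x l))"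
  by (auto simp: C_grpd_def)

lemma injections_in: "x \<in> injections \<Lambda> S \<Longrightarrow> l \<in> \<Lambda> \<Longrightarrow> x l \<in> S"
  by (auto simp: injections_def)

lemma injections_image: "x \<in> injections \<Lambda> S \<Longrightarrow> x ` \<Lambda> \<subseteq> S"
  by (auto simp: injections_def)

lemma C_grpd_target_unique:
  assumes "x \<in> injections \<Lambda> S" "y \<in> injections \<Lambda> S" "w \<in> C_grpd W S \<Lambda> x z" "w \<in> C_grpd W S \<Lambda> y z"
  shows "x = y"
proof (rule extensionalityI[of _ \<Lambda>])
  show "x l = y l" if "l \<in> \<Lambda>" for l
    using assms(3,4) that by (metis C_grpd_iff simple_root_inject)
qed (use assms in \<open>auto simp: injections_def PiE_def\<close>)

text \<open>The negative of w_0(K) permutes the simple roots of K; t is the image of s. The edge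
  then carries the simple roots of \<open>K - {s}\<close> to those of \<open>K - {t}\<close> and
  fixes the remaining ones of [x], which are orthogonal to K. So t is the element of [x] \<union>
  {s} that the target omits, and the edge at y with label t leads back.\<close>

lemma arc_structure:
  assumes x: "x \<in> injections \<Lambda> S" and s: "s \<in> S" "s \<notin> x ` \<Lambda>"
    and Kdef: "K = link_component W (x ` \<Lambda>) {s}" and fin: "finite_type W K"
  obtains y t where "y \<in> injections \<Lambda> S" "t \<in> S" "t \<notin> y ` \<Lambda>" "insert t (y ` \<Lambda>) = insert s (x ` \<Lambda>)"
    "link_component W (y ` \<Lambda>) {t} = K" "edge_elt K s \<in> C_grpd W S \<Lambda> y x"
    "edge_elt K t = inv (edge_elt K s)"
proof -
  let ?J = "x ` \<Lambda>"
  have JS: "insert s ?J \<subseteq> S"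
    using injections_image[OF x] s by simp
  have K: "K \<in> irreducible_components W (insert s ?J)" "s \<in> K" "K \<subseteq> insert s ?J"
    unfolding Kdef using link_component[OF JS] by auto
  have KS: "K \<subseteq> S"
    using K JS by blast
  note Kc = KS fin K(2)
  note KmS = K_minus[OF Kc]
  have orth: "gram W j k = 0" if "j \<in> insert s ?J" "j \<notin> K" "k \<in> K" for j k
    using component_orthogonal[OF JS K(1)] that by blast
  obtain t where t: "t \<in> K" "w0 K \<bullet> \<alpha> s = - \<alpha> t"
    using longest_elt_simple[OF KS fin K(2)] by blast
  have t': "w0 K \<bullet> \<alpha> t = - \<alpha> s"
  proof -
    have "w0 K \<bullet> w0 K \<bullet> \<alpha> s = - (w0 K \<bullet> \<alpha> t)"
      using t by (simp add: act_minus)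
    then show ?thesis
      using longest_elt_act_twice[OF KS fin, of "\<alpha> s"] by simp
  qed
  note act = edge_elt_act[OF Kc]
  have in_K: "\<exists>k'\<in>K - {t}. w0 K \<bullet> \<alpha> k = - \<alpha> k'" if "k \<in> K - {s}" for k
  proof -
    obtain k' where k': "k' \<in> K" "w0 K \<bullet> \<alpha> k = - \<alpha> k'"
      using longest_elt_simple[OF KS fin, of k] \<open>k \<in> K - {s}\<close> by blast
    have "k' \<noteq> t"
    proof
      assume "k' = t"
      then have "w0 K \<bullet> \<alpha> k = w0 K \<bullet> \<alpha> s"
        using k' t by simp
      then have "k = s"
        using act_eq_iff[OF w0_K_closed(1)[OF Kc]] by simp
      with that show False by simp
    qed
    with k' show ?thesis by blast
  qed
  have out_K: "\<exists>k'\<in>K - {s}. w0 K \<bullet> \<alpha> k = - \<alpha> k'" if "k \<in> K - {t}" for k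
  proof -
    obtain k' where k': "k' \<in> K" "w0 K \<bullet> \<alpha> k = - \<alpha> k'"
      using longest_elt_simple[OF KS fin, of k] \<open>k \<in> K - {t}\<close> by blast
    have "k' \<noteq> s"
    proof
      assume "k' = s"
      then have "w0 K \<bullet> \<alpha> k = w0 K \<bullet> \<alpha> t"
        using k' t' by simp
      then have "k = t"
        using act_eq_iff[OF w0_K_closed(1)[OF Kc]] by simp
      with that show False by simp
    qed
    with k' show ?thesis by blast
  qed
  have fix_out: "w \<bullet> \<alpha> j = \<alpha> j" if "w \<in> generate W K" "j \<in> ?J" "j \<notin> K" for w j
    using that orth JS by (intro parabolic_fix_simple[OF KS]) auto
  have minus_fwd: "\<exists>k'\<in>K - {s}. w0 (K - {s}) \<bullet> \<alpha> k = - \<alpha> k'" if "k \<in> K - {s}" for k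
    using longest_elt_simple[OF KmS that] by blast
  have fwd: "\<exists>j'\<in>insert s ?J - {t}. edge_elt K s \<bullet> \<alpha> j = \<alpha> j'" if j: "j \<in> ?J" for j
  proof (cases "j \<in> K")
    case True
    then have "j \<in> K - {s}"
      using j s by auto
    then obtain k' where k': "k' \<in> K - {s}" "w0 (K - {s}) \<bullet> \<alpha> j = - \<alpha> k'"
      using minus_fwd by blast
    then obtain k'' where "k'' \<in> K - {t}" "w0 K \<bullet> \<alpha> k' = - \<alpha> k''"
      using in_K by blast
    then show ?thesis
      using k' K by (intro bexI[of _ k'']) (auto simp: act act_minus)
  next
    case False
    then show ?thesis
      using fix_out[OF edge_elt_in[OF Kc] j] t j by (intro bexI[of _ j]) auto
  qed
  \<comment> \<open>The choice is unique because the simple roots are distinct; the bounded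
    abstraction makes y extensional, as \<open>injections\<close> demands.\<close>
  define y where "y = (\<lambda>l\<in>\<Lambda>. SOME j. j \<in> insert s ?J - {t} \<and> edge_elt K s \<bullet> \<alpha> (x l) = \<alpha> j)"
  have y: "y l \<in> insert s ?J - {t} \<and> edge_elt K s \<bullet> \<alpha> (x l) = \<alpha> (y l)" if l: "l \<in> \<Lambda>" for l
  proof -
    have "\<exists>j. j \<in> insert s ?J - {t} \<and> edge_elt K s \<bullet> \<alpha> (x l) = \<alpha> j"
      using fwd[of "x l"] l by blast
    from someI_ex[OF this] show ?thesis
      using l by (simp add: y_def)
  qed
  have vc: "edge_elt K s \<in> carrier W"
    by (rule edge_elt_closed[OF Kc])
  have y_inj: "y \<in> injections \<Lambda> S"
    unfolding injections_def
  proof (intro CollectI conjI)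
    show "y \<in> \<Lambda> \<rightarrow>\<^sub>E S"
    proof (rule PiE_I)
      show "y l \<in> S" if "l \<in> \<Lambda>" for l
        using y[OF that] JS by blast
    qed (simp add: y_def)
    show "inj_on y \<Lambda>"
    proof (rule inj_onI)
      fix l m
      assume lm: "l \<in> \<Lambda>" "m \<in> \<Lambda>" "y l = y m"
      then have "edge_elt K s \<bullet> \<alpha> (x l) = edge_elt K s \<bullet> \<alpha> (x m)"
        using y by simp
      then have "x l = x m"
        using act_eq_iff[OF vc] by simp
      then show "l = m"
        using x lm by (auto simp: injections_def inj_on_def)
    qed
  qed
  have image: "y ` \<Lambda> = insert s ?J - {t}"
  proof
    show "y ` \<Lambda> \<subseteq> insert s ?J - {t}"
      using y by blast
    show "insert s ?J - {t} \<subseteq> y ` \<Lambda>"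
    proof
      fix j
      assume j: "j \<in> insert s ?J - {t}"
      have "\<exists>i\<in>?J. edge_elt K s \<bullet> \<alpha> i = \<alpha> j"
      proof (cases "j \<in> K")
        case True
        then obtain k where k: "k \<in> K - {s}" "w0 K \<bullet> \<alpha> j = - \<alpha> k"
          using out_K j by blast
        obtain k' where k': "k' \<in> K - {s}" "w0 (K - {s}) \<bullet> \<alpha> k = - \<alpha> k'"
          using minus_fwd k by blast
        have "w0 (K - {s}) \<bullet> \<alpha> k' = - (w0 (K - {s}) \<bullet> w0 (K - {s}) \<bullet> \<alpha> k)"
          using k' by (simp add: act_minus)
        then have "w0 (K - {s}) \<bullet> \<alpha> k' = - \<alpha> k"
          using longest_elt_act_twice[OF KmS] by simp
        then have "edge_elt K s \<bullet> \<alpha> k' = - (w0 K \<bullet> \<alpha> k)"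
          by (simp add: act act_minus)
        also have "\<dots> = w0 K \<bullet> w0 K \<bullet> \<alpha> j"
          using k by (simp add: act_minus)
        also have "\<dots> = \<alpha> j"
          by (rule longest_elt_act_twice[OF KS fin])
        finally show ?thesis
          using k' K by blast
      next
        case False
        then have "j \<in> ?J"
          using j K by auto
        then show ?thesis
          using fix_out[OF edge_elt_in[OF Kc] _ False] by blast
      qed
      then obtain l where "l \<in> \<Lambda>" "edge_elt K s \<bullet> \<alpha> (x l) = \<alpha> j"
        by blast
      then show "j \<in> y ` \<Lambda>"
        using y[of l] by auto
    qed
  qed
  have tJ: "t \<in> insert s ?J"
    using t K by blast
  then have ins: "insert t (y ` \<Lambda>) = insert s ?J"
    using image by auto
  have "link_component W (y ` \<Lambda>) {t} = K"
    using JS ins component_eq[OF JS K(1) t(1)] by (subst link_component_eq) auto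
  moreover have "edge_elt K s \<in> C_grpd W S \<Lambda> y x"
    using vc y by (auto simp: C_grpd_iff)
  moreover have "edge_elt K t = inv (edge_elt K s)"
  proof -
    have Kt: "K - {t} \<subseteq> S" "finite_type W (K - {t})"
      using K_minus[OF KS fin t(1)] .
    \<comment> \<open>Conjugation by w_0(K) carries \<open>K - {s}\<close> to
      \<open>K - {t}\<close>, hence the longest element of the one to that of the other. Inserted
      into the formula for the edge with label t, this gives the inverse.\<close>
    let ?u = "w0 K \<otimes> w0 (K - {s}) \<otimes> w0 K"
    have c: "w0 K \<in> carrier W" "w0 (K - {s}) \<in> carrier W"
      using w0_K_closed[OF Kc] .
    have uact: "?u \<bullet> v = w0 K \<bullet> w0 (K - {s}) \<bullet> w0 K \<bullet> v" for v
      using c by (simp add: act_mult)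
    have conj: "w0 K \<otimes> k \<otimes> inv (w0 K) \<in> generate W (K - {t})" if k: "k \<in> K - {s}" for k
    proof -
      obtain k' where k': "k' \<in> K - {t}" "w0 K \<bullet> \<alpha> k = - \<alpha> k'"
        using in_K[OF k] by blast
      then have "w0 K \<otimes> k \<otimes> inv (w0 K) = k'"
        using c k KS by (intro conj_simple_eqI) auto
      then show ?thesis
        using k' by (simp add: generate.incl)
    qed
    have "w0 K \<otimes> w0 (K - {s}) \<otimes> inv (w0 K) \<in> generate W (K - {t})"
      using subset_trans[OF KmS(1) S_subset_carrier] subset_trans[OF Kt(1) S_subset_carrier] conj
        longest_elt_in[OF KmS] by (rule generate_conj[OF c(1)])
    then have uK: "?u \<in> generate W (K - {t})"
      by (simp add: inv_longest_elt[OF KS fin])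
    have neg: "\<exists>k'\<in>K - {t}. ?u \<bullet> \<alpha> k = - \<alpha> k'" if k: "k \<in> K - {t}" for k
    proof -
      obtain a where a: "a \<in> K - {s}" "w0 K \<bullet> \<alpha> k = - \<alpha> a"
        using out_K[OF k] by blast
      obtain b where b: "b \<in> K - {s}" "w0 (K - {s}) \<bullet> \<alpha> a = - \<alpha> b"
        using minus_fwd[OF a(1)] by blast
      obtain d where d: "d \<in> K - {t}" "w0 K \<bullet> \<alpha> b = - \<alpha> d"
        using in_K[OF b(1)] by blast
      show ?thesis
        using a b d by (intro bexI[of _ d]) (auto simp: uact act_minus)
    qed
    have "?u \<bullet> \<alpha> k \<notin> \<Phi>p" if k: "k \<in> K - {t}" for k
    proof -
      obtain k' where k': "k' \<in> K - {t}" "?u \<bullet> \<alpha> k = - \<alpha> k'"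
        using neg[OF k] by blast
      then have "k' \<in> S"
        using KS by blast
      then show ?thesis
        unfolding k'(2) by (rule pos_root_not_neg[OF simple_root_pos])
    qed
    with uK have "w0 (K - {t}) = ?u"
      by (rule longest_elt_eqI[OF Kt])
    then have "edge_elt K t = w0 K \<otimes> ?u"
      by (simp add: edge_elt_def)
    also have "\<dots> = w0 K \<otimes> w0 K \<otimes> w0 (K - {s}) \<otimes> w0 K"
      using c by (simp add: m_assoc)
    finally show ?thesis
      using c KS fin longest_elt_square by (simp add: inv_edge_elt[OF Kc])
  qed
  ultimately show thesis
    using that[of y t] y_inj ins image t KS by blast
qed

end


section \<open>Trees\<close>

text \<open>Instantiated twice: by the graph without loops and by the maximal tree inside
  it.\<close>

locale reversible_digraph = wf_digraph G for G :: "('v, 'e) pre_digraph" +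
  fixes rev_arc :: "'e \<Rightarrow> 'e"
  assumes rev_in_arcs: "e \<in> arcs G \<Longrightarrow> rev_arc e \<in> arcs G"
    and tail_rev: "e \<in> arcs G \<Longrightarrow> tail G (rev_arc e) = head G e"
    and head_rev: "e \<in> arcs G \<Longrightarrow> head G (rev_arc e) = tail G e"
    and rev_rev: "e \<in> arcs G \<Longrightarrow> rev_arc (rev_arc e) = e"
begin

text \<open>An arc put in front of a reduced walk either keeps it reduced or cancels against its
  first arc.\<close>

lemma ex_non_backtracking:
  assumes "awalk u p v"
  shows "\<exists>q. awalk u q v \<and> non_backtracking rev_arc q"
  using assms
proof (induction p arbitrary: u)
  case Nil
  then show ?case by (intro exI[of _ "[]"]) (simp add: non_backtracking_def)
next
  case (Cons e p)
  then have e: "e \<in> arcs G" "u = tail G e" "awalk (head G e) p v"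
    by (auto simp: awalk_Cons_iff)
  then obtain q where q: "awalk (head G e) q v" "non_backtracking rev_arc q"
    using Cons.IH by blast
  show ?case
  proof (cases "\<exists>q'. q = rev_arc e # q'")
    case True
    then obtain q' where "q = rev_arc e # q'" by blast
    with q e show ?thesis
      by (intro exI[of _ q'])
        (cases q'; auto simp: awalk_Cons_iff head_rev non_backtracking_def)
  next
    case False
    with q e show ?thesis
      by (intro exI[of _ "e # q"])
        (cases q; auto simp: awalk_Cons_iff non_backtracking_def)
  qed
qed

lemma awalk_reverse: "awalk u p v \<Longrightarrow> awalk v (rev (map rev_arc p)) u"
proof (induction p arbitrary: u)
  case (Cons e p)
  then have e: "e \<in> arcs G" "u = tail G e" "awalk (head G e) p v"
    by (auto simp: awalk_Cons_iff)
  moreover have "awalk (head G e) [rev_arc e] u"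
    using e by (simp add: awalk_Cons_iff rev_in_arcs tail_rev head_rev awalk_Nil_iff)
  ultimately show ?case
    using Cons.IH[of "head G e"] awalk_appendI by fastforce
qed (auto simp: awalk_Nil_iff)

lemma non_backtracking_reverse:
  assumes "set p \<subseteq> arcs G" "non_backtracking rev_arc p"
  shows "non_backtracking rev_arc (rev (map rev_arc p))"
proof -
  have "successively (\<lambda>e f. rev_arc e \<noteq> rev_arc (rev_arc f)) p
      = successively (\<lambda>e f. f \<noteq> rev_arc e) p"
    using assms(1) by (intro successively_cong refl) (auto simp: rev_rev subset_iff)
  then show ?thesis
    using assms(2) by (simp add: non_backtracking_def successively_rev successively_map)
qed

text \<open>Common initial arcs are removed. If the first arcs then differ, the reverse of one walk
  followed by the other is closed and reduced, since no cancellation occurs at the joint.\<close>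

lemma non_backtracking_unique:
  assumes acyclic: "\<And>u p. awalk u p u \<Longrightarrow> non_backtracking rev_arc p \<Longrightarrow> p = []"
    and "awalk u p v" "non_backtracking rev_arc p" "awalk u q v" "non_backtracking rev_arc q"
  shows "p = q"
  using assms(2-)
proof (induction p arbitrary: u q)
  case Nil
  then show ?case using acyclic[of v q] by (auto simp: awalk_Nil_iff)
next
  case (Cons e p)
  show ?case
  proof (cases q)
    case Nil
    then show ?thesis using Cons.prems acyclic[of v "e # p"] by (auto simp: awalk_Nil_iff)
  next
    case q: (Cons f q')
    show ?thesis
    proof (cases "e = f")
      case True
      have "p = q'"
        using Cons.prems unfolding q
        by (intro Cons.IH[of "head G e"])
          (cases p; cases q'; auto simp: True awalk_Cons_iff non_backtracking_def)+
      then show ?thesis using q True by simp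
    next
      case False
      let ?r = "rev (map rev_arc (e # p))"
      have ep: "set (e # p) \<subseteq> arcs G"
        using Cons.prems(1) by (auto simp: awalk_def)
      have "awalk v (?r @ q) v"
        using awalk_reverse[OF Cons.prems(1)] Cons.prems(3) by (rule awalk_appendI)
      moreover have "non_backtracking rev_arc (?r @ q)"
        using non_backtracking_reverse[OF ep Cons.prems(2)] Cons.prems(4) ep False q
        by (auto simp: non_backtracking_def successively_append_iff rev_rev)
      ultimately show ?thesis
        using acyclic[of v "?r @ q"] by simp
    qed
  qed
qed

text \<open>If the tree misses a vertex, connectedness provides an arc e that leaves it. Adding the
  end of e together with e and its reverse gives a larger tree.\<close>

lemma maximal_undirected_tree_spanning:
  assumes T: "max_subgraph (undirected_tree rev_arc) T"
    and conn: "\<And>u v. u \<in> verts G \<Longrightarrow> v \<in> verts G \<Longrightarrow> \<exists>p. awalk u p v"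
  shows "verts T = verts G"
proof (rule ccontr)
  assume neq: "verts T \<noteq> verts G"
  have sub: "subgraph T G" and tree: "undirected_tree rev_arc T"
    using T by (auto simp: max_subgraph_def)
  have TG: "verts T \<subseteq> verts G" "arcs T \<subseteq> arcs G" "tail T = tail G" "head T = head G" "wf_digraph T"
    using sub by (auto simp: subgraph_def compatible_def)
  interpret T: wf_digraph T by (rule TG)
  have revT: "rev_arc ` arcs T \<subseteq> arcs T" and sc: "strongly_connected T"
      and acyc: "\<And>u p. T.awalk u p u \<Longrightarrow> non_backtracking rev_arc p \<Longrightarrow> p = []"
    using tree by (auto simp: undirected_tree_def)
  obtain a where a: "a \<in> verts T"
    using sc by (auto simp: strongly_connected_def)
  obtain b where b: "b \<in> verts G" "b \<notin> verts T"
    using neq TG by blast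
  obtain p where "awalk a p b"
    using conn a b TG by blast
  then have "\<exists>e\<in>arcs G. tail G e \<in> verts T \<and> head G e \<notin> verts T"
    using a b
  proof (induction p arbitrary: a)
    case (Cons e p)
    show ?case
    proof (cases "head G e \<in> verts T")
      case True
      then show ?thesis
        using Cons.IH[of "head G e"] Cons.prems by (auto simp: awalk_Cons_iff)
    next
      case False
      then show ?thesis using Cons.prems by (auto simp: awalk_Cons_iff)
    qed
  qed (auto simp: awalk_Nil_iff)
  then obtain e where e: "e \<in> arcs G" "tail G e \<in> verts T" "head G e \<notin> verts T"
    by blast
  define v where "v = head G e"
  define T' where "T' = T\<lparr>verts := insert v (verts T), arcs := insert e (insert (rev_arc e) (arcs T))\<rparr>"
  have T': "verts T' = insert v (verts T)" "arcs T' = insert e (insert (rev_arc e) (arcs T))"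
      "tail T' = tail G" "head T' = head G"
    using TG by (auto simp: T'_def)
  have wfT': "wf_digraph T'"
    using TG e T.tail_in_verts T.head_in_verts
    by (unfold_locales) (auto simp: T' v_def tail_rev head_rev)
  interpret T': wf_digraph T' by (rule wfT')
  have subT: "subgraph T T'"
    using wfT' TG by (auto simp: subgraph_def compatible_def T')
  have subG: "subgraph T' G"
    using wfT' TG e by (auto simp: subgraph_def compatible_def T' v_def rev_in_arcs wf_digraph_axioms)
  have walk: "awalk x p y" if "T'.awalk x p y" for x p y
    using subgraph_awalk_imp_awalk[OF that subG] .
  have arcT: "tail G f \<in> verts T \<and> head G f \<in> verts T" if "f \<in> arcs T" for f
    using T.tail_in_verts[OF that] T.head_in_verts[OF that] TG by simp
  have "strongly_connected T'"
  proof (rule strongly_connectedI)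
    have "T'.awalk (tail G e) [e] v" "T'.awalk v [rev_arc e] (tail G e)"
      using e by (auto simp: T'.awalk_Cons_iff T'.awalk_Nil_iff T' v_def tail_rev head_rev)
    then have hub: "tail G e \<rightarrow>\<^sup>*\<^bsub>T'\<^esub> v" "v \<rightarrow>\<^sup>*\<^bsub>T'\<^esub> tail G e"
      using T'.reachable_awalk by blast+
    have TT: "x \<rightarrow>\<^sup>*\<^bsub>T'\<^esub> y" if "x \<in> verts T" "y \<in> verts T" for x y
      using sc that T'.reachable_mono[OF _ subT] by (auto simp: strongly_connected_def)
    have "x \<rightarrow>\<^sup>*\<^bsub>T'\<^esub> tail G e \<and> tail G e \<rightarrow>\<^sup>*\<^bsub>T'\<^esub> x" if "x \<in> verts T'" for x
      using that TT e hub by (auto simp: T')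
    then show "x \<rightarrow>\<^sup>*\<^bsub>T'\<^esub> y" if "x \<in> verts T'" "y \<in> verts T'" for x y
      using that T'.reachable_trans by blast
  qed (simp add: T')
  moreover have "rev_arc ` arcs T' \<subseteq> arcs T'"
    using revT e by (auto simp: T' rev_rev)
  moreover have "p = []" if closed: "T'.awalk x p x" and nb: "non_backtracking rev_arc p" for x p
  proof -
    \<comment> \<open>The new vertex v is a leaf: its only outgoing arc is the reverse of e, and its
      only incoming arc is e.\<close>
    have out: "g = rev_arc e" if "g \<in> arcs T'" "tail G g = v" for g
      using that arcT[of g] e by (auto simp: T' v_def)
    have into: "g = e" if "g \<in> arcs T'" "head G g = v" for g
      using that arcT[of g] e by (auto simp: T' v_def head_rev)
    \<comment> \<open>A reduced walk between vertices of T cannot visit v, because it would have to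
      leave v by the reverse of the arc that led there.\<close>
    have inT: "T.awalk a q b"
      if "T'.awalk a q b" "non_backtracking rev_arc q" "a \<in> verts T" "b \<in> verts T" for a b q
      using that
    proof (induction q arbitrary: a)
      case Nil
      then show ?case by (auto simp: T.awalk_Nil_iff T'.awalk_Nil_iff)
    next
      case (Cons f q)
      then have f: "f \<in> arcs T'" "a = tail G f" "T'.awalk (head G f) q b"
        by (auto simp: T'.awalk_Cons_iff T')
      have "f \<noteq> e"
      proof
        assume fe: "f = e"
        have "q \<noteq> []"
        proof
          assume "q = []"
          then have "head G f = b"
            using f(3) by (simp add: T'.awalk_Nil_iff)
          then show False
            using fe e(3) Cons.prems(4) by simp
        qed
        then obtain g q' where q: "q = g # q'"
          by (meson neq_Nil_conv)
        have "g \<in> arcs T'" "tail G g = v"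
          using f(3) unfolding q T'.awalk_Cons_iff by (simp_all add: fe v_def T'(3))
        then have "g = rev_arc e"
          by (rule out)
        then show False
          using q fe Cons.prems(2) by (auto simp: non_backtracking_def)
      qed
      moreover have "f \<noteq> rev_arc e"
        using f(2) Cons.prems(3) e by (auto simp: tail_rev)
      ultimately have fT: "f \<in> arcs T"
        using f by (auto simp: T')
      moreover have "T.awalk (head G f) q b"
        using Cons.prems f arcT[OF fT]
        by (intro Cons.IH) (cases q; auto simp: non_backtracking_def)+
      ultimately show ?case
        using f TG by (auto simp: T.awalk_Cons_iff)
    qed
    show ?thesis
    proof (cases "x \<in> verts T")
      case True
      then show ?thesis using inT[OF closed nb True True] nb acyc[of x p] by simp
    next
      case False
      then have xv: "x = v"
        using T'.awalk_hd_in_verts[OF closed] by (auto simp: T')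
      show ?thesis
      proof (rule ccontr)
        assume "p \<noteq> []"
        \<comment> \<open>A closed walk at v starts with the reverse of e and ends with e. The part
          in between is closed and reduced in T, hence empty, so the two outer arcs are a
          backtrack.\<close>
        then obtain f q where p: "p = f # q"
          by (cases p) auto
        have fv: "f \<in> arcs T'" "tail G f = v" "T'.awalk (head G f) q v"
          using closed unfolding p xv T'.awalk_Cons_iff T'(3,4) by metis+
        have fe: "f = rev_arc e"
          using fv(1,2) by (rule out)
        have qw: "T'.awalk (tail G e) q v"
          using fv(3) e(1) by (simp add: fe head_rev)
        have "q \<noteq> []"
        proof
          assume "q = []"
          then have "tail G e = v"
            using qw by (simp add: T'.awalk_Nil_iff)
          then show False
            using e(2,3) by (simp add: v_def)
        qed
        then obtain r g where q: "q = r @ [g]"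
          by (meson rev_exhaust)
        have rg: "g \<in> arcs T'" "head G g = v" "T'.awalk (tail G e) r (tail G g)"
          using qw unfolding q T'.awalk_append_iff T'.awalk_Cons_iff T'.awalk_Nil_iff
          by (auto simp: T'(3,4))
        have "g = e"
          using rg(1,2) by (rule into)
        moreover from this have "T'.awalk (tail G e) r (tail G e)"
          using rg(3) by simp
        moreover have "non_backtracking rev_arc r"
          using nb successively_append_iff[of "\<lambda>e f. f \<noteq> rev_arc e" "[f]" "r @ [g]"]
          unfolding p q by (simp add: non_backtracking_def successively_append_iff)
        ultimately have "r = []"
          using inT[of "tail G e" r "tail G e"] e(2) acyc[of "tail G e" r] by simp
        then show False
          using nb \<open>g = e\<close> rev_rev[OF e(1)] unfolding p q fe by (simp add: non_backtracking_def)
      qed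
    qed
  qed
  ultimately have "undirected_tree rev_arc T'"
    by (auto simp: undirected_tree_def)
  moreover have "T' \<noteq> T"
    using T' e by (auto simp: v_def)
  ultimately show False
    using T subT subG by (auto simp: max_subgraph_def)
qed

end


section \<open>The groupoids\<close>

context coxeter
begin

lemma C_grpd_mult: "a \<in> C_grpd W S \<Lambda> x y \<Longrightarrow> b \<in> C_grpd W S \<Lambda> y z \<Longrightarrow> a \<otimes> b \<in> C_grpd W S \<Lambda> x z"
  by (auto simp: C_grpd_iff act_mult)

lemma C_grpd_inv:
  assumes "a \<in> C_grpd W S \<Lambda> x y"
  shows "inv a \<in> C_grpd W S \<Lambda> y x"
proof -
  have "a \<in> carrier W" "a \<bullet> \<alpha> (y l) = \<alpha> (x l)" if "l \<in> \<Lambda>" for l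
    using assms that by (auto simp: C_grpd_iff)
  then have "inv a \<bullet> \<alpha> (x l) = \<alpha> (y l)" if "l \<in> \<Lambda>" for l
    using that by (metis act_inv_left)
  with assms show ?thesis
    by (simp add: C_grpd_iff)
qed

lemma perp_rootsD: "\<gamma> \<in> perp_roots W S J \<Longrightarrow> \<gamma> \<in> \<Phi> \<and> (\<forall>j\<in>J. vform W \<gamma> (\<alpha> j) = 0)"
  by (simp add: perp_roots_def)

lemma act_perp_roots:
  assumes w: "w \<in> carrier W" and J: "J \<subseteq> S" "J' \<subseteq> S"
    and im: "\<And>j'. j' \<in> J' \<Longrightarrow> \<exists>j\<in>J. w \<bullet> \<alpha> j = \<alpha> j' \<or> w \<bullet> \<alpha> j = - \<alpha> j'"
    and \<gamma>: "\<gamma> \<in> perp_roots W S J"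
  shows "w \<bullet> \<gamma> \<in> perp_roots W S J'"
proof -
  have g: "\<gamma> \<in> \<Phi>" "supp \<gamma> \<subseteq> S"
    using perp_rootsD[OF \<gamma>] supp_root by auto
  have "vform W (w \<bullet> \<gamma>) (\<alpha> j') = 0" if j': "j' \<in> J'" for j'
  proof -
    obtain j where j: "j \<in> J" "w \<bullet> \<alpha> j = \<alpha> j' \<or> w \<bullet> \<alpha> j = - \<alpha> j'"
      using im[OF j'] by blast
    then have "vform W (w \<bullet> \<gamma>) (w \<bullet> \<alpha> j) = 0"
      using g w J perp_rootsD[OF \<gamma>] by (subst vform_act) auto
    then show ?thesis
      using j(2) by (auto simp: vform_bilinear)
  qed
  then show ?thesis
    using g w by (simp add: perp_roots_def act_root)
qed

lemma C_grpd_perp_roots: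
  assumes "x \<in> injections \<Lambda> S" "y \<in> injections \<Lambda> S" "w \<in> C_grpd W S \<Lambda> x y"
    and "\<gamma> \<in> perp_roots W S (y ` \<Lambda>)"
  shows "w \<bullet> \<gamma> \<in> perp_roots W S (x ` \<Lambda>)"
  using assms injections_image by (intro act_perp_roots[OF _ _ _ _ assms(4)]) (auto simp: C_grpd_iff)

lemma Y_grpd_pos:
  assumes "x \<in> injections \<Lambda> S" "y \<in> injections \<Lambda> S" "w \<in> Y_grpd W S \<Lambda> x y"
    and "\<gamma> \<in> pos_perp_roots W S (y ` \<Lambda>)"
  shows "w \<bullet> \<gamma> \<in> pos_perp_roots W S (x ` \<Lambda>)"
  using assms C_grpd_perp_roots[of x \<Lambda> y w \<gamma>] by (auto simp: Y_grpd_def pos_perp_roots_def)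

lemma Y_grpd_mult:
  assumes "x \<in> injections \<Lambda> S" "y \<in> injections \<Lambda> S" "z \<in> injections \<Lambda> S"
    and a: "a \<in> Y_grpd W S \<Lambda> x y" and b: "b \<in> Y_grpd W S \<Lambda> y z"
  shows "a \<otimes> b \<in> Y_grpd W S \<Lambda> x z"
proof -
  have "a \<in> C_grpd W S \<Lambda> x y" "b \<in> C_grpd W S \<Lambda> y z"
    using a b by (auto simp: Y_grpd_def)
  moreover from this have "a \<in> carrier W" "b \<in> carrier W"
    by (auto simp: C_grpd_iff)
  moreover have "a \<bullet> b \<bullet> \<gamma> \<in> \<Phi>p" if "\<gamma> \<in> pos_perp_roots W S (z ` \<Lambda>)" for \<gamma>
    using Y_grpd_pos[OF assms(1,2) a Y_grpd_pos[OF assms(2,3) b that]] by (simp add: pos_perp_roots_def)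
  ultimately show ?thesis
    by (auto simp: Y_grpd_def C_grpd_mult act_mult)
qed

lemma Y_grpd_one: "\<one> \<in> Y_grpd W S \<Lambda> x x"
  by (auto simp: Y_grpd_def C_grpd_iff pos_perp_roots_def)

lemma edge_elt_Y_or_loop:
  assumes x: "x \<in> injections \<Lambda> S" and y: "y \<in> injections \<Lambda> S" and s: "s \<in> S" "s \<notin> x ` \<Lambda>"
    and Kdef: "K = link_component W (x ` \<Lambda>) {s}" and fin: "finite_type W K"
    and C: "edge_elt K s \<in> C_grpd W S \<Lambda> y x" and neq: "x \<noteq> y"
  shows "edge_elt K s \<in> Y_grpd W S \<Lambda> y x"
proof (rule ccontr)
  assume "edge_elt K s \<notin> Y_grpd W S \<Lambda> y x"
  then obtain \<gamma> where g: "\<gamma> \<in> pos_perp_roots W S (x ` \<Lambda>)" "edge_elt K s \<bullet> \<gamma> \<notin> \<Phi>p"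
    using C by (auto simp: Y_grpd_def)
  have JS: "insert s (x ` \<Lambda>) \<subseteq> S"
    using injections_image[OF x] s by simp
  have K: "K \<subseteq> S" "s \<in> K" "K - {s} \<subseteq> x ` \<Lambda>"
    unfolding Kdef using link_component[OF JS] JS by auto
  have gp: "\<gamma> \<in> \<Phi>p" "\<gamma> \<in> \<Phi>" "supp \<gamma> \<subseteq> S" and perp: "\<And>j. j \<in> x ` \<Lambda> \<Longrightarrow> vform W \<gamma> (\<alpha> j) = 0"
    using g(1) perp_rootsD supp_root by (auto simp: pos_perp_roots_def pos_root_in_roots)
  \<comment> \<open>An inversion orthogonal to [x] identifies the edge with the reflection in it.
    This reflection fixes the simple roots of [x], so the target would be x.\<close>
  have "edge_elt K s = refl \<gamma>"
    using edge_elt_inversion[OF K(1) fin K(2) gp(1) g(2)] perp K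
    by (intro edge_elt_eq_refl[OF K(1) fin K(2) gp(1)]) auto
  moreover have "refl \<gamma> \<bullet> \<alpha> (x l) = \<alpha> (x l)" if "l \<in> \<Lambda>" for l
    using that gp perp injections_in[OF x that] by (intro poly_mapping_eqI) (simp add: refl_act lookup_minus)
  ultimately have "edge_elt K s \<in> C_grpd W S \<Lambda> x x"
    using gp by (simp add: C_grpd_iff refl_closed)
  then show False
    using C_grpd_target_unique[OF x y _ C] neq by blast
qed

section \<open>Deodhar's descent\<close>

abbreviation inversions :: "'a \<Rightarrow> 'a vec_space set" where
  "inversions w \<equiv> {\<gamma> \<in> \<Phi>p. w \<bullet> \<gamma> \<notin> \<Phi>p}"

text \<open>The set F below consists of the roots supported on K with positive coefficient at s. All
  of them are inversions of w, so F is finite, and the parabolic subgroup of \<open>K - {s}\<close>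
  acts on F faithfully; this leads to the finiteness of W_K. Since F also contains the inversions of
  the edge, dividing w by the edge creates no new inversions and removes the one at
  \<alpha>_s.\<close>

lemma edge_descent:
  assumes x: "x \<in> injections \<Lambda> S" and z: "z \<in> injections \<Lambda> S" and w: "w \<in> C_grpd W S \<Lambda> z x"
    and s: "s \<in> S" "w \<bullet> \<alpha> s \<notin> \<Phi>p" and Kdef: "K = link_component W (x ` \<Lambda>) {s}"
  shows "s \<notin> x ` \<Lambda>" and "finite_type W K"
    and "card (inversions (w \<otimes> inv (edge_elt K s))) < card (inversions w)"
proof -
  have wx: "w \<bullet> \<alpha> (x l) = \<alpha> (z l)" if "l \<in> \<Lambda>" for l
    using w that by (auto simp: C_grpd_iff)
  have wc: "w \<in> carrier W"
    using w by (simp add: C_grpd_iff)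
  have wzpos: "w \<bullet> \<alpha> j \<in> \<Phi>p \<and> (\<exists>l\<in>\<Lambda>. w \<bullet> \<alpha> j = \<alpha> (z l))" if "j \<in> x ` \<Lambda>" for j
    using that wx injections_in[OF z] simple_root_pos by auto
  show snx: "s \<notin> x ` \<Lambda>"
    using wzpos s by blast
  have JS: "insert s (x ` \<Lambda>) \<subseteq> S"
    using injections_image[OF x] s by simp
  have K: "K \<subseteq> S" "s \<in> K" "K - {s} \<subseteq> x ` \<Lambda>"
    unfolding Kdef using link_component[OF JS] JS by auto
  define F where "F = {\<gamma> \<in> \<Phi>. supp \<gamma> \<subseteq> K \<and> coef \<gamma> s > 0}"
  \<comment> \<open>The image of \<alpha>_s is not supported on [z]: otherwise the inverse of w
    would turn it into a combination of simple roots of [x], which has coefficient 0 at s.\<close>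
  obtain t where t: "t \<notin> z ` \<Lambda>" "coef (w \<bullet> \<alpha> s) t < 0"
  proof -
    have "- (w \<bullet> \<alpha> s) \<in> \<Phi>p"
      using s wc by (simp add: neg_root_iff act_root simple_root_in_roots)
    then have nonpos: "coef (w \<bullet> \<alpha> s) k \<le> 0" for k
      using nonneg_pos_root[of "- (w \<bullet> \<alpha> s)" k] by simp
    have "\<not> supp (w \<bullet> \<alpha> s) \<subseteq> z ` \<Lambda>"
    proof
      assume sub: "supp (w \<bullet> \<alpha> s) \<subseteq> z ` \<Lambda>"
      have "coef (inv w \<bullet> w \<bullet> \<alpha> s) s
          = (\<Sum>k\<in>supp (w \<bullet> \<alpha> s). coef (w \<bullet> \<alpha> s) k * coef (inv w \<bullet> \<alpha> k) s)"
        by (rule coef_act)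
      also have "\<dots> = 0"
      proof (rule sum.neutral, intro ballI)
        fix k
        assume "k \<in> supp (w \<bullet> \<alpha> s)"
        then obtain l where l: "l \<in> \<Lambda>" "k = z l"
          using sub by blast
        then have "inv w \<bullet> \<alpha> k = \<alpha> (x l)"
          using wx wc by (metis act_inv_left)
        then show "coef (w \<bullet> \<alpha> s) k * coef (inv w \<bullet> \<alpha> k) s = 0"
          using snx l by (auto simp: coef_simple_root)
      qed
      finally show False
        using wc by (simp add: coef_simple_root)
    qed
    then obtain t where "t \<in> supp (w \<bullet> \<alpha> s)" "t \<notin> z ` \<Lambda>"
      by blast
    then show thesis
      using that nonpos[of t] by (auto simp: in_keys_iff less_le)
  qed
  have F_pos: "\<gamma> \<in> \<Phi>p" if "\<gamma> \<in> F" for \<gamma>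
    using that root_posI by (auto simp: F_def)
  have F_neg: "w \<bullet> \<gamma> \<notin> \<Phi>p" if "\<gamma> \<in> F" for \<gamma>
  proof -
    have g: "supp \<gamma> \<subseteq> K" "coef \<gamma> s > 0"
      using that by (auto simp: F_def)
    have "coef (w \<bullet> \<gamma>) t = (\<Sum>k\<in>supp \<gamma>. coef \<gamma> k * coef (w \<bullet> \<alpha> k) t)"
      by (rule coef_act)
    \<comment> \<open>The simple roots of \<open>K - {s}\<close> go to simple roots of [z], which
      vanish at t. So the coefficient at t depends on the coefficient at s only.\<close>
    also have "\<dots> = (\<Sum>k\<in>{s}. coef \<gamma> k * coef (w \<bullet> \<alpha> k) t)"
    proof (rule sum.mono_neutral_right)
      show "\<forall>k\<in>supp \<gamma> - {s}. coef \<gamma> k * coef (w \<bullet> \<alpha> k) t = 0"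
      proof
        fix k
        assume "k \<in> supp \<gamma> - {s}"
        then obtain l where "l \<in> \<Lambda>" "k = x l"
          using g K by blast
        then show "coef \<gamma> k * coef (w \<bullet> \<alpha> k) t = 0"
          using wx t(1) by (auto simp: coef_simple_root)
      qed
    qed (use g in \<open>auto simp: in_keys_iff\<close>)
    also have "\<dots> < 0"
      using g t(2) by (simp add: mult_pos_neg)
    finally show ?thesis
      using nonneg_pos_root[of "w \<bullet> \<gamma>" t] by force
  qed
  have "F \<subseteq> inversions w"
    using F_pos F_neg by blast
  then have finF: "finite F"
    using finite_inversions[OF wc] finite_subset by blast
  have sF: "\<alpha> s \<in> F"
    using s K by (simp add: F_def simple_root_in_roots coef_simple_root)
  have KmS: "K - {s} \<subseteq> S"
    using K by blast
  have F_stable: "u \<bullet> \<gamma> \<in> F" if u: "u \<in> generate W (K - {s})" and g: "\<gamma> \<in> F" for u \<gamma>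
  proof -
    have "generate W (K - {s}) \<subseteq> generate W K"
      by (rule mono_generate) auto
    then show ?thesis
      using u g parabolic_supp[OF K(1), of u \<gamma>] generate_act_coef[OF KmS u, of s] generate_closed[OF KmS u]
      by (auto simp: F_def act_root)
  qed
  \<comment> \<open>Induction along a path from s in the Coxeter graph. It carries along a root of F
    that is positive at the current vertex and supported on K1, the vertices whose simple roots u
    fixes.\<close>
  have F_faithful: "u \<bullet> \<alpha> k = \<alpha> k"
    if u: "\<And>\<gamma>. \<gamma> \<in> F \<Longrightarrow> u \<bullet> \<gamma> = \<gamma>" and k: "k \<in> K" for u k
  proof -
    define K1 where "K1 = {k \<in> K. u \<bullet> \<alpha> k = \<alpha> k}"
    have "(s, k) \<in> (cox_adj W (insert s (x ` \<Lambda>)))\<^sup>*"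
      using k unfolding Kdef link_component_eq[OF JS] by blast
    then have "k \<in> K1 \<and> (\<exists>\<gamma>\<in>F. coef \<gamma> k > 0 \<and> supp \<gamma> \<subseteq> K1)"
    proof (induction rule: rtrancl_induct)
      case base
      have "s \<in> K1"
        using u[OF sF] K by (simp add: K1_def)
      then show ?case
        using sF by (intro conjI bexI[of _ "\<alpha> s"]) (auto simp: coef_simple_root)
    next
      case (step k k')
      then obtain \<gamma> where g: "\<gamma> \<in> F" "coef \<gamma> k > 0" "supp \<gamma> \<subseteq> K1"
        by blast
      have gF: "\<gamma> \<in> \<Phi>" "supp \<gamma> \<subseteq> K" "coef \<gamma> s > 0" "\<gamma> \<in> \<Phi>p"
        using g F_pos by (auto simp: F_def)
      have "k' \<in> K"
        unfolding Kdef link_component_eq[OF JS] using step by (auto intro: rtrancl_into_rtrancl)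
      then have k': "k' \<in> K" "k' \<in> S"
        using K by auto
      show ?case
      proof (cases "coef \<gamma> k' = 0")
        case False
        then have "coef \<gamma> k' > 0" "k' \<in> K1"
          using nonneg_pos_root[OF gF(4), of k'] g(3) by (auto simp: in_keys_iff less_le)
        then show ?thesis using g by blast
      next
        case True
        \<comment> \<open>The next vertex k' is adjacent to k, where \<gamma> is positive, and
          \<gamma> vanishes at k', so the form value is strictly negative. The reflection of
          \<gamma> by k' thus lies in F and is \<gamma> plus a positive multiple of the simple root
          of k'. As u fixes both roots, it fixes this simple root.\<close>
        let ?c = "vform W (\<alpha> k') \<gamma>"
        have c: "?c < 0"
        proof -
          have "?c = (\<Sum>q\<in>supp \<gamma>. coef \<gamma> q * gram W k' q)"
            by (simp add: vform_def coef_simple_root)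
          also have "\<dots> < (\<Sum>q\<in>supp \<gamma>. 0)"
          proof (rule sum_strict_mono_ex1)
            have "coef \<gamma> q * gram W k' q \<le> 0" if "q \<in> supp \<gamma>" for q
              using that True k' gF K nonneg_pos_root[OF gF(4), of q]
              by (intro mult_nonneg_nonpos gram_nonpos) auto
            then show "\<forall>q\<in>supp \<gamma>. coef \<gamma> q * gram W k' q \<le> 0"
              by blast
            have "(k', k) \<in> cox_adj W (insert s (x ` \<Lambda>))"
              using step(2) sym_cox_adj[OF JS] by (meson symD)
            then have "gram W k' k < 0"
              by (rule gram_adj[OF JS])
            then show "\<exists>q\<in>supp \<gamma>. coef \<gamma> q * gram W k' q < 0"
              using g(2) by (intro bexI[of _ k]) (auto simp: in_keys_iff mult_pos_neg)
          qed simp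
          finally show ?thesis by simp
        qed
        define \<delta> where "\<delta> = k' \<bullet> \<gamma>"
        have dcoef: "coef \<delta> q = coef \<gamma> q - (if q = k' then 2 * ?c else 0)" for q
          using k' by (simp add: \<delta>_def act_S coef_simple_act)
        have "s \<noteq> k'"
          using True gF by auto
        then have dF: "\<delta> \<in> F"
          using k' gF dcoef by (auto simp: F_def \<delta>_def[symmetric] in_keys_iff subset_iff)
            (simp add: \<delta>_def act_root S_closed)
        have "\<delta> = \<gamma> - vscale (2 * ?c) (\<alpha> k')"
          using k' by (simp add: \<delta>_def act_S simple_act_def)
        then have "\<gamma> - vscale (2 * ?c) (u \<bullet> \<alpha> k') = \<gamma> - vscale (2 * ?c) (\<alpha> k')"
          using u[OF dF] u[OF g(1)] by (simp add: act_diff act_scale)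
        then have "u \<bullet> \<alpha> k' = \<alpha> k'"
          using c by (simp add: poly_mapping_eq_iff fun_eq_iff lookup_minus)
        then have "k' \<in> K1"
          using k' by (simp add: K1_def)
        moreover have "supp \<delta> \<subseteq> K1"
          using g(3) dcoef calculation by (auto simp: in_keys_iff subset_iff split: if_splits)
        moreover have "coef \<delta> k' > 0"
          using dcoef[of k'] True c by simp
        ultimately show ?thesis
          using dF by blast
      qed
    qed
    then show ?thesis
      by (simp add: K1_def)
  qed
  have fin_minus: "finite_type W (K - {s})"
  proof -
    have "inj_on (\<lambda>u. restrict (act W S u) F) (generate W (K - {s}))"
    proof (rule inj_onI)
      fix u v
      assume uv: "u \<in> generate W (K - {s})" "v \<in> generate W (K - {s})"
        "restrict (act W S u) F = restrict (act W S v) F"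
      have c: "u \<in> carrier W" "v \<in> carrier W"
        using uv KmS generate_closed by auto
      have "(inv v \<otimes> u) \<bullet> \<gamma> = \<gamma>" if "\<gamma> \<in> F" for \<gamma>
        using fun_cong[OF uv(3), of \<gamma>] that c by (simp add: act_mult)
      then have "(inv v \<otimes> u) \<bullet> \<alpha> k = \<alpha> k" if "k \<in> K" for k
        using that by (rule F_faithful)
      moreover have "inv v \<otimes> u \<in> generate W (K - {s})"
        using uv KmS by (simp add: generate.eng generate_inv_closed)
      ultimately have "inv v \<otimes> u = \<one>"
        using KmS simple_root_pos by (intro parabolic_pos_imp_one[OF KmS]) auto
      then show "u = v"
        using c by (metis inv_closed inv_equality inv_inv)
    qed
    moreover have "(\<lambda>u. restrict (act W S u) F) ` generate W (K - {s}) \<subseteq> F \<rightarrow>\<^sub>E F"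
      using F_stable by (intro image_subsetI restrict_PiE_iff[THEN iffD2] ballI)
    ultimately show ?thesis
      using finF finite_PiE[of F "\<lambda>_. F"] unfolding finite_type_def
      by (meson finite_imageD finite_subset)
  qed
  have mc: "w0 (K - {s}) \<in> carrier W"
    by (rule longest_elt_closed[OF KmS fin_minus])
  show fin: "finite_type W K"
  proof (rule finite_type_if_neg[OF _ K(1)])
    show "w \<otimes> w0 (K - {s}) \<in> carrier W"
      using wc mc by simp
    show "(w \<otimes> w0 (K - {s})) \<bullet> \<alpha> k \<notin> \<Phi>p" if k: "k \<in> K" for k
    proof (cases "k = s")
      case True
      then show ?thesis
        using F_neg[OF F_stable[OF longest_elt_in[OF KmS fin_minus] sF]] wc mc by (simp add: act_mult)
    next
      case False
      then obtain k' where k': "k' \<in> K - {s}" "w0 (K - {s}) \<bullet> \<alpha> k = - \<alpha> k'"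
        using longest_elt_simple[OF KmS fin_minus, of k] k by blast
      then have "w \<bullet> \<alpha> k' \<in> \<Phi>p"
        using wzpos K by blast
      then show ?thesis
        using pos_root_not_neg k' wc mc by (simp add: act_mult act_minus)
    qed
  qed
  let ?v = "edge_elt K s"
  note Kc = K(1) fin K(2)
  have vc: "?v \<in> carrier W"
    by (rule edge_elt_closed[OF Kc])
  \<comment> \<open>If the inverse of the edge made an inversion \<gamma> of the quotient negative,
    the opposite of the image would be an inversion of the edge, hence in F, and w would make the
    image positive. The root \<alpha>_s is not reached because the edge makes it negative.\<close>
  have inv_pos: "inv ?v \<bullet> \<gamma> \<in> \<Phi>p \<and> w \<bullet> inv ?v \<bullet> \<gamma> \<notin> \<Phi>p \<and> inv ?v \<bullet> \<gamma> \<noteq> \<alpha> s"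
    if g: "\<gamma> \<in> inversions (w \<otimes> inv ?v)" for \<gamma>
  proof -
    have gn: "\<gamma> \<in> \<Phi>p" "w \<bullet> inv ?v \<bullet> \<gamma> \<notin> \<Phi>p"
      using g wc vc by (auto simp: act_mult)
    have "inv ?v \<bullet> \<gamma> \<in> \<Phi>p"
    proof (rule ccontr)
      assume "inv ?v \<bullet> \<gamma> \<notin> \<Phi>p"
      then have d: "- (inv ?v \<bullet> \<gamma>) \<in> \<Phi>p"
        using gn vc by (simp add: neg_root_iff act_root pos_root_in_roots)
      moreover have "?v \<bullet> - (inv ?v \<bullet> \<gamma>) \<notin> \<Phi>p"
        using gn vc pos_root_not_neg by (simp add: act_minus)
      ultimately have "- (inv ?v \<bullet> \<gamma>) \<in> F"
        using edge_elt_inversion[OF Kc] pos_root_in_roots unfolding F_def by blast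
      then have "- (w \<bullet> inv ?v \<bullet> \<gamma>) \<notin> \<Phi>p"
        using F_neg by (metis act_minus)
      then show False
        using gn wc vc neg_root_iff by (simp add: act_root pos_root_in_roots)
    qed
    moreover have "inv ?v \<bullet> \<gamma> \<noteq> \<alpha> s"
      using edge_elt_self_neg[OF Kc] gn(1) vc by (metis act_inv_right)
    ultimately show ?thesis
      using gn by blast
  qed
  have "inj_on (act W S (inv ?v)) (inversions (w \<otimes> inv ?v))"
    using vc by (intro inj_onI) (simp add: act_eq_iff)
  moreover have "act W S (inv ?v) ` inversions (w \<otimes> inv ?v) \<subseteq> inversions w - {\<alpha> s}"
  proof (rule image_subsetI)
    fix \<gamma>
    assume "\<gamma> \<in> inversions (w \<otimes> inv ?v)"
    from inv_pos[OF this] show "inv ?v \<bullet> \<gamma> \<in> inversions w - {\<alpha> s}"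
      by simp
  qed
  ultimately have "card (inversions (w \<otimes> inv ?v)) \<le> card (inversions w - {\<alpha> s})"
    using finite_Diff[OF finite_inversions[OF wc]] by (rule card_inj_on_le)
  also have "\<dots> < card (inversions w)"
    using s finite_inversions[OF wc] simple_root_pos by (intro card_Diff1_less) auto
  finally show "card (inversions (w \<otimes> inv ?v)) < card (inversions w)" .
qed


section \<open>Connectedness of the graph\<close>

context
  fixes \<Lambda> :: "'l set" and xI :: "'l \<Rightarrow> 'a"
  assumes xI: "xI \<in> injections \<Lambda> S"
begin

abbreviation "V \<equiv> C_verts W S \<Lambda> xI"
abbreviation "Y1 \<equiv> Y1_graph W S \<Lambda> xI"
abbreviation "target \<equiv> arc_target W S \<Lambda> xI"
abbreviation "reverse \<equiv> arc_reverse W S \<Lambda> xI"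

lemma V_injections: "x \<in> V \<Longrightarrow> x \<in> injections \<Lambda> S"
  by (simp add: C_verts_def)

lemma V_I:
  assumes "x \<in> V" "y \<in> injections \<Lambda> S" "w \<in> C_grpd W S \<Lambda> y x"
  shows "y \<in> V"
proof -
  obtain u where "u \<in> C_grpd W S \<Lambda> x xI"
    using assms(1) by (auto simp: C_verts_def)
  then show ?thesis
    using assms(2) C_grpd_mult[OF assms(3)] by (auto simp: C_verts_def)
qed

lemma target_eqI:
  assumes "y \<in> V" "arc_elt W S \<Lambda> e \<in> C_grpd W S \<Lambda> y (fst e)"
  shows "target e = y"
  unfolding arc_target_def using assms V_injections C_grpd_target_unique by (intro the_equality) blast+

lemma xI_in_V: "xI \<in> V"
  using xI Y_grpd_one[of \<Lambda> xI] by (auto simp: C_verts_def Y_grpd_def)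

lemma Y1_simps:
  "verts Y1 = V" "tail Y1 = fst" "head Y1 = target"
  "e \<in> arcs Y1 \<longleftrightarrow> fst e \<in> V \<and> snd e \<in> S \<and> snd e \<notin> fst e ` \<Lambda> \<and>
    finite_type W (link_component W (fst e ` \<Lambda>) {snd e}) \<and> target e \<noteq> fst e"
  by (auto simp: Y1_graph_def C_graph_def Let_def)

lemma arc_facts:
  assumes x: "x \<in> V" and s: "s \<in> S" "s \<notin> x ` \<Lambda>" and fin: "finite_type W (link_component W (x ` \<Lambda>) {s})"
  obtains y t where "y \<in> V" "t \<in> S" "t \<notin> y ` \<Lambda>" "finite_type W (link_component W (y ` \<Lambda>) {t})"
    "target (x, s) = y" "reverse (x, s) = (y, t)" "target (y, t) = x" "reverse (y, t) = (x, s)"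
    "arc_elt W S \<Lambda> (x, s) \<in> C_grpd W S \<Lambda> y x"
    "x \<noteq> y \<Longrightarrow> arc_elt W S \<Lambda> (x, s) \<in> Y_grpd W S \<Lambda> y x"
proof -
  define K where "K = link_component W (x ` \<Lambda>) {s}"
  obtain y t where y: "y \<in> injections \<Lambda> S" "t \<in> S" "t \<notin> y ` \<Lambda>" "insert t (y ` \<Lambda>) = insert s (x ` \<Lambda>)"
    "link_component W (y ` \<Lambda>) {t} = K" "edge_elt K s \<in> C_grpd W S \<Lambda> y x"
    "edge_elt K t = inv (edge_elt K s)"
    using arc_structure[OF V_injections[OF x] s K_def] fin by (auto simp: K_def)
  have yV: "y \<in> V"
    using V_I[OF x y(1,6)] .
  have elt: "arc_elt W S \<Lambda> (x, s) = edge_elt K s" "arc_elt W S \<Lambda> (y, t) = inv (edge_elt K s)"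
    using y(5,7) by (simp_all add: arc_elt_eq K_def)
  have tgt: "target (x, s) = y"
    using yV y(6) by (intro target_eqI) (simp_all add: elt)
  have tgt': "target (y, t) = x"
    using x C_grpd_inv[OF y(6)] by (intro target_eqI) (simp_all add: elt)
  have "(x ` \<Lambda> \<union> {s}) - y ` \<Lambda> = {t}" "(y ` \<Lambda> \<union> {t}) - x ` \<Lambda> = {s}"
    using y(3,4) s(2) by auto
  then have rev: "reverse (x, s) = (y, t)" "reverse (y, t) = (x, s)"
    by (simp_all add: arc_reverse_def tgt tgt' Let_def)
  have "x \<noteq> y \<Longrightarrow> edge_elt K s \<in> Y_grpd W S \<Lambda> y x"
    using edge_elt_Y_or_loop[OF V_injections[OF x] y(1) s K_def _ y(6)] fin by (simp add: K_def)
  then show thesis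
    using that[of y t] yV y fin tgt tgt' rev elt by (simp add: K_def)
qed

lemma Y1_arc_facts:
  assumes "e \<in> arcs Y1"
  shows "fst e \<in> V \<and> reverse e \<in> arcs Y1 \<and> fst (reverse e) = target e \<and> target (reverse e) = fst e
    \<and> reverse (reverse e) = e \<and> target e \<in> V \<and> arc_elt W S \<Lambda> e \<in> Y_grpd W S \<Lambda> (target e) (fst e)"
proof -
  obtain x s where e: "e = (x, s)"
    by (cases e)
  with assms have x: "x \<in> V" "s \<in> S" "s \<notin> x ` \<Lambda>" "finite_type W (link_component W (x ` \<Lambda>) {s})"
      "target (x, s) \<noteq> x"
    by (auto simp: Y1_simps)
  show ?thesis
    by (rule arc_facts[OF x(1-4)]) (use x(1,5) in \<open>auto simp: e Y1_simps\<close>)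
qed

interpretation Y1: reversible_digraph Y1 reverse
  by unfold_locales (use Y1_arc_facts in \<open>simp_all add: Y1_simps(1-3)\<close>)

text \<open>Induction on the number of inversions of w. The walk is not claimed to represent w:
  edges that are loops are dropped, which changes the element but not the vertices.\<close>

lemma Y1_connected:
  assumes "x \<in> V" "z \<in> V" "w \<in> C_grpd W S \<Lambda> z x"
  shows "\<exists>p. Y1.awalk x p z"
  using assms
proof (induction "card (inversions w)" arbitrary: x w rule: less_induct)
  case less
  note x = V_injections[OF less.prems(1)] and z = V_injections[OF less.prems(2)]
  have wc: "w \<in> carrier W"
    using less.prems by (simp add: C_grpd_iff)
  show ?case
  proof (cases "\<forall>s\<in>S. w \<bullet> \<alpha> s \<in> \<Phi>p")
    case True
    then have "w = \<one>"
      using all_simple_pos_imp_one wc by blast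
    then have "\<one> \<in> C_grpd W S \<Lambda> z x" "\<one> \<in> C_grpd W S \<Lambda> x x"
      using less.prems by (auto simp: C_grpd_iff)
    then have "x = z"
      using C_grpd_target_unique x z by blast
    then show ?thesis
      using less.prems by (intro exI[of _ "[]"]) (simp add: Y1.awalk_Nil_iff Y1_simps)
  next
    case False
    then obtain s where s: "s \<in> S" "w \<bullet> \<alpha> s \<notin> \<Phi>p"
      by blast
    define K where "K = link_component W (x ` \<Lambda>) {s}"
    note descent = edge_descent[OF x z less.prems(3) s K_def]
    obtain y t where y: "y \<in> V" "target (x, s) = y" "arc_elt W S \<Lambda> (x, s) \<in> C_grpd W S \<Lambda> y x"
      using arc_facts[OF less.prems(1) s(1) descent(1)] descent(2) by (auto simp: K_def)
    have "arc_elt W S \<Lambda> (x, s) = edge_elt K s"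
      by (simp add: arc_elt_eq K_def)
    then have "w \<otimes> inv (edge_elt K s) \<in> C_grpd W S \<Lambda> z y"
      using C_grpd_mult[OF less.prems(3)] C_grpd_inv[OF y(3)] by simp
    then obtain p where p: "Y1.awalk y p z"
      using less.hyps[OF descent(3) y(1) less.prems(2)] by blast
    show ?thesis
    proof (cases "x = y")
      case False
      then have "(x, s) \<in> arcs Y1"
        using less.prems(1) s descent y by (auto simp: Y1_simps K_def)
      then show ?thesis
        using p y by (intro exI[of _ "(x, s) # p"]) (simp add: Y1.awalk_Cons_iff Y1_simps)
    qed (use p in blast)
  qed
qed

lemma Y1_walk:
  assumes "x \<in> V" "z \<in> V"
  shows "\<exists>p. Y1.awalk x p z"
proof -
  obtain a b where "a \<in> C_grpd W S \<Lambda> x xI" "b \<in> C_grpd W S \<Lambda> z xI"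
    using assms by (auto simp: C_verts_def)
  then have "b \<otimes> inv a \<in> C_grpd W S \<Lambda> z x"
    by (intro C_grpd_mult C_grpd_inv)
  then show ?thesis
    using Y1_connected assms by blast
qed

lemma Y1_walk_elt:
  assumes "Y1.awalk x p z"
  shows "word_prod W (rev (map (arc_elt W S \<Lambda>) p)) \<in> Y_grpd W S \<Lambda> z x"
  using assms
proof (induction p arbitrary: x)
  case Nil
  then show ?case by (simp add: Y1.awalk_Nil_iff Y_grpd_one)
next
  case (Cons e p)
  then have e: "e \<in> arcs Y1" "x = fst e" "Y1.awalk (target e) p z"
    by (auto simp: Y1.awalk_Cons_iff Y1_simps)
  have "arc_elt W S \<Lambda> a \<in> carrier W" if "a \<in> arcs Y1" for a
    using Y1_arc_facts[OF that] by (simp add: Y_grpd_def C_grpd_iff)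
  then have c: "set (rev (map (arc_elt W S \<Lambda>) p)) \<subseteq> carrier W" "arc_elt W S \<Lambda> e \<in> carrier W"
    using e Y1.awalk_def by auto
  have "x \<in> V" "target e \<in> V" "z \<in> V"
    using e(1,2) Y1_arc_facts[OF e(1)] Y1.awalk_last_in_verts[OF e(3)] by (auto simp: Y1_simps)
  then have "word_prod W (rev (map (arc_elt W S \<Lambda>) p)) \<otimes> arc_elt W S \<Lambda> e \<in> Y_grpd W S \<Lambda> z x"
    using Cons.IH[OF e(3)] Y1_arc_facts[OF e(1)] e(2) V_injections
    by (intro Y_grpd_mult[of z \<Lambda> "target e" x]) auto
  then show ?case
    using c word_prod_append[of "rev (map (arc_elt W S \<Lambda>) p)" "[arc_elt W S \<Lambda> e]"] by simp
qed

text \<open>The path exists since the tree spans all vertices, and it is unique since closed reduced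
  walks in the tree are empty. It uses no loops, so it is a product of elements of the groupoid
  Y.\<close>

lemma tree_path_elt_Y:
  assumes T: "maximal_tree W S \<Lambda> xI T" and yz: "y \<in> V" "z \<in> V"
  shows "tree_path_elt W S \<Lambda> xI T z y \<in> Y_grpd W S \<Lambda> z y"
proof -
  have max: "Y1.max_subgraph (undirected_tree reverse) T"
    using T by (simp add: maximal_tree_def)
  have spanning: "verts T = V"
    using Y1.maximal_undirected_tree_spanning[OF max] Y1_walk by (simp add: Y1_simps)
  have sub: "subgraph T Y1" and tree: "undirected_tree reverse T"
    using max by (auto simp: pre_digraph.max_subgraph_def)
  have TG: "arcs T \<subseteq> arcs Y1" "tail T = tail Y1" "head T = head Y1" "wf_digraph T"
    using sub by (auto simp: subgraph_def compatible_def)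
  have revT: "reverse ` arcs T \<subseteq> arcs T"
    using tree by (simp add: undirected_tree_def)
  interpret T: wf_digraph T by (rule TG)
  interpret T: reversible_digraph T reverse
    using TG revT Y1.tail_rev Y1.head_rev Y1.rev_rev by unfold_locales auto
  have "y \<rightarrow>\<^sup>*\<^bsub>T\<^esub> z"
    using tree yz spanning by (auto simp: undirected_tree_def strongly_connected_def)
  then obtain p where "T.awalk y p z"
    using T.reachable_awalk by blast
  then obtain q where q: "T.awalk y q z" "non_backtracking reverse q"
    using T.ex_non_backtracking by blast
  have acyclic: "T.awalk u p u \<Longrightarrow> non_backtracking reverse p \<Longrightarrow> p = []" for u p
    using tree by (simp add: undirected_tree_def)
  have "(THE p. T.awalk y p z \<and> non_backtracking reverse p) = q"
    using q T.non_backtracking_unique[OF acyclic] by (intro the_equality) auto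
  then have "tree_path_elt W S \<Lambda> xI T z y = word_prod W (rev (map (arc_elt W S \<Lambda>) q))"
    by (simp add: tree_path_elt_def Let_def)
  moreover have "Y1.awalk y q z"
    using Y1.subgraph_awalk_imp_awalk[OF q(1) sub] .
  ultimately show ?thesis
    using Y1_walk_elt by simp
qed

end


section \<open>The centralizer\<close>

lemma alpha_neq_minus: "\<alpha> s \<noteq> - \<alpha> t"
proof
  assume "\<alpha> s = - \<alpha> t"
  then have "coef (\<alpha> s) s = coef (- \<alpha> t) s"
    by simp
  then show False
    by (simp add: coef_simple_root split: if_splits)
qed

text \<open>Commuting with j means that the reflections in g \<alpha>_j and \<alpha>_j agree, and
  reflections determine roots up to sign. Questions on the centralizer thus become questions on
  signs.\<close>

lemma centralizer_iff:
  assumes J: "J \<subseteq> S"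
  shows "g \<in> centralizer W (generate W J) \<longleftrightarrow>
    g \<in> carrier W \<and> (\<forall>j\<in>J. g \<bullet> \<alpha> j = \<alpha> j \<or> g \<bullet> \<alpha> j = - \<alpha> j)"
proof
  assume "g \<in> centralizer W (generate W J)"
  then have g: "g \<in> carrier W" "\<And>h. h \<in> generate W J \<Longrightarrow> g \<otimes> h = h \<otimes> g"
    by (auto simp: centralizer_def)
  have "g \<bullet> \<alpha> j = \<alpha> j \<or> g \<bullet> \<alpha> j = - \<alpha> j" if j: "j \<in> J" for j
  proof (rule refl_eq_imp)
    have jS: "j \<in> S" "j \<in> carrier W"
      using j J S_closed by auto
    have "g \<otimes> j = j \<otimes> g"
      using g(2) j by (simp add: generate.incl)
    then have "g \<otimes> j \<otimes> inv g = j"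
      using g(1) jS by (simp add: m_assoc)
    then show "refl (g \<bullet> \<alpha> j) = refl (\<alpha> j)"
      using g(1) jS by (simp add: refl_simple_conj refl_simple)
  qed (use g j J in \<open>auto simp: act_root simple_root_in_roots\<close>)
  with g(1) show "g \<in> carrier W \<and> (\<forall>j\<in>J. g \<bullet> \<alpha> j = \<alpha> j \<or> g \<bullet> \<alpha> j = - \<alpha> j)"
    by blast
next
  assume g: "g \<in> carrier W \<and> (\<forall>j\<in>J. g \<bullet> \<alpha> j = \<alpha> j \<or> g \<bullet> \<alpha> j = - \<alpha> j)"
  have comm: "g \<otimes> j = j \<otimes> g" if "j \<in> J" for j
  proof -
    have jS: "j \<in> S" "j \<in> carrier W"
      using that J S_closed by auto
    have "g \<otimes> j \<otimes> inv g = j"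
      using g that jS by (intro conj_simple_eqI) auto
    then show ?thesis
      using g jS by (metis inv_solve_right' m_closed)
  qed
  have "g \<otimes> h = h \<otimes> g" if "h \<in> generate W J" for h
    using that
  proof (induction rule: generate.induct)
    case (inv h)
    then show ?case
      using comm J by (auto simp: inv_S subset_iff)
  next
    case (eng h1 h2)
    then have c: "g \<in> carrier W" "h1 \<in> carrier W" "h2 \<in> carrier W"
      using g generate_closed[OF J] by auto
    then have "g \<otimes> (h1 \<otimes> h2) = h1 \<otimes> g \<otimes> h2"
      using eng by (simp add: m_assoc[symmetric])
    also have "\<dots> = h1 \<otimes> h2 \<otimes> g"
      using c eng by (simp add: m_assoc)
    finally show ?case .
  qed (use comm g in auto)
  with g show "g \<in> centralizer W (generate W J)"
    by (simp add: centralizer_def)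
qed

lemma center_generate: "J \<subseteq> S \<Longrightarrow>
  center (W\<lparr>carrier := generate W J\<rparr>) = generate W J \<inter> centralizer W (generate W J)"
  using generate_closed by (auto simp: center_def centralizer_def)

lemma subgroup_centralizer:
  assumes J: "J \<subseteq> S"
  shows "subgroup (centralizer W (generate W J)) W"
proof (rule subgroupI)
  show "centralizer W (generate W J) \<subseteq> carrier W"
    by (auto simp: centralizer_def)
  have "\<one> \<in> centralizer W (generate W J)"
    by (simp add: centralizer_iff[OF J])
  then show "centralizer W (generate W J) \<noteq> {}"
    by blast
  show "inv a \<in> centralizer W (generate W J)" if a: "a \<in> centralizer W (generate W J)" for a
  proof -
    have "inv a \<bullet> \<alpha> j = \<alpha> j \<or> inv a \<bullet> \<alpha> j = - \<alpha> j" if "j \<in> J" for j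
    proof -
      have "a \<in> carrier W" "a \<bullet> \<alpha> j = \<alpha> j \<or> a \<bullet> \<alpha> j = - \<alpha> j"
        using a that by (auto simp: centralizer_iff[OF J])
      then show ?thesis
        by (metis act_inv_left act_minus minus_minus)
    qed
    with a show ?thesis by (simp add: centralizer_iff[OF J])
  qed
  show "a \<otimes> b \<in> centralizer W (generate W J)"
    if "a \<in> centralizer W (generate W J)" "b \<in> centralizer W (generate W J)" for a b
  proof -
    have c: "a \<in> carrier W" "b \<in> carrier W"
      and ab: "\<And>j. j \<in> J \<Longrightarrow> a \<bullet> \<alpha> j = \<alpha> j \<or> a \<bullet> \<alpha> j = - \<alpha> j" "\<And>j. j \<in> J \<Longrightarrow> b \<bullet> \<alpha> j = \<alpha> j \<or> b \<bullet> \<alpha> j = - \<alpha> j"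
      using that by (auto simp: centralizer_iff[OF J])
    have "(a \<otimes> b) \<bullet> \<alpha> j = \<alpha> j \<or> (a \<otimes> b) \<bullet> \<alpha> j = - \<alpha> j" if "j \<in> J" for j
      using ab(1)[OF that] ab(2)[OF that] by (elim disjE) (simp_all add: act_mult c act_minus)
    with c show ?thesis
      by (simp add: centralizer_iff[OF J])
  qed
qed

text \<open>By orthogonality w_0(C) and w_0(J - C) fix each other's simple roots, so their product
  reverses all signs on J and must be w_0(J).\<close>

lemma longest_elt_split:
  assumes J: "J \<subseteq> S" "finite_type W J" and C: "C \<subseteq> J"
    and orth: "\<And>c k. c \<in> C \<Longrightarrow> k \<in> J - C \<Longrightarrow> gram W c k = 0" and c: "c \<in> C"
  shows "w0 J \<bullet> \<alpha> c = w0 C \<bullet> \<alpha> c"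
proof -
  have CS: "C \<subseteq> S" "finite_type W C" "J - C \<subseteq> S" "finite_type W (J - C)"
    using J C finite_type_mono[OF J(2)] by auto
  have cl: "w0 C \<in> carrier W" "w0 (J - C) \<in> carrier W"
    using CS longest_elt_closed by auto
  have fix1: "w0 (J - C) \<bullet> \<alpha> j = \<alpha> j" if "j \<in> C" for j
    using that CS orth by (intro parabolic_fix_simple[OF CS(3) longest_elt_in[OF CS(3,4)]]) auto
  have fix2: "w0 C \<bullet> \<alpha> j = \<alpha> j" if "j \<in> J - C" for j
    using that CS orth gram_commute
    by (intro parabolic_fix_simple[OF CS(1) longest_elt_in[OF CS(1,2)]]) (auto simp: subset_iff)
  have "w0 J = w0 C \<otimes> w0 (J - C)"
  proof (rule longest_elt_eqI[OF J])
    have "generate W C \<subseteq> generate W J" "generate W (J - C) \<subseteq> generate W J"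
      using C by (auto intro!: mono_generate)
    then show "w0 C \<otimes> w0 (J - C) \<in> generate W J"
      using longest_elt_in[OF CS(1,2)] longest_elt_in[OF CS(3,4)] by (auto intro: generate.eng)
    show "(w0 C \<otimes> w0 (J - C)) \<bullet> \<alpha> j \<notin> \<Phi>p" if j: "j \<in> J" for j
    proof (cases "j \<in> C")
      case True
      then show ?thesis
        using longest_elt_neg[OF CS(1,2)] cl fix1 by (simp add: act_mult)
    next
      case False
      then obtain k where k: "k \<in> J - C" "w0 (J - C) \<bullet> \<alpha> j = - \<alpha> k"
        using longest_elt_simple[OF CS(3,4), of j] j by blast
      then have "(w0 C \<otimes> w0 (J - C)) \<bullet> \<alpha> j = - \<alpha> k"
        using cl fix2 by (simp add: act_mult act_minus)
      then show ?thesis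
        using k CS(3) pos_root_not_neg simple_root_pos by fastforce
    qed
  qed
  then show ?thesis
    using cl fix1[OF c] by (simp add: act_mult)
qed

lemma minus_one_type_act:
  assumes "C \<subseteq> S" "minus_one_type W S C" "c \<in> C"
  shows "w0 C \<bullet> \<alpha> c = - \<alpha> c"
proof -
  have fin: "finite_type W C" and "w0 C \<in> centralizer W (generate W C)"
    using assms by (auto simp: minus_one_type_def center_generate)
  then have "w0 C \<bullet> \<alpha> c = \<alpha> c \<or> w0 C \<bullet> \<alpha> c = - \<alpha> c"
    using assms by (auto simp: centralizer_iff)
  moreover have "w0 C \<bullet> \<alpha> c \<noteq> \<alpha> c"
    using longest_elt_neg[OF assms(1) fin assms(3)] simple_root_pos assms by auto
  ultimately show ?thesis by blast
qed

lemma minus_one_typeI: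
  assumes "C \<subseteq> S" "irreducible_subset W C" "finite_type W C" "\<And>c. c \<in> C \<Longrightarrow> w0 C \<bullet> \<alpha> c = - \<alpha> c"
  shows "minus_one_type W S C"
  using assms longest_elt_in[OF assms(1,3)] longest_elt_closed[OF assms(1,3)]
  by (simp add: minus_one_type_def center_generate centralizer_iff)

text \<open>If the signs at j and k differed, the invariance of the form would force <\<alpha>_j,
  \<alpha>_k> = 0, but this value is negative for adjacent vertices.\<close>

lemma centralizer_sign_adj:
  assumes I: "I \<subseteq> S" and w: "w \<in> centralizer W (generate W I)"
    and jk: "(j, k) \<in> cox_adj W I" "w \<bullet> \<alpha> j = - \<alpha> j"
  shows "w \<bullet> \<alpha> k = - \<alpha> k"
proof (rule ccontr)
  assume "w \<bullet> \<alpha> k \<noteq> - \<alpha> k"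
  moreover have jkI: "j \<in> I" "k \<in> I"
    using jk by (auto simp: cox_adj_def)
  ultimately have "w \<bullet> \<alpha> k = \<alpha> k" "w \<in> carrier W"
    using w by (auto simp: centralizer_iff[OF I])
  moreover from this have "vform W (w \<bullet> \<alpha> j) (w \<bullet> \<alpha> k) = vform W (\<alpha> j) (\<alpha> k)"
    using jkI I by (intro vform_act) auto
  ultimately show False
    using jk(2) gram_adj[OF I jk(1)] by (simp add: vform_bilinear vform_simple_root)
qed

lemma centralizer_sign_component:
  assumes I: "I \<subseteq> S" and w: "w \<in> centralizer W (generate W I)"
    and C: "C \<in> irreducible_components W I" "j \<in> C" "k \<in> C" and j: "w \<bullet> \<alpha> j = - \<alpha> j"
  shows "w \<bullet> \<alpha> k = - \<alpha> k"
proof -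
  have "(j, k) \<in> (cox_adj W I)\<^sup>*"
    using component_eq[OF I C(1,2)] C(3) by auto
  then show ?thesis
    by (induction rule: rtrancl_induct) (use j centralizer_sign_adj[OF I w] in auto)
qed

lemma orthogonal_union_components:
  assumes I: "I \<subseteq> S" and \<K>: "\<K> \<subseteq> irreducible_components W I"
    and "i \<in> I" "i \<notin> \<Union>\<K>" "j \<in> \<Union>\<K>"
  shows "gram W i j = 0"
  using assms component_orthogonal[OF I] by blast


section \<open>The reflection subgroup orthogonal to a parabolic subgroup\<close>

lemma root_subsystem_perp_roots:
  assumes I: "I \<subseteq> S"
  shows "root_subsystem (perp_roots W S I)"
  unfolding root_subsystem_def
proof (intro conjI ballI subsetI)
  fix \<gamma> \<delta>
  assume gd: "\<gamma> \<in> perp_roots W S I" "\<delta> \<in> perp_roots W S I"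
  then have "refl \<gamma> \<bullet> \<delta> = \<delta> - vscale (2 * vform W \<gamma> \<delta>) \<gamma>"
    using perp_rootsD supp_root by (simp add: refl_act)
  moreover have "refl \<gamma> \<bullet> \<delta> \<in> \<Phi>"
    using gd perp_rootsD by (simp add: act_root refl_closed)
  ultimately show "refl \<gamma> \<bullet> \<delta> \<in> perp_roots W S I"
    using gd by (simp add: perp_roots_def vform_bilinear)
qed (auto dest: perp_rootsD)

lemma refl_perp_fix:
  assumes "I \<subseteq> S" "\<gamma> \<in> perp_roots W S I" "i \<in> I"
  shows "refl \<gamma> \<bullet> \<alpha> i = \<alpha> i"
proof -
  have "\<gamma> \<in> \<Phi>" "vform W \<gamma> (\<alpha> i) = 0" "i \<in> S"
    using assms perp_rootsD by auto
  then show ?thesis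
    by (intro poly_mapping_eqI) (simp add: refl_act lookup_minus)
qed

lemma W_perp_fix:
  assumes I: "I \<subseteq> S" and u: "u \<in> W_perp W S I"
  shows "u \<in> carrier W" "i \<in> I \<Longrightarrow> u \<bullet> \<alpha> i = \<alpha> i"
proof -
  have sub: "perp_roots W S I \<subseteq> \<Phi>"
    by (auto dest: perp_rootsD)
  have c: "h \<in> carrier W" if "h \<in> generate W (refl ` perp_roots W S I)" for h
    using that generate_in_carrier[OF refl_image_closed[OF sub]] by blast
  then show "u \<in> carrier W"
    using u by (simp add: W_perp_def)
  show "u \<bullet> \<alpha> i = \<alpha> i" if "i \<in> I"
    using u unfolding W_perp_def
  proof (induction rule: generate.induct)
    case (incl h)
    then show ?case using refl_perp_fix[OF I _ that] by auto
  next
    case (inv h)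
    then show ?case using refl_perp_fix[OF I _ that] sub by (auto simp: inv_refl)
  next
    case (eng h1 h2)
    then show ?case by (simp add: act_mult c)
  qed simp
qed

lemma W_perp_subset_centralizer: "I \<subseteq> S \<Longrightarrow> W_perp W S I \<subseteq> centralizer W (generate W I)"
  using W_perp_fix by (auto simp: centralizer_iff)

lemma subgroup_W_perp: "subgroup (W_perp W S I) W"
  unfolding W_perp_def by (intro generate_is_subgroup refl_image_closed) (auto dest: perp_rootsD)

lemma centralizer_perp_roots:
  assumes I: "I \<subseteq> S" and w: "w \<in> centralizer W (generate W I)" and g: "\<gamma> \<in> perp_roots W S I"
  shows "w \<bullet> \<gamma> \<in> perp_roots W S I"
  using w I by (intro act_perp_roots[OF _ I I _ g]) (auto simp: centralizer_iff[OF I])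

lemma W_perp_conj:
  assumes I: "I \<subseteq> S" and w: "w \<in> centralizer W (generate W I)" and u: "u \<in> W_perp W S I"
  shows "w \<otimes> u \<otimes> inv w \<in> W_perp W S I"
proof -
  have wc: "w \<in> carrier W"
    using w by (simp add: centralizer_def)
  have sub: "perp_roots W S I \<subseteq> \<Phi>"
    by (auto dest: perp_rootsD)
  have r: "w \<otimes> refl \<gamma> \<otimes> inv w \<in> refl ` perp_roots W S I" if "\<gamma> \<in> perp_roots W S I" for \<gamma>
  proof -
    have "w \<otimes> refl \<gamma> \<otimes> inv w = refl (w \<bullet> \<gamma>)"
      using refl_conj[OF wc, of \<gamma>] that sub by auto
    then show ?thesis
      using centralizer_perp_roots[OF I w that] by simp
  qed
  then have "w \<otimes> h \<otimes> inv w \<in> generate W (refl ` perp_roots W S I)"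
    if "h \<in> refl ` perp_roots W S I" for h
    using that by (auto intro: generate.incl)
  then show ?thesis
    using u unfolding W_perp_def
    by (rule generate_conj[OF wc refl_image_closed[OF sub] refl_image_closed[OF sub]])
qed

text \<open>The inclusion already gives equality: if the inverse of w made \<gamma> negative, the
  opposite of the image would be a positive orthogonal root that w sends to -\<gamma>.\<close>

lemma B_tilde_iff:
  assumes I: "I \<subseteq> S"
  shows "w \<in> B_tilde W S I \<longleftrightarrow> w \<in> centralizer W (generate W I) \<and> (\<forall>\<gamma>\<in>pos_perp_roots W S I. w \<bullet> \<gamma> \<in> \<Phi>p)"
proof
  assume "w \<in> centralizer W (generate W I) \<and> (\<forall>\<gamma>\<in>pos_perp_roots W S I. w \<bullet> \<gamma> \<in> \<Phi>p)"
  then have w: "w \<in> centralizer W (generate W I)" "\<And>\<gamma>. \<gamma> \<in> pos_perp_roots W S I \<Longrightarrow> w \<bullet> \<gamma> \<in> \<Phi>p"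
    by auto
  have wc: "w \<in> carrier W"
    using w by (simp add: centralizer_def)
  have iw: "inv w \<in> centralizer W (generate W I)"
    using subgroup.m_inv_closed[OF subgroup_centralizer[OF I] w(1)] .
  have "act W S w ` pos_perp_roots W S I \<subseteq> pos_perp_roots W S I"
    using w centralizer_perp_roots[OF I w(1)] by (auto simp: pos_perp_roots_def)
  moreover have "\<gamma> \<in> act W S w ` pos_perp_roots W S I" if g: "\<gamma> \<in> pos_perp_roots W S I" for \<gamma>
  proof (rule image_eqI)
    show "\<gamma> = w \<bullet> inv w \<bullet> \<gamma>"
      using wc by simp
    have p: "inv w \<bullet> \<gamma> \<in> perp_roots W S I"
      using centralizer_perp_roots[OF I iw] g by (simp add: pos_perp_roots_def)
    have "inv w \<bullet> \<gamma> \<in> \<Phi>p"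
    proof (rule ccontr)
      assume "inv w \<bullet> \<gamma> \<notin> \<Phi>p"
      then have "- (inv w \<bullet> \<gamma>) \<in> pos_perp_roots W S I"
        using p neg_root_iff perp_rootsD root_subsystem_minus[OF root_subsystem_perp_roots[OF I]]
        by (auto simp: pos_perp_roots_def)
      from w(2)[OF this] have "- \<gamma> \<in> \<Phi>p"
        using wc by (simp add: act_minus)
      then show False
        using g pos_root_not_neg by (simp add: pos_perp_roots_def)
    qed
    with p show "inv w \<bullet> \<gamma> \<in> pos_perp_roots W S I"
      by (simp add: pos_perp_roots_def)
  qed
  ultimately show "w \<in> B_tilde W S I"
    using w by (auto simp: B_tilde_def)
qed (auto simp: B_tilde_def pos_perp_roots_def)

lemma subgroup_B_tilde:
  assumes I: "I \<subseteq> S"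
  shows "subgroup (B_tilde W S I) W"
proof (rule subgroupI)
  note ZW = subgroup_centralizer[OF I]
  have c: "w \<in> carrier W" if "w \<in> B_tilde W S I" for w
    using that by (simp add: B_tilde_def centralizer_def)
  then show "B_tilde W S I \<subseteq> carrier W"
    by blast
  have "\<one> \<in> B_tilde W S I"
    using subgroup.one_closed[OF ZW] by (auto simp: B_tilde_iff[OF I] pos_perp_roots_def)
  then show "B_tilde W S I \<noteq> {}"
    by blast
  show "inv a \<in> B_tilde W S I" if a: "a \<in> B_tilde W S I" for a
  proof -
    have "act W S (inv a) ` act W S a ` pos_perp_roots W S I = pos_perp_roots W S I"
      using c[OF a] by (simp add: image_image)
    then have "act W S (inv a) ` pos_perp_roots W S I = pos_perp_roots W S I"
      using a by (simp add: B_tilde_def)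
    then show ?thesis
      using a subgroup.m_inv_closed[OF ZW] by (simp add: B_tilde_def)
  qed
  show "a \<otimes> b \<in> B_tilde W S I" if ab: "a \<in> B_tilde W S I" "b \<in> B_tilde W S I" for a b
  proof -
    have "act W S (a \<otimes> b) ` pos_perp_roots W S I = act W S a ` act W S b ` pos_perp_roots W S I"
      using c ab by (simp add: image_image act_mult)
    then show ?thesis
      using ab subgroup.m_closed[OF ZW] by (simp add: B_tilde_def)
  qed
qed

lemma W_perp_Int_B_tilde:
  assumes I: "I \<subseteq> S"
  shows "W_perp W S I \<inter> B_tilde W S I = {\<one>}"
proof
  show "{\<one>} \<subseteq> W_perp W S I \<inter> B_tilde W S I"
    using subgroup.one_closed[OF subgroup_W_perp] subgroup.one_closed[OF subgroup_B_tilde[OF I]] by simp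
  show "W_perp W S I \<inter> B_tilde W S I \<subseteq> {\<one>}"
    using reflection_subgroup_pos_imp_one[OF root_subsystem_perp_roots[OF I]]
    by (auto simp: B_tilde_iff[OF I] W_perp_def pos_perp_roots_def)
qed

lemma centralizer_decomposition:
  assumes I: "I \<subseteq> S" and w: "w \<in> centralizer W (generate W I)"
  obtains u b where "u \<in> W_perp W S I" "b \<in> B_tilde W S I" "w = u \<otimes> b"
proof -
  note ZW = subgroup_centralizer[OF I]
  have wc: "w \<in> carrier W"
    using w by (simp add: centralizer_def)
  have sub: "perp_roots W S I \<subseteq> \<Phi>"
    by (auto dest: perp_rootsD)
  obtain u where u: "u \<in> W_perp W S I" "\<And>\<gamma>. \<gamma> \<in> perp_roots W S I \<inter> \<Phi>p \<Longrightarrow> (w \<otimes> u) \<bullet> \<gamma> \<in> \<Phi>p"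
    using ex_coset_minimal[OF sub wc] unfolding W_perp_def by blast
  have uZ: "u \<in> centralizer W (generate W I)" and uc: "u \<in> carrier W"
    using u W_perp_subset_centralizer[OF I] W_perp_fix[OF I] by auto
  have b: "w \<otimes> u \<in> B_tilde W S I"
    using u subgroup.m_closed[OF ZW w uZ] by (simp add: B_tilde_iff[OF I] pos_perp_roots_def)
  \<comment> \<open>The minimal coset element has the form w u, with the reflection part on the
    right; conjugation by w moves this part to the left.\<close>
  have "w \<otimes> inv u \<otimes> inv w \<in> W_perp W S I"
    using u(1) subgroup.m_inv_closed[OF subgroup_W_perp] W_perp_conj[OF I w] by blast
  moreover have "w = (w \<otimes> inv u \<otimes> inv w) \<otimes> (w \<otimes> u)"
    using wc uc by (simp add: m_assoc inv_cancel_left)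
  ultimately show thesis
    using b that by blast
qed

text \<open>Conjugation by b corresponds to the action of b on roots. This is linear and permutes
  the positive orthogonal roots, so it permutes the indecomposable ones among them.\<close>

lemma R_perp_conj:
  assumes I: "I \<subseteq> S" and b: "b \<in> B_tilde W S I"
  shows "(\<lambda>w. b \<otimes> w \<otimes> inv b) ` R_perp W S I = R_perp W S I"
proof -
  define P where "P = {\<gamma> \<in> pos_perp_roots W S I.
        \<forall>(n::nat) c \<beta>. (\<forall>i<n. 0 < c i \<and> \<beta> i \<in> pos_perp_roots W S I) \<and>
            \<gamma> = (\<Sum>i<n. vscale (c i) (\<beta> i))
          \<longrightarrow> (\<forall>i<n. \<beta> i = \<gamma>)}"
  have R: "R_perp W S I = refl ` P"
    by (simp add: R_perp_def P_def)
  have step: "a \<bullet> \<gamma> \<in> P" if a: "a \<in> B_tilde W S I" and g: "\<gamma> \<in> P" for a \<gamma>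
  proof -
    have ac: "a \<in> carrier W"
      using a by (simp add: B_tilde_def centralizer_def)
    have ia: "inv a \<in> B_tilde W S I"
      using subgroup.m_inv_closed[OF subgroup_B_tilde[OF I] a] .
    have pos: "a \<bullet> \<gamma> \<in> pos_perp_roots W S I"
      using a g unfolding B_tilde_def P_def by blast
    have indec: "\<forall>i<n. \<beta> i = \<gamma>"
      if "\<forall>i<n. 0 < c i \<and> \<beta> i \<in> pos_perp_roots W S I" "\<gamma> = (\<Sum>i<n. vscale (c i) (\<beta> i))"
      for n :: nat and c \<beta>
      using g that unfolding P_def by blast
    have "\<beta> i = a \<bullet> \<gamma>"
      if h: "\<forall>i<n. 0 < c i \<and> \<beta> i \<in> pos_perp_roots W S I" "a \<bullet> \<gamma> = (\<Sum>i<n. vscale (c i) (\<beta> i))" "i < n"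
      for n :: nat and c \<beta> i
    proof -
      have "inv a \<bullet> a \<bullet> \<gamma> = (\<Sum>i<n. vscale (c i) (inv a \<bullet> \<beta> i))"
        unfolding h(2) by (simp add: act_sum act_scale)
      then have "\<gamma> = (\<Sum>i<n. vscale (c i) (inv a \<bullet> \<beta> i))"
        using ac by simp
      moreover have "\<forall>i<n. 0 < c i \<and> inv a \<bullet> \<beta> i \<in> pos_perp_roots W S I"
        using h(1) ia unfolding B_tilde_def by blast
      ultimately have "\<forall>i<n. inv a \<bullet> \<beta> i = \<gamma>"
        using indec[of n c "\<lambda>i. inv a \<bullet> \<beta> i"] by blast
      then show ?thesis
        using h(3) ac by (metis act_inv_right)
    qed
    with pos show ?thesis
      unfolding P_def mem_Collect_eq by blast
  qed
  have bc: "b \<in> carrier W"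
    using b by (simp add: B_tilde_def centralizer_def)
  have ib: "inv b \<in> B_tilde W S I"
    using subgroup.m_inv_closed[OF subgroup_B_tilde[OF I] b] .
  have PR: "\<gamma> \<in> \<Phi>" if "\<gamma> \<in> P" for \<gamma>
    using that by (auto simp: P_def pos_perp_roots_def pos_root_in_roots)
  have bP: "act W S b ` P = P"
  proof
    show "P \<subseteq> act W S b ` P"
      using step[OF ib] bc by (metis act_inv_right image_eqI subsetI)
  qed (use step[OF b] in blast)
  have "(\<lambda>w. b \<otimes> w \<otimes> inv b) ` refl ` P = refl ` act W S b ` P"
    unfolding image_image using refl_conj[OF bc] PR by (intro image_cong) simp_all
  then show ?thesis
    unfolding R bP .
qed

end


section \<open>The homomorphism to the groups of subsets\<close>

lemma (in group) normal_in_subgroupI: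
  assumes N: "subgroup N G" and H: "subgroup H G" "N \<subseteq> H"
    and conj: "\<And>h n. h \<in> H \<Longrightarrow> n \<in> N \<Longrightarrow> h \<otimes> n \<otimes> inv h \<in> N"
  shows "N \<lhd> G\<lparr>carrier := H\<rparr>"
proof -
  interpret H: group "G\<lparr>carrier := H\<rparr>"
    using H(1) by (rule subgroup.subgroup_is_group) (rule group_axioms)
  have "subgroup N (G\<lparr>carrier := H\<rparr>)"
    using N H by (intro subgroup_incl)
  then show ?thesis
    using conj m_inv_consistent[OF H(1)] by (subst H.normal_inv_iff) auto
qed

context coxeter
begin

context
  fixes \<Lambda> :: "'l set" and xI :: "'l \<Rightarrow> 'a"
  assumes xI: "xI \<in> injections \<Lambda> S"
begin

abbreviation "I \<equiv> xI ` \<Lambda>"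
abbreviation "ZW \<equiv> centralizer W (generate W I)"
abbreviation "Z \<equiv> center (W\<lparr>carrier := generate W I\<rparr>)"
abbreviation "sgn_set \<equiv> A_map W S \<Lambda> xI"
abbreviation "B \<equiv> B_group W S \<Lambda> xI"

lemma I_subset: "I \<subseteq> S"
  using injections_image[OF xI] .

lemma ZW_closed: "w \<in> ZW \<Longrightarrow> w \<in> carrier W"
  by (simp add: centralizer_def)

lemma ZW_act:
  assumes "w \<in> ZW" "l \<in> \<Lambda>"
  shows "w \<bullet> \<alpha> (xI l) = (if l \<in> sgn_set w then - \<alpha> (xI l) else \<alpha> (xI l))"
  using assms by (auto simp: centralizer_iff[OF I_subset] A_map_def)

lemma sgn_set_subset: "sgn_set w \<subseteq> \<Lambda>"
  by (auto simp: A_map_def)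

lemma sgn_set_mult:
  assumes "v \<in> ZW" "w \<in> ZW"
  shows "sgn_set (v \<otimes> w) = sym_diff (sgn_set v) (sgn_set w)"
proof (rule Set.set_eqI)
  fix l
  show "l \<in> sgn_set (v \<otimes> w) \<longleftrightarrow> l \<in> sym_diff (sgn_set v) (sgn_set w)"
  proof (cases "l \<in> \<Lambda>")
    case True
    have "(v \<otimes> w) \<bullet> \<alpha> (xI l) = v \<bullet> w \<bullet> \<alpha> (xI l)"
      using assms ZW_closed by (simp add: act_mult)
    then have "l \<in> sgn_set (v \<otimes> w) \<longleftrightarrow> v \<bullet> w \<bullet> \<alpha> (xI l) = - \<alpha> (xI l)"
      using True by (simp add: A_map_def)
    then show ?thesis
      using ZW_act[OF assms(1) True] ZW_act[OF assms(2) True] alpha_neq_minus[of "xI l" "xI l"]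
      by (auto simp: act_minus)
  qed (use sgn_set_subset in blast)
qed

lemma sgn_set_one: "sgn_set \<one> = {}"
  using alpha_neq_minus by (auto simp: A_map_def)

lemma sgn_set_inv:
  assumes "w \<in> ZW"
  shows "sgn_set (inv w) = sgn_set w"
proof -
  have "inv w \<in> ZW"
    using subgroup.m_inv_closed[OF subgroup_centralizer[OF I_subset] assms] .
  then have "sym_diff (sgn_set w) (sgn_set (inv w)) = {}"
    using sgn_set_mult[OF assms, of "inv w"] sgn_set_one r_inv[OF ZW_closed[OF assms]] by metis
  then show ?thesis by blast
qed

text \<open>These are the conditions for \<open>A_tilde\<close> apart from \<open>x_conj\<close>
  being a vertex. They suffice to describe \<open>x_conj\<close> and can be checked without the
  groupoid.\<close>

definition component_closed :: "'l set \<Rightarrow> bool" where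
  "component_closed A \<longleftrightarrow> A \<subseteq> \<Lambda> \<and> finite_type W (xI ` A) \<and>
    (\<exists>\<K> \<subseteq> irreducible_components W I. xI ` A = \<Union>\<K>)"

lemma A_tilde_iff:
  "A \<in> A_tilde W S \<Lambda> xI \<longleftrightarrow> component_closed A \<and> x_conj W S \<Lambda> xI A \<in> C_verts W S \<Lambda> xI"
  by (auto simp: A_tilde_def component_closed_def)

text \<open>The type is finite because w makes all these simple roots negative, and whole components
  occur because the sign is constant along the edges of the Coxeter graph.\<close>

lemma sgn_set_component_closed:
  assumes w: "w \<in> ZW"
  shows "component_closed (sgn_set w)"
proof -
  let ?J = "xI ` sgn_set w"
  have J: "?J \<subseteq> I" "?J \<subseteq> S"
    using sgn_set_subset I_subset by auto
  have mem: "j \<in> ?J \<longleftrightarrow> w \<bullet> \<alpha> j = - \<alpha> j" if "j \<in> I" for j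
    using that by (auto simp: A_map_def)
  have "finite_type W ?J"
  proof (rule finite_type_if_neg[OF ZW_closed[OF w] J(2)])
    show "w \<bullet> \<alpha> j \<notin> \<Phi>p" if "j \<in> ?J" for j
    proof -
      have "w \<bullet> \<alpha> j = - \<alpha> j" "j \<in> S"
        using that J mem by auto
      then show ?thesis
        using pos_root_not_neg[OF simple_root_pos] by simp
    qed
  qed
  moreover have "?J = \<Union>{C \<in> irreducible_components W I. C \<subseteq> ?J}"
  proof
    show "?J \<subseteq> \<Union>{C \<in> irreducible_components W I. C \<subseteq> ?J}"
    proof
      fix j
      assume j: "j \<in> ?J"
      then have jI: "j \<in> I"
        using J by blast
      define C where "C = (cox_adj W I)\<^sup>* `` {j}"
      have C: "C \<in> irreducible_components W I" "j \<in> C"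
        using jI by (auto simp: components_iff C_def)
      have "C \<subseteq> ?J"
      proof
        fix k
        assume k: "k \<in> C"
        then have "w \<bullet> \<alpha> k = - \<alpha> k"
          using centralizer_sign_component[OF I_subset w C k] mem[OF jI] j by blast
        then show "k \<in> ?J"
          using mem component_subset[OF C(1)] k by blast
      qed
      with C show "j \<in> \<Union>{C \<in> irreducible_components W I. C \<subseteq> ?J}"
        by blast
    qed
  qed blast
  ultimately show ?thesis
    unfolding component_closed_def using sgn_set_subset
    by (intro conjI exI[of _ "{C \<in> irreducible_components W I. C \<subseteq> ?J}"]) auto
qed

lemma x_conj_facts:
  assumes A: "component_closed A"
  shows x_conj_act: "l \<in> \<Lambda> \<Longrightarrow> w0 (xI ` A) \<bullet> \<alpha> (xI l) =
        (if l \<in> A then - \<alpha> (x_conj W S \<Lambda> xI A l) else \<alpha> (x_conj W S \<Lambda> xI A l))"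
    and x_conj_injections: "x_conj W S \<Lambda> xI A \<in> injections \<Lambda> S"
    and x_conj_image: "x_conj W S \<Lambda> xI A ` \<Lambda> = I"
    and longest_A_closed: "w0 (xI ` A) \<in> carrier W"
    and longest_A_perp: "\<gamma> \<in> perp_roots W S I \<Longrightarrow> w0 (xI ` A) \<bullet> \<gamma> = \<gamma>"
proof -
  let ?J = "xI ` A" and ?x = "x_conj W S \<Lambda> xI A"
  obtain \<K> where A': "A \<subseteq> \<Lambda>" "finite_type W ?J" "\<K> \<subseteq> irreducible_components W I" "?J = \<Union>\<K>"
    using A by (auto simp: component_closed_def)
  have JI: "?J \<subseteq> I"
    using A'(1) by blast
  then have J: "?J \<subseteq> S"
    using I_subset by (rule subset_trans)
  have inj: "inj_on xI \<Lambda>"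
    using xI by (simp add: injections_def)
  have mem: "xI l \<in> ?J \<longleftrightarrow> l \<in> A" if "l \<in> \<Lambda>" for l
    using inj_on_image_mem_iff[OF inj that A'(1)] .
  show c: "w0 ?J \<in> carrier W"
    using longest_elt_closed[OF J A'(2)] .
  note inW = longest_elt_in[OF J A'(2)]
  have conj: "?x l = w0 ?J \<otimes> xI l \<otimes> inv (w0 ?J)" if "l \<in> \<Lambda>" for l
    using that by (simp add: x_conj_def inv_longest_elt[OF J A'(2)])
  have out: "w0 ?J \<bullet> \<alpha> (xI l) = \<alpha> (xI l) \<and> ?x l = xI l" if l: "l \<in> \<Lambda>" "l \<notin> A" for l
  proof -
    have S: "xI l \<in> S"
      using injections_in[OF xI l(1)] .
    have fix_l: "w0 ?J \<bullet> \<alpha> (xI l) = \<alpha> (xI l)"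
      using orthogonal_union_components[OF I_subset A'(3)] l mem[OF l(1)] A'(4) S
      by (intro parabolic_fix_simple[OF J inW]) auto
    then have "w0 ?J \<otimes> xI l \<otimes> inv (w0 ?J) = xI l"
      using c S by (intro conj_simple_eqI) auto
    with fix_l show ?thesis
      using conj[OF l(1)] by simp
  qed
  have ins: "\<exists>k\<in>?J. w0 ?J \<bullet> \<alpha> (xI l) = - \<alpha> k \<and> ?x l = k" if l: "l \<in> A" for l
  proof -
    have lL: "l \<in> \<Lambda>" and S: "xI l \<in> S"
      using l A'(1) injections_in[OF xI] by auto
    obtain k where k: "k \<in> ?J" "w0 ?J \<bullet> \<alpha> (xI l) = - \<alpha> k"
      using longest_elt_simple[OF J A'(2), of "xI l"] l by blast
    then have "w0 ?J \<otimes> xI l \<otimes> inv (w0 ?J) = k"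
      using c S J by (intro conj_simple_eqI) auto
    with k show ?thesis
      using conj[OF lL] by auto
  qed
  show act: "w0 ?J \<bullet> \<alpha> (xI l) = (if l \<in> A then - \<alpha> (?x l) else \<alpha> (?x l))" if "l \<in> \<Lambda>" for l
    using out[OF that] ins[of l] by auto
  have sub: "?x l \<in> I" if "l \<in> \<Lambda>" for l
    using out[OF that] ins[of l] JI that by (cases "l \<in> A") auto
  show "?x \<in> injections \<Lambda> S"
    unfolding injections_def
  proof (intro CollectI conjI)
    show "?x \<in> \<Lambda> \<rightarrow>\<^sub>E S"
      using sub I_subset by (auto simp: x_conj_def)
    show "inj_on ?x \<Lambda>"
    proof (rule inj_onI)
      fix l m
      assume lm: "l \<in> \<Lambda>" "m \<in> \<Lambda>" "?x l = ?x m"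
      then have "w0 ?J \<otimes> xI l \<otimes> inv (w0 ?J) = w0 ?J \<otimes> xI m \<otimes> inv (w0 ?J)"
        using conj by simp
      then have "xI l = xI m"
        using c lm injections_in[OF xI] by (simp add: S_closed)
      then show "l = m"
        using inj lm by (auto dest: inj_onD)
    qed
  qed
  show "?x ` \<Lambda> = I"
  proof
    show "I \<subseteq> ?x ` \<Lambda>"
    proof
      fix i
      assume "i \<in> I"
      then obtain l where l: "l \<in> \<Lambda>" "i = xI l"
        by blast
      show "i \<in> ?x ` \<Lambda>"
      proof (cases "l \<in> A")
        case False
        then show ?thesis using out[OF l(1)] l by force
      next
        case True
        obtain m where m: "m \<in> A" "w0 ?J \<bullet> \<alpha> (xI l) = - \<alpha> (xI m)"
          using ins[OF True] by blast
        have "w0 ?J \<bullet> \<alpha> (xI m) = - (w0 ?J \<bullet> w0 ?J \<bullet> \<alpha> (xI l))"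
          using m by (simp add: act_minus)
        then have "w0 ?J \<bullet> \<alpha> (xI m) = - \<alpha> (xI l)"
          using longest_elt_act_twice[OF J A'(2)] by simp
        moreover have "w0 ?J \<bullet> \<alpha> (xI m) = - \<alpha> (?x m)"
          using ins[OF m(1)] by auto
        ultimately have "?x m = i"
          using l by simp
        then show ?thesis
          using m A' by blast
      qed
    qed
  qed (use sub in blast)
  show "w0 ?J \<bullet> \<gamma> = \<gamma>" if "\<gamma> \<in> perp_roots W S I"
    using perp_rootsD[OF that] supp_root JI by (intro parabolic_fix[OF J inW]) auto
qed

text \<open>The longest element of the negated part cancels the signs of w. The product is then an
  element of the groupoid from \<open>xI\<close> to \<open>x_conj\<close>, which is thereby a
  vertex.\<close>

lemma sgn_set_in_A_tilde:
  assumes w: "w \<in> ZW"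
  shows "sgn_set w \<in> A_tilde W S \<Lambda> xI"
proof -
  note A = sgn_set_component_closed[OF w]
  let ?x = "x_conj W S \<Lambda> xI (sgn_set w)" and ?u = "w0 (xI ` sgn_set w)"
  have "(?u \<otimes> w) \<bullet> \<alpha> (xI l) = \<alpha> (?x l)" if "l \<in> \<Lambda>" for l
    using ZW_act[OF w that] x_conj_act[OF A that] ZW_closed[OF w] longest_A_closed[OF A]
    by (simp add: act_mult act_minus)
  then have "?u \<otimes> w \<in> C_grpd W S \<Lambda> ?x xI"
    using ZW_closed[OF w] longest_A_closed[OF A] by (simp add: C_grpd_iff)
  then have "?x \<in> C_verts W S \<Lambda> xI"
    using x_conj_injections[OF A] by (auto simp: C_verts_def)
  then show ?thesis
    using A by (simp add: A_tilde_iff)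
qed

text \<open>The longest element produces the signs on A but may permute I; the tree path undoes the
  permutation without signs. On roots orthogonal to I the longest element is trivial, and the path,
  lying in Y, preserves positivity.\<close>

lemma g_elt_facts:
  assumes T: "maximal_tree W S \<Lambda> xI T" and A: "A \<in> A_tilde W S \<Lambda> xI"
  shows g_elt_B_tilde: "g_elt W S \<Lambda> xI T A \<in> B_tilde W S I"
    and sgn_set_g_elt: "sgn_set (g_elt W S \<Lambda> xI T A) = A"
proof -
  let ?x = "x_conj W S \<Lambda> xI A" and ?u = "w0 (xI ` A)" and ?g = "g_elt W S \<Lambda> xI T A"
  have cl: "component_closed A" and V: "?x \<in> C_verts W S \<Lambda> xI"
    using A by (auto simp: A_tilde_iff)
  have AL: "A \<subseteq> \<Lambda>"
    using cl by (simp add: component_closed_def)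
  define p where "p = tree_path_elt W S \<Lambda> xI T xI ?x"
  have p: "p \<in> Y_grpd W S \<Lambda> xI ?x"
    unfolding p_def by (rule tree_path_elt_Y[OF xI T V xI_in_V[OF xI]])
  then have pC: "p \<in> carrier W" "\<And>l. l \<in> \<Lambda> \<Longrightarrow> p \<bullet> \<alpha> (?x l) = \<alpha> (xI l)"
    by (auto simp: Y_grpd_def C_grpd_iff)
  have g: "?g = p \<otimes> ?u"
    by (simp add: g_elt_def p_def)
  have uc: "?u \<in> carrier W"
    by (rule longest_A_closed[OF cl])
  have act: "?g \<bullet> \<alpha> (xI l) = (if l \<in> A then - \<alpha> (xI l) else \<alpha> (xI l))" if "l \<in> \<Lambda>" for l
    using x_conj_act[OF cl that] pC(2)[OF that] uc pC(1) by (simp add: g act_mult act_minus)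
  then show "sgn_set ?g = A"
    using AL by (auto simp: A_map_def alpha_neq_minus split: if_splits)
  have "?g \<in> ZW"
    using act uc pC(1) by (auto simp: centralizer_iff[OF I_subset] g)
  moreover have "?g \<bullet> \<gamma> \<in> \<Phi>p" if "\<gamma> \<in> pos_perp_roots W S I" for \<gamma>
  proof -
    have "?g \<bullet> \<gamma> = p \<bullet> \<gamma>"
      using longest_A_perp[OF cl, of \<gamma>] that uc pC(1) by (simp add: g act_mult pos_perp_roots_def)
    moreover have "p \<bullet> \<gamma> \<in> pos_perp_roots W S (xI ` \<Lambda>)"
      using that x_conj_image[OF cl] by (intro Y_grpd_pos[OF xI x_conj_injections[OF cl] p]) simp
    ultimately show ?thesis
      by (simp add: pos_perp_roots_def)
  qed
  ultimately show "?g \<in> B_tilde W S I"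
    by (simp add: B_tilde_iff[OF I_subset])
qed

section \<open>The group B and the exact sequence\<close>

lemma A_group_iff:
  "A \<in> A_group W S \<Lambda> xI \<longleftrightarrow> A \<in> A_tilde W S \<Lambda> xI \<and>
    (\<forall>l\<in>A. \<forall>K \<in> irreducible_components W I. minus_one_type W S K \<longrightarrow> xI l \<notin> K)"
  by (auto simp: A_group_def)

lemma B_tilde_ZW: "w \<in> B_tilde W S I \<Longrightarrow> w \<in> ZW"
  by (simp add: B_tilde_def)

text \<open>Since \<open>sgn_set w\<close> always lies in \<open>A_tilde\<close>, only the condition
  on components of (-1)-type remains. In this form closure under products and inverses follows from
  \<open>sgn_set_mult\<close> and \<open>sgn_set_inv\<close>.\<close>

lemma B_iff: "w \<in> B \<longleftrightarrow> w \<in> B_tilde W S I \<and>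
    (\<forall>l\<in>sgn_set w. \<forall>K \<in> irreducible_components W I. minus_one_type W S K \<longrightarrow> xI l \<notin> K)"
  using sgn_set_in_A_tilde[OF B_tilde_ZW, of w] by (auto simp: B_group_def A_group_iff)

lemma B_closed: "w \<in> B \<Longrightarrow> w \<in> carrier W"
  using ZW_closed[OF B_tilde_ZW] by (simp add: B_iff)

lemma B_subset: "B \<subseteq> B_tilde W S I"
  by (auto simp: B_iff)

lemma B_ZW: "w \<in> B \<Longrightarrow> w \<in> ZW"
  using B_tilde_ZW by (simp add: B_iff)

lemma subgroup_B: "subgroup B W"
proof (rule subgroupI)
  note Bt = subgroup_B_tilde[OF I_subset]
  show "B \<subseteq> carrier W"
    using B_closed by blast
  have "\<one> \<in> B"
    using subgroup.one_closed[OF Bt] by (simp add: B_iff sgn_set_one)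
  then show "B \<noteq> {}"
    by blast
  show "inv a \<in> B" if "a \<in> B" for a
    using that subgroup.m_inv_closed[OF Bt, of a] sgn_set_inv[of a] B_tilde_ZW[of a] by (simp add: B_iff)
  show "a \<otimes> b \<in> B" if "a \<in> B" "b \<in> B" for a b
    using that subgroup.m_closed[OF Bt, of a b] sgn_set_mult[of a b] B_tilde_ZW[of a] B_tilde_ZW[of b]
    by (auto simp: B_iff)
qed

lemma g_elt_B: "maximal_tree W S \<Lambda> xI T \<Longrightarrow> A \<in> A_group W S \<Lambda> xI \<Longrightarrow> g_elt W S \<Lambda> xI T A \<in> B"
  using g_elt_B_tilde[of T A] sgn_set_g_elt[of T A] by (simp add: B_group_def A_group_def)

lemma Y_eq: "Y_grpd W S \<Lambda> xI xI = {w \<in> B. sgn_set w = {}}"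
proof (rule Set.set_eqI)
  fix w
  have "w \<in> Y_grpd W S \<Lambda> xI xI \<longleftrightarrow>
      w \<in> carrier W \<and> (\<forall>l\<in>\<Lambda>. w \<bullet> \<alpha> (xI l) = \<alpha> (xI l)) \<and> (\<forall>\<gamma>\<in>pos_perp_roots W S I. w \<bullet> \<gamma> \<in> \<Phi>p)"
    by (auto simp: Y_grpd_def C_grpd_iff)
  also have "\<dots> \<longleftrightarrow> w \<in> ZW \<and> sgn_set w = {} \<and> (\<forall>\<gamma>\<in>pos_perp_roots W S I. w \<bullet> \<gamma> \<in> \<Phi>p)"
    by (auto simp: centralizer_iff[OF I_subset] A_map_def alpha_neq_minus)
  also have "\<dots> \<longleftrightarrow> w \<in> {w \<in> B. sgn_set w = {}}"
    by (auto simp: B_iff B_tilde_iff[OF I_subset])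
  finally show "w \<in> Y_grpd W S \<Lambda> xI xI \<longleftrightarrow> w \<in> {w \<in> B. sgn_set w = {}}" .
qed

lemma subgroup_Y: "subgroup (Y_grpd W S \<Lambda> xI xI) W"
  unfolding Y_eq
proof (rule subgroupI)
  show "{w \<in> B. sgn_set w = {}} \<noteq> {}"
    using subgroup.one_closed[OF subgroup_B] sgn_set_one by blast
  show "inv a \<in> {w \<in> B. sgn_set w = {}}" if "a \<in> {w \<in> B. sgn_set w = {}}" for a
    using that subgroup.m_inv_closed[OF subgroup_B, of a] sgn_set_inv[OF B_ZW, of a] by simp
  show "a \<otimes> b \<in> {w \<in> B. sgn_set w = {}}"
    if "a \<in> {w \<in> B. sgn_set w = {}}" "b \<in> {w \<in> B. sgn_set w = {}}" for a b
    using that subgroup.m_closed[OF subgroup_B, of a b] sgn_set_mult[OF B_ZW B_ZW, of a b] by simp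
qed (use B_closed in blast)

lemma sgn_set_image_B:
  assumes "maximal_tree W S \<Lambda> xI T"
  shows "sgn_set ` B = A_group W S \<Lambda> xI"
proof
  show "sgn_set ` B \<subseteq> A_group W S \<Lambda> xI"
    by (auto simp: B_group_def)
  show "A_group W S \<Lambda> xI \<subseteq> sgn_set ` B"
  proof
    fix A
    assume A: "A \<in> A_group W S \<Lambda> xI"
    then have "sgn_set (g_elt W S \<Lambda> xI T A) = A"
      using assms by (intro sgn_set_g_elt) (auto simp: A_group_def)
    then show "A \<in> sgn_set ` B"
      using g_elt_B[OF assms A] by (metis image_eqI)
  qed
qed

lemma short_exact:
  assumes T: "maximal_tree W S \<Lambda> xI T"
  shows "short_exact_groups (W\<lparr>carrier := Y_grpd W S \<Lambda> xI xI\<rparr>) (\<lambda>w. w) (W\<lparr>carrier := B\<rparr>) sgn_set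
    (sym_diff_group (A_group W S \<Lambda> xI))"
proof -
  interpret Y: group "W\<lparr>carrier := Y_grpd W S \<Lambda> xI xI\<rparr>"
    using subgroup_Y by (rule subgroup.subgroup_is_group) (rule group_axioms)
  interpret B: group "W\<lparr>carrier := B\<rparr>"
    using subgroup_B by (rule subgroup.subgroup_is_group) (rule group_axioms)
  have img: "A \<in> A_group W S \<Lambda> xI \<longleftrightarrow> (\<exists>w\<in>B. A = sgn_set w)" for A
    using sgn_set_image_B[OF T] by blast
  have hom: "sgn_set \<in> hom (W\<lparr>carrier := B\<rparr>) (sym_diff_group (A_group W S \<Lambda> xI))"
    using img by (auto simp: hom_def sym_diff_group_def sgn_set_mult B_ZW)
  \<comment> \<open>Closure and the neutral element are inherited from B, because every member of
    the carrier is the sign set of an element of B.\<close>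
  have A: "group (sym_diff_group (A_group W S \<Lambda> xI))"
  proof (rule groupI)
    fix A A'
    assume "A \<in> carrier (sym_diff_group (A_group W S \<Lambda> xI))"
      "A' \<in> carrier (sym_diff_group (A_group W S \<Lambda> xI))"
    then obtain v w where vw: "v \<in> B" "A = sgn_set v" "w \<in> B" "A' = sgn_set w"
      by (auto simp: sym_diff_group_def img)
    then have "sym_diff A A' = sgn_set (v \<otimes> w)" "v \<otimes> w \<in> B"
      using sgn_set_mult[OF B_ZW B_ZW] subgroup.m_closed[OF subgroup_B] by auto
    then show "A \<otimes>\<^bsub>sym_diff_group (A_group W S \<Lambda> xI)\<^esub> A'
        \<in> carrier (sym_diff_group (A_group W S \<Lambda> xI))"
      by (auto simp: sym_diff_group_def img)
  next
    have "{} \<in> A_group W S \<Lambda> xI"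
      using subgroup.one_closed[OF subgroup_B] sgn_set_one by (auto simp: img)
    then show "\<one>\<^bsub>sym_diff_group (A_group W S \<Lambda> xI)\<^esub> \<in> carrier (sym_diff_group (A_group W S \<Lambda> xI))"
      by (simp add: sym_diff_group_def)
  qed (auto simp: sym_diff_group_def)
  have "kernel (W\<lparr>carrier := B\<rparr>) (sym_diff_group (A_group W S \<Lambda> xI)) sgn_set = Y_grpd W S \<Lambda> xI xI"
    by (auto simp: kernel_def sym_diff_group_def Y_eq)
  moreover have "(\<lambda>w. w) \<in> hom (W\<lparr>carrier := Y_grpd W S \<Lambda> xI xI\<rparr>) (W\<lparr>carrier := B\<rparr>)"
    by (auto simp: hom_def Y_eq)
  ultimately show ?thesis
    unfolding short_exact_groups_def
    using hom A Y.group_axioms B.group_axioms sgn_set_image_B[OF T]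
    by (simp add: group_hom_def group_hom_axioms_def sym_diff_group_def)
qed


section \<open>The decompositions\<close>

lemma Z_eq: "Z = generate W I \<inter> ZW"
  by (rule center_generate[OF I_subset])

lemma Z_B_tilde: "Z \<subseteq> B_tilde W S I"
proof
  fix z
  assume z: "z \<in> Z"
  then have "z \<bullet> \<gamma> = \<gamma>" if "\<gamma> \<in> perp_roots W S I" for \<gamma>
    using perp_rootsD[OF that] supp_root by (intro parabolic_fix[OF I_subset]) (auto simp: Z_eq)
  then show "z \<in> B_tilde W S I"
    using z by (auto simp: Z_eq B_tilde_iff[OF I_subset] pos_perp_roots_def)
qed

lemma Z_central: "z \<in> Z \<Longrightarrow> w \<in> ZW \<Longrightarrow> w \<otimes> z = z \<otimes> w"
  by (auto simp: Z_eq centralizer_def)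

lemma Z_conj: "z \<in> Z \<Longrightarrow> w \<in> ZW \<Longrightarrow> w \<otimes> z \<otimes> inv w = z"
  using Z_central[of z w] ZW_closed by (auto simp: Z_eq m_assoc)

lemma subgroup_Z: "subgroup Z W"
  unfolding Z_eq using generate_is_subgroup[of I] I_subset S_subset_carrier
  by (intro subgroups_Inter_pair subgroup_centralizer[OF I_subset]) auto

text \<open>A central z negates the simple roots in a union J of components and fixes the others in
  I. As z lies in W_I, it equals w_0(J), so every component of J is of (-1)-type. In B this forces J
  to be empty.\<close>

lemma Z_Int_B: "Z \<inter> B = {\<one>}"
proof
  show "{\<one>} \<subseteq> Z \<inter> B"
    using subgroup.one_closed[OF subgroup_Z] subgroup.one_closed[OF subgroup_B] by simp
  show "Z \<inter> B \<subseteq> {\<one>}"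
  proof
    fix z
    assume "z \<in> Z \<inter> B"
    then have z: "z \<in> generate W I" "z \<in> ZW" "z \<in> B"
      by (auto simp: Z_eq)
    have zc: "z \<in> carrier W"
      using z ZW_closed by blast
    let ?J = "xI ` sgn_set z"
    obtain \<K> where K: "finite_type W ?J" "\<K> \<subseteq> irreducible_components W I" "?J = \<Union>\<K>"
      using sgn_set_component_closed[OF z(2)] by (auto simp: component_closed_def)
    have J: "?J \<subseteq> I" "?J \<subseteq> S"
      using sgn_set_subset I_subset by auto
    have neg: "z \<bullet> \<alpha> j = - \<alpha> j" if "j \<in> ?J" for j
      using that by (auto simp: A_map_def)
    have other: "z \<bullet> \<alpha> i = \<alpha> i" if "i \<in> I" "i \<notin> ?J" for i
      using that ZW_act[OF z(2)] by auto
    have w0c: "w0 ?J \<in> carrier W"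
      using longest_elt_closed[OF J(2) K(1)] .
    have "w0 ?J \<otimes> z = \<one>"
    proof (rule parabolic_pos_imp_one[OF I_subset])
      have "generate W ?J \<subseteq> generate W I"
        using J(1) by (rule mono_generate)
      then show "w0 ?J \<otimes> z \<in> generate W I"
        using longest_elt_in[OF J(2) K(1)] z(1) by (auto intro: generate.eng)
      show "(w0 ?J \<otimes> z) \<bullet> \<alpha> i \<in> \<Phi>p" if i: "i \<in> I" for i
      proof (cases "i \<in> ?J")
        case True
        then obtain k where "k \<in> ?J" "w0 ?J \<bullet> \<alpha> i = - \<alpha> k"
          using longest_elt_simple[OF J(2) K(1)] by blast
        then show ?thesis
          using True neg J(2) w0c zc simple_root_pos by (simp add: act_mult act_minus subset_iff)
      next
        case False
        have "w0 ?J \<bullet> \<alpha> i = \<alpha> i"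
          using orthogonal_union_components[OF I_subset K(2) i] False K(3) i I_subset
          by (intro parabolic_fix_simple[OF J(2) longest_elt_in[OF J(2) K(1)]]) auto
        then show ?thesis
          using other[OF i False] i I_subset w0c zc simple_root_pos by (simp add: act_mult subset_iff)
      qed
    qed
    then have w0z: "w0 ?J = z"
      using w0c zc inv_longest_elt[OF J(2) K(1)] by (metis inv_equality inv_inv)
    have "\<K> \<subseteq> {{}}"
    proof
      fix C
      assume C: "C \<in> \<K>"
      then have CC: "C \<in> irreducible_components W I" "C \<subseteq> ?J" "C \<subseteq> S"
        using K J by auto
      have orth: "gram W c k = 0" if "c \<in> C" "k \<in> ?J - C" for c k
      proof -
        have "gram W k c = 0"
          using component_orthogonal[OF I_subset CC(1) that(1)] that(2) J(1) by blast
        moreover have "c \<in> S" "k \<in> S"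
          using that CC(3) J(2) by blast+
        ultimately show ?thesis
          using gram_commute[of c k] by simp
      qed
      have "w0 C \<bullet> \<alpha> c = - \<alpha> c" if "c \<in> C" for c
        using longest_elt_split[OF J(2) K(1) CC(2) orth that] neg CC(2) that w0z by auto
      then have "minus_one_type W S C"
        using finite_type_mono[OF K(1) CC(2)] component_irreducible[OF I_subset CC(1)]
        by (intro minus_one_typeI[OF CC(3)]) auto
      then have "xI l \<notin> C" if "l \<in> sgn_set z" for l
        using z(3) CC(1) that by (simp add: B_iff)
      then show "C \<in> {{}}"
        using CC(2) by blast
    qed
    then have "?J = {}"
      using K(3) by blast
    then have "z \<bullet> \<alpha> i \<in> \<Phi>p" if "i \<in> I" for i
      using other[OF that] that I_subset simple_root_pos by auto
    then show "z \<in> {\<one>}"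
      using parabolic_pos_imp_one[OF I_subset z(1)] by simp
  qed
qed

text \<open>The factor z is w_0(J) for the union J of those (-1)-type components that w negates. It
  is central and negates exactly J, so multiplication by it clears these components and changes no
  other sign.\<close>

lemma B_tilde_decomposition:
  assumes w: "w \<in> B_tilde W S I"
  obtains z b where "z \<in> Z" "b \<in> B" "w = z \<otimes> b"
proof -
  note wZ = B_tilde_ZW[OF w]
  let ?J = "xI ` sgn_set w"
  obtain \<K> where K: "finite_type W ?J" "\<K> \<subseteq> irreducible_components W I" "?J = \<Union>\<K>"
    using sgn_set_component_closed[OF wZ] by (auto simp: component_closed_def)
  define \<K>' where "\<K>' = {C \<in> irreducible_components W I. C \<subseteq> ?J \<and> minus_one_type W S C}"
  define J where "J = \<Union>\<K>'"
  have J1: "J \<subseteq> ?J"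
    by (auto simp: J_def \<K>'_def)
  have "?J \<subseteq> I"
    using sgn_set_subset by blast
  then have J: "J \<subseteq> ?J" "J \<subseteq> I" "J \<subseteq> S" "finite_type W J" "\<K>' \<subseteq> irreducible_components W I"
    using J1 I_subset finite_type_mono[OF K(1) J1] unfolding \<K>'_def by blast+
  note w0J = longest_elt_in[OF J(3,4)]
  have neg: "w0 J \<bullet> \<alpha> c = - \<alpha> c" if "c \<in> J" for c
  proof -
    obtain C where C: "C \<in> irreducible_components W I" "C \<subseteq> J" "minus_one_type W S C" "c \<in> C"
      using \<open>c \<in> J\<close> by (auto simp: J_def \<K>'_def)
    have "gram W d k = 0" if "d \<in> C" "k \<in> J - C" for d k
    proof -
      have "gram W k d = 0"
        using component_orthogonal[OF I_subset C(1) that(1)] that(2) J(2) by blast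
      moreover have "d \<in> S" "k \<in> S"
        using that C(2) J(3) by blast+
      ultimately show ?thesis
        using gram_commute[of d k] by simp
    qed
    then have "w0 J \<bullet> \<alpha> c = w0 C \<bullet> \<alpha> c"
      using longest_elt_split[OF J(3,4) C(2) _ C(4)] by blast
    also have "\<dots> = - \<alpha> c"
      using C J by (intro minus_one_type_act) auto
    finally show ?thesis .
  qed
  have other: "w0 J \<bullet> \<alpha> i = \<alpha> i" if "i \<in> I" "i \<notin> J" for i
    using orthogonal_union_components[OF I_subset J(5) that(1)] that I_subset
    by (intro parabolic_fix_simple[OF J(3) w0J]) (auto simp: J_def)
  have zc: "w0 J \<in> carrier W"
    using longest_elt_closed[OF J(3,4)] .
  have "generate W J \<subseteq> generate W I"
    using J(2) by (rule mono_generate)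
  then have zZ: "w0 J \<in> Z"
    using w0J neg other zc by (auto simp: Z_eq centralizer_iff[OF I_subset])
  then have zZW: "w0 J \<in> ZW"
    by (simp add: Z_eq)
  define b where "b = w0 J \<otimes> w"
  have bt: "b \<in> B_tilde W S I"
    unfolding b_def using subgroup.m_closed[OF subgroup_B_tilde[OF I_subset]] Z_B_tilde zZ w by blast
  have sb: "sgn_set b = sym_diff (sgn_set (w0 J)) (sgn_set w)"
    unfolding b_def by (rule sgn_set_mult[OF zZW wZ])
  have mem: "l \<in> sgn_set (w0 J) \<longleftrightarrow> xI l \<in> J" if "l \<in> \<Lambda>" for l
    using that neg[of "xI l"] other[of "xI l"] alpha_neq_minus[of "xI l" "xI l"]
    by (cases "xI l \<in> J") (auto simp: A_map_def)
  have "xI l \<notin> C"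
    if l: "l \<in> sgn_set b" and C: "C \<in> irreducible_components W I" "minus_one_type W S C" for l C
  proof
    assume lC: "xI l \<in> C"
    have lL: "l \<in> \<Lambda>"
      using l sgn_set_subset by blast
    have inj: "inj_on xI \<Lambda>"
      using xI by (simp add: injections_def)
    have lw: "l \<in> sgn_set w \<longleftrightarrow> xI l \<in> ?J"
      using inj_on_image_mem_iff[OF inj lL sgn_set_subset] by simp
    show False
    proof (cases "xI l \<in> J")
      case True
      then show False
        using l mem[OF lL] lw J(1) by (auto simp: sb)
    next
      case False
      then have "xI l \<in> ?J"
        using l mem[OF lL] lw by (auto simp: sb)
      \<comment> \<open>Components through a common point coincide, so C lies in the part negated by
        w and is one of the components that make up J.\<close>
      then obtain C' where C': "C' \<in> \<K>" "xI l \<in> C'"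
        using K(3) by blast
      then have "C' = C"
        using component_eq[OF I_subset _ C'(2)] component_eq[OF I_subset C(1) lC] K(2) by blast
      then have "C \<in> \<K>'"
        using C C' K(3) by (auto simp: \<K>'_def)
      then show False
        using False lC by (auto simp: J_def)
    qed
  qed
  then have "b \<in> B"
    using bt by (simp add: B_iff)
  moreover have "w = w0 J \<otimes> b"
    using zc ZW_closed[OF wZ] longest_elt_square[OF J(3,4)] by (simp add: b_def m_assoc[symmetric])
  ultimately show thesis
    using zZ that by blast
qed

lemma Z_times_B: "Z <#> B = B_tilde W S I"
proof
  show "Z <#> B \<subseteq> B_tilde W S I"
    using Z_B_tilde B_subset subgroup.m_closed[OF subgroup_B_tilde[OF I_subset]]
    by (auto simp: set_mult_def subset_iff)
  show "B_tilde W S I \<subseteq> Z <#> B"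
    by (auto simp: set_mult_def elim!: B_tilde_decomposition)
qed

lemma B_conj:
  assumes b: "b \<in> B" and w: "w \<in> B_tilde W S I"
  shows "w \<otimes> b \<otimes> inv w \<in> B"
proof -
  note Bt = subgroup_B_tilde[OF I_subset]
  have iw: "inv w \<in> B_tilde W S I"
    using subgroup.m_inv_closed[OF Bt w] .
  have bt: "b \<in> B_tilde W S I"
    using b B_subset by blast
  have wb: "w \<otimes> b \<in> B_tilde W S I"
    using subgroup.m_closed[OF Bt w bt] .
  have "sgn_set (w \<otimes> b \<otimes> inv w) = sym_diff (sym_diff (sgn_set w) (sgn_set b)) (sgn_set w)"
    using B_tilde_ZW[OF w] B_tilde_ZW[OF iw] B_tilde_ZW[OF bt] B_tilde_ZW[OF wb]
    by (simp only: sgn_set_mult sgn_set_inv)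
  also have "\<dots> = sgn_set b"
    by blast
  finally show ?thesis
    using b subgroup.m_closed[OF Bt wb iw] by (simp add: B_iff)
qed

abbreviation "Wp \<equiv> W_perp W S I"

lemma Wp_ZW: "Wp \<subseteq> ZW"
  by (rule W_perp_subset_centralizer[OF I_subset])

text \<open>The two factors commute elementwise, because \<open>Wp\<close> centralizes W_I, which
  contains Z.\<close>

lemma Z_times_Wp_subgroup: "subgroup (Z <#> Wp) W"
proof (rule subgroupI)
  have zu: "z \<in> carrier W" "u \<in> carrier W" "u \<otimes> z = z \<otimes> u" if "z \<in> Z" "u \<in> Wp" for z u
    using that Wp_ZW ZW_closed Z_central[OF that(1), of u] by (auto simp: Z_eq)
  show "Z <#> Wp \<subseteq> carrier W"
    using zu by (auto simp: set_mult_def)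
  have "\<one> \<otimes> \<one> \<in> Z <#> Wp"
    using subgroup.one_closed[OF subgroup_Z] subgroup.one_closed[OF subgroup_W_perp]
    unfolding set_mult_def by blast
  then show "Z <#> Wp \<noteq> {}"
    by blast
  show "inv a \<in> Z <#> Wp" if ah: "a \<in> Z <#> Wp" for a
  proof -
    obtain z u where a: "z \<in> Z" "u \<in> Wp" "a = z \<otimes> u"
      using ah by (auto simp: set_mult_def)
    have i: "inv z \<in> Z" "inv u \<in> Wp"
      using subgroup.m_inv_closed[OF subgroup_Z a(1)] subgroup.m_inv_closed[OF subgroup_W_perp a(2)] by auto
    have "inv a = inv z \<otimes> inv u"
      using zu[OF a(1,2)] zu(3)[OF i] by (simp add: a(3) inv_mult_group)
    with i show ?thesis
      by (auto simp: set_mult_def)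
  qed
  show "a \<otimes> b \<in> Z <#> Wp" if ah: "a \<in> Z <#> Wp" and bh: "b \<in> Z <#> Wp" for a b
  proof -
    obtain z u where a: "z \<in> Z" "u \<in> Wp" "a = z \<otimes> u"
      using ah by (auto simp: set_mult_def)
    obtain y v where b: "y \<in> Z" "v \<in> Wp" "b = y \<otimes> v"
      using bh by (auto simp: set_mult_def)
    have m: "z \<otimes> y \<in> Z" "u \<otimes> v \<in> Wp"
      using subgroup.m_closed[OF subgroup_Z a(1) b(1)] subgroup.m_closed[OF subgroup_W_perp a(2) b(2)] by auto
    have "a \<otimes> b = z \<otimes> (u \<otimes> y) \<otimes> v"
      using zu[OF a(1,2)] zu[OF b(1,2)] by (simp add: a(3) b(3) m_assoc)
    also have "\<dots> = (z \<otimes> y) \<otimes> (u \<otimes> v)"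
      using zu[OF a(1,2)] zu[OF b(1,2)] zu(3)[OF b(1) a(2)] by (simp add: m_assoc)
    finally show ?thesis
      using m by (auto simp: set_mult_def)
  qed
qed

lemma Z_Int_Wp: "Z \<inter> Wp = {\<one>}"
  using W_perp_Int_B_tilde[OF I_subset] Z_B_tilde subgroup.one_closed[OF subgroup_Z] by blast

lemma direct_product_B_tilde: "internal_direct_product (W\<lparr>carrier := B_tilde W S I\<rparr>) Z B"
proof -
  have "Z \<lhd> W\<lparr>carrier := B_tilde W S I\<rparr>"
    using subgroup_Z subgroup_B_tilde[OF I_subset] Z_B_tilde Z_conj B_tilde_ZW
    by (intro normal_in_subgroupI) auto
  moreover have "B \<lhd> W\<lparr>carrier := B_tilde W S I\<rparr>"
    using subgroup_B subgroup_B_tilde[OF I_subset] B_subset B_conj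
    by (intro normal_in_subgroupI) auto
  ultimately show ?thesis
    using Z_Int_B Z_times_B by (simp add: internal_direct_product_def set_mult_def)
qed

lemma semidirect_product_B_tilde: "internal_semidirect_product (W\<lparr>carrier := ZW\<rparr>) Wp (B_tilde W S I)"
proof -
  note ZWs = subgroup_centralizer[OF I_subset]
  have "Wp \<lhd> W\<lparr>carrier := ZW\<rparr>"
    using subgroup_W_perp ZWs Wp_ZW W_perp_conj[OF I_subset] by (intro normal_in_subgroupI) auto
  moreover have "subgroup (B_tilde W S I) (W\<lparr>carrier := ZW\<rparr>)"
    using subgroup_B_tilde[OF I_subset] ZWs B_tilde_ZW by (intro subgroup_incl) auto
  moreover have "Wp <#> B_tilde W S I = ZW"
  proof
    show "Wp <#> B_tilde W S I \<subseteq> ZW"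
      using Wp_ZW B_tilde_ZW subgroup.m_closed[OF ZWs] by (auto simp: set_mult_def subset_iff)
    show "ZW \<subseteq> Wp <#> B_tilde W S I"
      by (auto simp: set_mult_def elim!: centralizer_decomposition[OF I_subset])
  qed
  ultimately show ?thesis
    using W_perp_Int_B_tilde[OF I_subset] by (simp add: internal_semidirect_product_def set_mult_def)
qed

lemma semidirect_product_B: "internal_semidirect_product (W\<lparr>carrier := ZW\<rparr>) (Z <#> Wp) B"
proof -
  note ZWs = subgroup_centralizer[OF I_subset]
  have ZZW: "Z \<subseteq> ZW"
    by (simp add: Z_eq)
  have sub: "Z <#> Wp \<subseteq> ZW"
    using ZZW Wp_ZW subgroup.m_closed[OF ZWs] by (auto simp: set_mult_def subset_iff)
  have "Z <#> Wp \<lhd> W\<lparr>carrier := ZW\<rparr>"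
  proof (rule normal_in_subgroupI[OF Z_times_Wp_subgroup ZWs sub])
    fix w n
    assume w: "w \<in> ZW" and "n \<in> Z <#> Wp"
    then obtain z u where n: "z \<in> Z" "u \<in> Wp" "n = z \<otimes> u"
      by (auto simp: set_mult_def)
    have c: "w \<in> carrier W" "z \<in> carrier W" "u \<in> carrier W"
      using w n ZZW Wp_ZW ZW_closed by auto
    have "w \<otimes> n \<otimes> inv w = (w \<otimes> z) \<otimes> u \<otimes> inv w"
      using c by (simp add: n(3) m_assoc)
    also have "\<dots> = z \<otimes> (w \<otimes> u \<otimes> inv w)"
      using c by (simp add: Z_central[OF n(1) w] m_assoc)
    finally show "w \<otimes> n \<otimes> inv w \<in> Z <#> Wp"
      using n(1) W_perp_conj[OF I_subset w n(2)] by (auto simp: set_mult_def)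
  qed
  moreover have "subgroup B (W\<lparr>carrier := ZW\<rparr>)"
    using subgroup_B ZWs B_ZW by (intro subgroup_incl) auto
  moreover have "(Z <#> Wp) \<inter> B = {\<one>}"
  proof
    show "{\<one>} \<subseteq> (Z <#> Wp) \<inter> B"
      using subgroup.one_closed[OF Z_times_Wp_subgroup] subgroup.one_closed[OF subgroup_B] by simp
    show "(Z <#> Wp) \<inter> B \<subseteq> {\<one>}"
    proof
      fix b
      assume "b \<in> (Z <#> Wp) \<inter> B"
      then obtain z u where n: "z \<in> Z" "u \<in> Wp" "b = z \<otimes> u" and b: "b \<in> B"
        by (auto simp: set_mult_def)
      have c: "z \<in> carrier W" "u \<in> carrier W"
        using n ZZW Wp_ZW ZW_closed by auto
      \<comment> \<open>Since b and z lie in \<open>B_tilde\<close>, so does u, which is therefore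
        trivial. This leaves b in Z, and \<open>Z_Int_B\<close> finishes.\<close>
      have "inv z \<otimes> b \<in> B_tilde W S I"
        using subgroup.m_closed[OF subgroup_B_tilde[OF I_subset]]
          subgroup.m_inv_closed[OF subgroup_B_tilde[OF I_subset]] n(1) Z_B_tilde B_subset b by blast
      moreover have "inv z \<otimes> b = u"
        using c n(3) by (simp add: inv_cancel_left)
      ultimately have "u \<in> Wp \<inter> B_tilde W S I"
        using n(2) by simp
      then have "u = \<one>"
        using W_perp_Int_B_tilde[OF I_subset] by blast
      then have "b \<in> Z \<inter> B"
        using n b c by simp
      then show "b \<in> {\<one>}"
        using Z_Int_B by blast
    qed
  qed
  moreover have "(Z <#> Wp) <#> B = ZW"
  proof
    show "(Z <#> Wp) <#> B \<subseteq> ZW"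
      using sub B_ZW subgroup.m_closed[OF ZWs] unfolding set_mult_def[of W "Z <#> Wp"] by blast
    show "ZW \<subseteq> (Z <#> Wp) <#> B"
    proof
      fix w
      assume "w \<in> ZW"
      then obtain u a where w: "u \<in> Wp" "a \<in> B_tilde W S I" "w = u \<otimes> a"
        using centralizer_decomposition[OF I_subset] by blast
      obtain z b where a: "z \<in> Z" "b \<in> B" "a = z \<otimes> b"
        using B_tilde_decomposition[OF w(2)] by blast
      have c: "u \<in> carrier W" "z \<in> carrier W" "b \<in> carrier W"
        using w a ZZW Wp_ZW ZW_closed B_closed by auto
      have "u \<otimes> z = z \<otimes> u"
        using Z_central[OF a(1)] w(1) Wp_ZW by blast
      then have "w = (z \<otimes> u) \<otimes> b"
        using c by (simp add: w(3) a(3) m_assoc[symmetric])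
      moreover have "z \<otimes> u \<in> Z <#> Wp"
        using a(1) w(1) by (auto simp: set_mult_def)
      ultimately show "w \<in> (Z <#> Wp) <#> B"
        using a(2) unfolding set_mult_def[of W "Z <#> Wp"] by blast
    qed
  qed
  ultimately show ?thesis
    by (simp add: internal_semidirect_product_def set_mult_def)
qed

lemma direct_product_Wp: "internal_direct_product (W\<lparr>carrier := Z <#> Wp\<rparr>) Z Wp"
proof -
  have one: "\<one> \<in> Z" "\<one> \<in> Wp"
    using subgroup.one_closed[OF subgroup_Z] subgroup.one_closed[OF subgroup_W_perp] by auto
  have c: "Z \<subseteq> carrier W" "Wp \<subseteq> carrier W"
    using subgroup.subset[OF subgroup_Z] subgroup.subset[OF subgroup_W_perp] by auto
  have ZWs: "Z <#> Wp \<subseteq> ZW"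
    using Wp_ZW subgroup.m_closed[OF subgroup_centralizer[OF I_subset]]
    by (auto simp: set_mult_def Z_eq subset_iff)
  have sub: "Z \<subseteq> Z <#> Wp" "Wp \<subseteq> Z <#> Wp"
  proof -
    show "Z \<subseteq> Z <#> Wp"
    proof
      fix z
      assume "z \<in> Z"
      moreover from this have "z = z \<otimes> \<one>"
        using c by auto
      ultimately show "z \<in> Z <#> Wp"
        using one unfolding set_mult_def by blast
    qed
    show "Wp \<subseteq> Z <#> Wp"
    proof
      fix u
      assume "u \<in> Wp"
      moreover from this have "u = \<one> \<otimes> u"
        using c by auto
      ultimately show "u \<in> Z <#> Wp"
        using one unfolding set_mult_def by blast
    qed
  qed
  have "Z \<lhd> W\<lparr>carrier := Z <#> Wp\<rparr>"
  proof (rule normal_in_subgroupI[OF subgroup_Z Z_times_Wp_subgroup sub(1)])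
    fix h n
    assume "h \<in> Z <#> Wp" "n \<in> Z"
    then show "h \<otimes> n \<otimes> inv h \<in> Z"
      using Z_conj[of n h] ZWs by auto
  qed
  moreover have "Wp \<lhd> W\<lparr>carrier := Z <#> Wp\<rparr>"
  proof (rule normal_in_subgroupI[OF subgroup_W_perp Z_times_Wp_subgroup sub(2)])
    fix h n
    assume "h \<in> Z <#> Wp" "n \<in> Wp"
    then show "h \<otimes> n \<otimes> inv h \<in> Wp"
      using W_perp_conj[OF I_subset] ZWs by blast
  qed
  ultimately show ?thesis
    using Z_Int_Wp by (simp add: internal_direct_product_def set_mult_def)
qed

text \<open>\<open>AutoGroup\<close> consists of extensional bijections, which explains the bounded
  abstractions. The inverse map is conjugation by \<open>inv b\<close>.\<close>

lemma conj_B_hom_Auto: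
  "(\<lambda>b\<in>B. \<lambda>w\<in>Wp. b \<otimes> w \<otimes> inv b) \<in> hom (W\<lparr>carrier := B\<rparr>) (AutoGroup (W\<lparr>carrier := Wp\<rparr>))"
proof -
  define c where "c = (\<lambda>b. \<lambda>w\<in>Wp. b \<otimes> w \<otimes> inv b)"
  have uc: "u \<in> carrier W" if "u \<in> Wp" for u
    using that Wp_ZW ZW_closed by blast
  have in_Wp: "b \<otimes> u \<otimes> inv b \<in> Wp" if "b \<in> B" "u \<in> Wp" for b u
    using W_perp_conj[OF I_subset] B_ZW that by blast
  have comp: "a \<otimes> b \<otimes> u \<otimes> inv (a \<otimes> b) = a \<otimes> (b \<otimes> u \<otimes> inv b) \<otimes> inv a"
    if "a \<in> B" "b \<in> B" "u \<in> Wp" for a b u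
    using that B_closed uc by (simp add: m_assoc inv_mult_group)
  have ib: "inv b \<in> B" if "b \<in> B" for b
    using subgroup.m_inv_closed[OF subgroup_B that] .
  have bij: "bij_betw (c b) Wp Wp" if b: "b \<in> B" for b
  proof (rule bij_betw_byWitness[where f' = "c (inv b)"])
    have bc: "b \<in> carrier W"
      using b B_closed by blast
    show "\<forall>u\<in>Wp. c (inv b) (c b u) = u"
      using comp[OF ib[OF b] b] in_Wp[OF b] bc uc by (simp add: c_def)
    show "\<forall>u\<in>Wp. c b (c (inv b) u) = u"
      using comp[OF b ib[OF b]] in_Wp[OF ib[OF b]] bc uc by (simp add: c_def)
    show "c b ` Wp \<subseteq> Wp" "c (inv b) ` Wp \<subseteq> Wp"
      using in_Wp[OF b] in_Wp[OF ib[OF b]] by (auto simp: c_def)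
  qed
  have c_Bij: "c b \<in> Bij Wp" if "b \<in> B" for b
    using bij[OF that] by (simp add: Bij_def c_def)
  have c_hom: "c b \<in> hom (W\<lparr>carrier := Wp\<rparr>) (W\<lparr>carrier := Wp\<rparr>)" if b: "b \<in> B" for b
  proof -
    have "b \<otimes> (u \<otimes> v) \<otimes> inv b = (b \<otimes> u \<otimes> inv b) \<otimes> (b \<otimes> v \<otimes> inv b)" if "u \<in> Wp" "v \<in> Wp" for u v
      using B_closed[OF b] uc that by (simp add: m_assoc inv_cancel_left)
    then show ?thesis
      using in_Wp[OF b] subgroup.m_closed[OF subgroup_W_perp] by (auto simp: hom_def c_def)
  qed
  have c_mult: "c (a \<otimes> b) = compose Wp (c a) (c b)" if "a \<in> B" "b \<in> B" for a b
    using comp[OF that] in_Wp[OF that(2)] by (auto simp: c_def compose_def fun_eq_iff)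
  have "restrict c B \<in> hom (W\<lparr>carrier := B\<rparr>) (AutoGroup (W\<lparr>carrier := Wp\<rparr>))"
    using c_Bij c_hom c_mult subgroup.m_closed[OF subgroup_B]
    by (auto simp: hom_def AutoGroup_def BijGroup_def auto_def)
  then show ?thesis
    by (simp add: c_def)
qed

end

end


theorem theorem5p2:
  fixes W :: "('a, 'm) monoid_scheme" and S I :: "'a set"
    and \<Lambda> :: "'l set" and xI :: "'l \<Rightarrow> 'a"
    and T :: "('l \<Rightarrow> 'a, ('l, 'a) arc) pre_digraph"
  assumes "coxeter_system W S"
    and "I \<subseteq> S"
    and "xI \<in> injections \<Lambda> S" and "xI ` \<Lambda> = I"
    and "maximal_tree W S \<Lambda> xI T"
  shows
    "let ZW = centralizer W (generate W I);
         Z = center (W\<lparr>carrier := generate W I\<rparr>);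
         Wp = W_perp W S I;
         Bt = B_tilde W S I;
         B = B_group W S \<Lambda> xI;
         Y = Y_grpd W S \<Lambda> xI xI;
         \<A> = A_group W S \<Lambda> xI
     in
       subgroup B (W\<lparr>carrier := Bt\<rparr>) \<and>
       (\<forall>A\<in>\<A>. g_elt W S \<Lambda> xI T A \<in> B) \<and>
       short_exact_groups
         (W\<lparr>carrier := Y\<rparr>) (\<lambda>w. w)
         (W\<lparr>carrier := B\<rparr>) (A_map W S \<Lambda> xI)
         (sym_diff_group \<A>) \<and>
       internal_direct_product (W\<lparr>carrier := Bt\<rparr>) Z B \<and>
       internal_semidirect_product (W\<lparr>carrier := ZW\<rparr>) Wp (Z <#>\<^bsub>W\<^esub> B) \<and>
       internal_direct_product (W\<lparr>carrier := Z <#>\<^bsub>W\<^esub> B\<rparr>) Z B \<and>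
       internal_semidirect_product (W\<lparr>carrier := ZW\<rparr>) (Z <#>\<^bsub>W\<^esub> Wp) B \<and>
       internal_direct_product (W\<lparr>carrier := Z <#>\<^bsub>W\<^esub> Wp\<rparr>) Z Wp \<and>
       (\<lambda>b\<in>B. \<lambda>w\<in>Wp. b \<otimes>\<^bsub>W\<^esub> w \<otimes>\<^bsub>W\<^esub> inv\<^bsub>W\<^esub> b)
         \<in> hom (W\<lparr>carrier := B\<rparr>) (AutoGroup (W\<lparr>carrier := Wp\<rparr>)) \<and>
       (\<forall>b\<in>B. (\<lambda>w. b \<otimes>\<^bsub>W\<^esub> w \<otimes>\<^bsub>W\<^esub> inv\<^bsub>W\<^esub> b) ` R_perp W S I = R_perp W S I)"
proof -
  interpret coxeter W S
    by unfold_locales (rule assms(1))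
  note xI = assms(3) and T = assms(5)
  show ?thesis
    unfolding Let_def assms(4)[symmetric]
  proof (intro conjI ballI)
    show "subgroup (B_group W S \<Lambda> xI) (W\<lparr>carrier := B_tilde W S (xI ` \<Lambda>)\<rparr>)"
      using subgroup_B[OF xI] subgroup_B_tilde[OF I_subset[OF xI]] B_subset[OF xI] by (rule subgroup_incl)
    show "g_elt W S \<Lambda> xI T A \<in> B_group W S \<Lambda> xI" if "A \<in> A_group W S \<Lambda> xI" for A
      using g_elt_B[OF xI T that] .
    show "(\<lambda>w. b \<otimes>\<^bsub>W\<^esub> w \<otimes>\<^bsub>W\<^esub> inv\<^bsub>W\<^esub> b) ` R_perp W S (xI ` \<Lambda>) = R_perp W S (xI ` \<Lambda>)"
      if "b \<in> B_group W S \<Lambda> xI" for b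
      using R_perp_conj[OF I_subset[OF xI]] B_subset[OF xI] that by blast
  \<comment> \<open>Replacing the product of Z and B by \<open>B_tilde\<close> turns both claims
    that mention this product into the facts proved for \<open>B_tilde\<close>.\<close>
  qed (use short_exact[OF xI T] direct_product_B_tilde[OF xI] semidirect_product_B_tilde[OF xI]
      semidirect_product_B[OF xI] direct_product_Wp[OF xI] conj_B_hom_Auto[OF xI]
      in \<open>simp_all only: Z_times_B[OF xI]\<close>)
qed

end
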